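(* Let $k$ be a field and let $\mathcal{C}$ be an essentially small $k$-linear Hom-finite triangulated category with split idempotents and suspension functor $\Sigma$. Let $w \geqslant 2$ be an integer, $\mathcal{S}$ a $w$-simple minded system in $\mathcal{C}$, and assume that $\mathcal{C}$ is $(-w)$-Calabi--Yau. Let $\mathcal{S}',\mathcal{S}'' \subseteq \mathcal{S}$ be subsets. (Left tilting) The left tilt $L_{\mathcal{S}'}(\mathcal{S})$ and the classes $\mathcal{T} = \langle \mathcal{S}' \rangle$, $\mathcal{F} = \langle \mathcal{S}' \rangle^{\perp} \cap \langle \mathcal{S} \rangle$ have the following properties. (i) $L_{\mathcal{S}'}(\mathcal{S})$ is a $w$-simple minded system. (ii) The abelian category $\langle \mathcal{S} \rangle$ has the torsion pair $(\mathcal{T},\mathcal{F})$. (iii) The abelian category $\langle L_{\mathcal{S}'}(\mathcal{S}) \rangle$ has the torsion pair $(\mathcal{F},\Sigma^{-1}\mathcal{T})$. (Right tilting) The right tilt $R_{\mathcal{S}''}(\mathcal{S})$ and the classes $\mathcal{U} = {}^{\perp}\langle \mathcal{S}'' \rangle \cap \langle \mathcal{S} \rangle$, $\mathcal{G} = \langle \mathcal{S}'' \rangle$ have the following properties. (i) $R_{\mathcal{S}''}(\mathcal{S})$ is a $w$-simple minded system. (ii) The abelian category $\langle \mathcal{S} \rangle$ has the torsion pair $(\mathcal{U},\mathcal{G})$. (iii) The abelian category $\langle R_{\mathcal{S}''}(\mathcal{S}) \rangle$ has the torsion pair $(\Sigma\mathcal{G},\mathcal{U})$.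
   Context: $\mathcal{C}(x,y)$ denotes the Hom space in $\mathcal{C}$. $\mathcal{C}$ is $(-w)$-Calabi--Yau if there are natural isomorphisms $\mathcal{C}(x,y) \cong \operatorname{Hom}_k(\mathcal{C}(y,\Sigma^{-w}x),k)$, i.e. $\Sigma^{-w}$ is a Serre functor. A diagram $c' \to c \to c''$ in $\mathcal{C}$ is a short triangle if it can be completed to a (distinguished) triangle $c' \to c \to c'' \to \Sigma c'$. For full subcategories $\mathcal{A},\mathcal{B} \subseteq \mathcal{C}$, $\mathcal{A} * \mathcal{B}$ is the full subcategory of objects $e$ for which there is a short triangle $a \to e \to b$ with $a \in \mathcal{A}$, $b \in \mathcal{B}$; this operation is associative. The extension closure of a set $\mathcal{S}$ of objects is $\langle \mathcal{S} \rangle = \bigcup_{n \geqslant 0} (\mathcal{S})_n$, where $(\mathcal{S})_0 = \{0\}$ and $(\mathcal{S})_n = (\mathcal{S})_{n-1} * (\mathcal{S} \cup \{0\})$ for $n \geqslant 1$. A $w$-orthogonal collection in $\mathcal{C}$ is a finite set $\mathcal{S} = \{ s_1, \ldots, s_e \}$ of objects such that: (a) $\mathcal{C}(s_i,s_j)$ is a skew field if $i=j$ and is $0$ if $i \neq j$; (b) $\mathcal{C}(s_i,\Sigma^{\ell}s_j) = 0$ for all $i,j$ and all $\ell \in \{ -w+1, \ldots, -1 \}$. A $w$-simple minded system is a $w$-orthogonal collection $\mathcal{S}$ with $\mathcal{C} = \langle \mathcal{S} \rangle * \Sigma^{-1}\langle \mathcal{S} \rangle * \cdots * \Sigma^{-w+1}\langle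 \mathcal{S} \rangle$. For $w \geqslant 2$ the extension closure of a $w$-orthogonal collection is an abelian category whose short exact sequences are precisely the short triangles with all terms in it. For a class $\mathcal{X}$ of objects, $\mathcal{X}^{\perp} = \{ c \in \mathcal{C} \mid \mathcal{C}(\mathcal{X},c)=0 \}$ and ${}^{\perp}\mathcal{X} = \{ c \in \mathcal{C} \mid \mathcal{C}(c,\mathcal{X})=0 \}$. An $\mathcal{X}$-cover of $c$ is a morphism $\tau: x \to c$ with $x \in \mathcal{X}$ through which every morphism $x' \to c$ with $x' \in \mathcal{X}$ factors, and which is right minimal (every endomorphism $\varphi$ of $x$ with $\tau\varphi = \tau$ is an automorphism). $\mathcal{X}$-envelopes are defined dually. Left tilt: $L_{\mathcal{S}'}(\mathcal{S})$ is defined if each $s \in \mathcal{S}\setminus\mathcal{S}'$ has a $(\Sigma^{-1}\langle \mathcal{S}' \rangle)$-cover $\tau_s: \Sigma^{-1}t_s \to s$. Then $L_{\mathcal{S}'}(\mathcal{S}) = \{ L_{\mathcal{S}'}(s) \mid s \in \mathcal{S} \}$, where $L_{\mathcal{S}'}(s)$ is given by a triangle $\Sigma^{-1}t_s \xrightarrow{\tau_s} s \to L_{\mathcal{S}'}(s) \to t_s$ if $s \in \mathcal{S}\setminus\mathcal{S}'$, and $L_{\mathcal{S}'}(s) = \Sigma^{-1}s$ if $s \in \mathcal{S}'$. Right tilt: $R_{\mathcal{S}''}(\mathcal{S})$ is defined if each $s \in \mathcal{S}\setminus\mathcal{S}''$ has a $(\Sigma\langle \mathcal{S}'' \rangle)$-envelope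 $\gamma_s: s \to \Sigma g_s$. Then $R_{\mathcal{S}''}(\mathcal{S}) = \{ R_{\mathcal{S}''}(s) \mid s \in \mathcal{S} \}$, where $R_{\mathcal{S}''}(s)$ is given by a triangle $g_s \to R_{\mathcal{S}''}(s) \to s \xrightarrow{\gamma_s} \Sigma g_s$ if $s \in \mathcal{S}\setminus\mathcal{S}''$, and $R_{\mathcal{S}''}(s) = \Sigma s$ if $s \in \mathcal{S}''$. If $\mathcal{S}$ is a $w$-simple minded system, these covers and envelopes exist, so both tilts are defined. A torsion pair $(\mathcal{T},\mathcal{F})$ in an abelian category is a pair of full subcategories closed under isomorphisms, with no non-zero morphisms from $\mathcal{T}$ to $\mathcal{F}$, such that each object $a$ has a short exact sequence $0 \to t \to a \to f \to 0$ with $t \in \mathcal{T}$, $f \in \mathcal{F}$. *)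

theory Defs
  imports "Jordan_Normal_Form.Missing_VectorSpace"
begin

section \<open>Linear categories\<close>

text \<open>
  The objects are all elements of the type \<^typ>\<open>'o\<close>, so every category below is small; up to
  equivalence these are the essentially small categories.  The Hom spaces are modules in the sense
  of HOL-Algebra (the multiplicative part of the \<^typ>\<open>('k, 'm) module\<close> record is not used).
\<close>

record ('k, 'o, 'm) lin_cat =
  Hom :: "'o \<Rightarrow> 'o \<Rightarrow> ('k, 'm) module"
  Id :: "'o \<Rightarrow> 'm"
  Comp :: "'m \<Rightarrow> 'm \<Rightarrow> 'm"  (infixl \<open>\<cdot>\<index>\<close> 70)

abbreviation Mor :: "('k, 'o, 'm, 'z) lin_cat_scheme \<Rightarrow> 'o \<Rightarrow> 'o \<Rightarrow> 'm set"
  where "Mor C x y \<equiv> carrier (Hom C x y)"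

abbreviation Zero :: "('k, 'o, 'm, 'z) lin_cat_scheme \<Rightarrow> 'o \<Rightarrow> 'o \<Rightarrow> 'm"
  where "Zero C x y \<equiv> \<zero>\<^bsub>Hom C x y\<^esub>"

locale linear_category =
  fixes K :: "'k ring" and C :: "('k, 'o, 'm, 'z) lin_cat_scheme" (structure)
  assumes field_K: "field K"
    and hom_vectorspace: "vectorspace K (Hom C x y)"
    and hom_disjoint: "f \<in> Mor C x y \<Longrightarrow> f \<in> Mor C x' y' \<Longrightarrow> x = x' \<and> y = y'"
    and id_closed: "Id C x \<in> Mor C x x"
    and comp_closed: "f \<in> Mor C x y \<Longrightarrow> g \<in> Mor C y z \<Longrightarrow> g \<cdot> f \<in> Mor C x z"
    and comp_assoc: "f \<in> Mor C x y \<Longrightarrow> g \<in> Mor C y z \<Longrightarrow> h \<in> Mor C z u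
           \<Longrightarrow> (h \<cdot> g) \<cdot> f = h \<cdot> (g \<cdot> f)"
    and id_left: "f \<in> Mor C x y \<Longrightarrow> Id C y \<cdot> f = f"
    and id_right: "f \<in> Mor C x y \<Longrightarrow> f \<cdot> Id C x = f"
    and precomp_linear: "f \<in> Mor C x y \<Longrightarrow> (\<lambda>g. g \<cdot> f) \<in> module_hom K (Hom C y z) (Hom C x z)"
    and postcomp_linear: "g \<in> Mor C y z \<Longrightarrow> (\<lambda>f. g \<cdot> f) \<in> module_hom K (Hom C x y) (Hom C x z)"

definition is_iso :: "('k, 'o, 'm, 'z) lin_cat_scheme \<Rightarrow> 'o \<Rightarrow> 'o \<Rightarrow> 'm \<Rightarrow> bool"
  where "is_iso C x y f \<longleftrightarrow> f \<in> Mor C x y \<and>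
    (\<exists>g \<in> Mor C y x. g \<cdot>\<^bsub>C\<^esub> f = Id C x \<and> f \<cdot>\<^bsub>C\<^esub> g = Id C y)"

definition isomorphic :: "('k, 'o, 'm, 'z) lin_cat_scheme \<Rightarrow> 'o \<Rightarrow> 'o \<Rightarrow> bool"
  where "isomorphic C x y \<longleftrightarrow> (\<exists>f. is_iso C x y f)"

definition zero_object :: "('k, 'o, 'm, 'z) lin_cat_scheme \<Rightarrow> 'o \<Rightarrow> bool"
  where "zero_object C x \<longleftrightarrow> (\<forall>y. Mor C x y = {Zero C x y} \<and> Mor C y x = {Zero C y x})"

definition biproduct :: "('k, 'o, 'm, 'z) lin_cat_scheme \<Rightarrow> 'o \<Rightarrow> 'o \<Rightarrow> 'o \<Rightarrow> bool"
  where "biproduct C x y b \<longleftrightarrow>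
    (\<exists>i \<in> Mor C x b. \<exists>j \<in> Mor C y b. \<exists>p \<in> Mor C b x. \<exists>q \<in> Mor C b y.
       p \<cdot>\<^bsub>C\<^esub> i = Id C x \<and> q \<cdot>\<^bsub>C\<^esub> j = Id C y \<and>
       q \<cdot>\<^bsub>C\<^esub> i = Zero C x y \<and> p \<cdot>\<^bsub>C\<^esub> j = Zero C y x \<and>
       (i \<cdot>\<^bsub>C\<^esub> p) \<oplus>\<^bsub>Hom C b b\<^esub> (j \<cdot>\<^bsub>C\<^esub> q) = Id C b)"

locale additive_linear_category = linear_category +
  assumes ex_zero_object: "\<exists>x. zero_object C x"
    and ex_biproduct: "\<exists>b. biproduct C x y b"

definition hom_finite :: "'k ring \<Rightarrow> ('k, 'o, 'm, 'z) lin_cat_scheme \<Rightarrow> bool"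
  where "hom_finite K C \<longleftrightarrow> (\<forall>x y. vectorspace.fin_dim K (Hom C x y))"

definition split_idempotents :: "('k, 'o, 'm, 'z) lin_cat_scheme \<Rightarrow> bool"
  where "split_idempotents C \<longleftrightarrow>
    (\<forall>x. \<forall>e \<in> Mor C x x. e \<cdot>\<^bsub>C\<^esub> e = e \<longrightarrow>
       (\<exists>y. \<exists>p \<in> Mor C x y. \<exists>i \<in> Mor C y x. i \<cdot>\<^bsub>C\<^esub> p = e \<and> p \<cdot>\<^bsub>C\<^esub> i = Id C y))"

definition End :: "('k, 'o, 'm, 'z) lin_cat_scheme \<Rightarrow> 'o \<Rightarrow> 'm ring"
  where "End C x = \<lparr>carrier = Mor C x x, mult = Comp C, one = Id C x,
                     zero = Zero C x x, add = add (Hom C x x)\<rparr>"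

definition skew_field :: "('a, 'b) ring_scheme \<Rightarrow> bool"
  where "skew_field R \<longleftrightarrow> ring R \<and> Units R = carrier R - {\<zero>\<^bsub>R\<^esub>}"

section \<open>Triangulated categories\<close>

text \<open>
  The suspension is an automorphism, given together with its inverse.  \<^term>\<open>Tri C x y z f g h\<close>
  says that $x \to y \to z \to \Sigma x$, with maps $f$, $g$, $h$, is a distinguished triangle.
\<close>

record ('k, 'o, 'm) tri_cat = "('k, 'o, 'm) lin_cat" +
  Susp :: "'o \<Rightarrow> 'o"
  SuspM :: "'m \<Rightarrow> 'm"
  Desusp :: "'o \<Rightarrow> 'o"
  DesuspM :: "'m \<Rightarrow> 'm"
  Tri :: "'o \<Rightarrow> 'o \<Rightarrow> 'o \<Rightarrow> 'm \<Rightarrow> 'm \<Rightarrow> 'm \<Rightarrow> bool"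

locale triangulated_category = additive_linear_category K C
  for K :: "'k ring" and C :: "('k, 'o, 'm, 'z) tri_cat_scheme" (structure) +
  assumes susp_linear: "SuspM C \<in> module_hom K (Hom C x y) (Hom C (Susp C x) (Susp C y))"
    and susp_id: "SuspM C (Id C x) = Id C (Susp C x)"
    and susp_comp: "f \<in> Mor C x y \<Longrightarrow> g \<in> Mor C y z
           \<Longrightarrow> SuspM C (g \<cdot> f) = SuspM C g \<cdot> SuspM C f"
    and desusp_closed: "f \<in> Mor C x y \<Longrightarrow> DesuspM C f \<in> Mor C (Desusp C x) (Desusp C y)"
    and susp_desusp_obj: "Susp C (Desusp C x) = x"
    and desusp_susp_obj: "Desusp C (Susp C x) = x"
    and susp_desusp: "f \<in> Mor C x y \<Longrightarrow> SuspM C (DesuspM C f) = f"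
    and desusp_susp: "f \<in> Mor C x y \<Longrightarrow> DesuspM C (SuspM C f) = f"
    and tri_closed: "Tri C x y z f g h
           \<Longrightarrow> f \<in> Mor C x y \<and> g \<in> Mor C y z \<and> h \<in> Mor C z (Susp C x)"
    and tri_iso: "Tri C x y z f g h \<Longrightarrow> is_iso C x x' a \<Longrightarrow> is_iso C y y' b \<Longrightarrow> is_iso C z z' c
           \<Longrightarrow> f' \<in> Mor C x' y' \<Longrightarrow> g' \<in> Mor C y' z' \<Longrightarrow> h' \<in> Mor C z' (Susp C x')
           \<Longrightarrow> f' \<cdot> a = b \<cdot> f \<Longrightarrow> g' \<cdot> b = c \<cdot> g \<Longrightarrow> h' \<cdot> c = SuspM C a \<cdot> h
           \<Longrightarrow> Tri C x' y' z' f' g' h'"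
    and tri_id: "zero_object C z
           \<Longrightarrow> Tri C x x z (Id C x) (Zero C x z) (Zero C z (Susp C x))"
    and tri_complete: "f \<in> Mor C x y \<Longrightarrow> \<exists>z g h. Tri C x y z f g h"
    and tri_rotate: "f \<in> Mor C x y \<Longrightarrow> g \<in> Mor C y z \<Longrightarrow> h \<in> Mor C z (Susp C x)
           \<Longrightarrow> Tri C x y z f g h \<longleftrightarrow>
               Tri C y z (Susp C x) g h (\<ominus>\<^bsub>Hom C (Susp C x) (Susp C y)\<^esub> (SuspM C f))"
    and tri_morphism: "Tri C x y z f g h \<Longrightarrow> Tri C x' y' z' f' g' h'
           \<Longrightarrow> a \<in> Mor C x x' \<Longrightarrow> b \<in> Mor C y y' \<Longrightarrow> f' \<cdot> a = b \<cdot> f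
           \<Longrightarrow> \<exists>c \<in> Mor C z z'. g' \<cdot> b = c \<cdot> g \<and> h' \<cdot> c = SuspM C a \<cdot> h"
    and tri_octahedral: "Tri C x y u f f1 f2 \<Longrightarrow> Tri C y z v g g1 g2 \<Longrightarrow> Tri C x z t (g \<cdot> f) h1 h2
           \<Longrightarrow> \<exists>p q. Tri C u t v p q (SuspM C f1 \<cdot> g2) \<and>
                     p \<cdot> f1 = h1 \<cdot> g \<and> h2 \<cdot> p = f2 \<and>
                     q \<cdot> h1 = g1 \<and> g2 \<cdot> q = SuspM C f \<cdot> h2"

text \<open>The dual space $\mathrm{Hom}_K(V, K)$; functionals are undefined outside \<^term>\<open>carrier V\<close>.\<close>

definition dual_space :: "'k ring \<Rightarrow> ('k, 'm) module \<Rightarrow> ('k, 'm \<Rightarrow> 'k) module"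
  where "dual_space K V = (ring.func_space K (carrier V))
    \<lparr>carrier := {\<xi> \<in> carrier V \<rightarrow>\<^sub>E carrier K.
       (\<forall>u \<in> carrier V. \<forall>v \<in> carrier V. \<xi> (u \<oplus>\<^bsub>V\<^esub> v) = \<xi> u \<oplus>\<^bsub>K\<^esub> \<xi> v) \<and>
       (\<forall>a \<in> carrier K. \<forall>v \<in> carrier V. \<xi> (a \<odot>\<^bsub>V\<^esub> v) = a \<otimes>\<^bsub>K\<^esub> \<xi> v)}\<rparr>"

text \<open>
  \<^term>\<open>neg_calabi_yau K C w\<close> is the $(-w)$-Calabi--Yau property: linear isomorphisms
  $\varphi_{x,y} : \mathcal{C}(x,y) \to \mathrm{Hom}_K(\mathcal{C}(y,\Sigma^{-w}x), K)$, natural in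
  $x$ and $y$.
\<close>

definition neg_calabi_yau :: "'k ring \<Rightarrow> ('k, 'o, 'm, 'z) tri_cat_scheme \<Rightarrow> nat \<Rightarrow> bool"
  where "neg_calabi_yau K C w \<longleftrightarrow>
    (\<exists>\<phi>. (\<forall>x y. let D = dual_space K (Hom C y ((Desusp C ^^ w) x)) in
             \<phi> x y \<in> module_hom K (Hom C x y) D \<and> bij_betw (\<phi> x y) (Mor C x y) (carrier D)) \<and>
         (\<forall>x x' y y'. \<forall>f \<in> Mor C x' x. \<forall>g \<in> Mor C y y'. \<forall>h \<in> Mor C x y.
            \<forall>u \<in> Mor C y' ((Desusp C ^^ w) x').
              \<phi> x' y' (g \<cdot>\<^bsub>C\<^esub> h \<cdot>\<^bsub>C\<^esub> f) u = \<phi> x y h ((DesuspM C ^^ w) f \<cdot>\<^bsub>C\<^esub> u \<cdot>\<^bsub>C\<^esub> g)))"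

section \<open>Simple minded systems\<close>

definition star :: "('k, 'o, 'm, 'z) tri_cat_scheme \<Rightarrow> 'o set \<Rightarrow> 'o set \<Rightarrow> 'o set"
  where "star C A B = {e. \<exists>a \<in> A. \<exists>b \<in> B. \<exists>f g h. Tri C a e b f g h}"

primrec ext_power :: "('k, 'o, 'm, 'z) tri_cat_scheme \<Rightarrow> 'o set \<Rightarrow> nat \<Rightarrow> 'o set"
  where
    "ext_power C S 0 = {x. zero_object C x}"
  | "ext_power C S (Suc n) = star C (ext_power C S n) (S \<union> {x. zero_object C x})"

definition ext_closure :: "('k, 'o, 'm, 'z) tri_cat_scheme \<Rightarrow> 'o set \<Rightarrow> 'o set"
  where "ext_closure C S = (\<Union>n. ext_power C S n)"

text \<open>$A * \Sigma^{-1}A * \cdots * \Sigma^{-n}A$; the operation $*$ is associative.\<close>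

primrec desusp_star :: "('k, 'o, 'm, 'z) tri_cat_scheme \<Rightarrow> 'o set \<Rightarrow> nat \<Rightarrow> 'o set"
  where
    "desusp_star C A 0 = A"
  | "desusp_star C A (Suc n) = star C (desusp_star C A n) ((Desusp C ^^ Suc n) ` A)"

definition orthogonal_collection :: "('k, 'o, 'm, 'z) tri_cat_scheme \<Rightarrow> nat \<Rightarrow> 'o set \<Rightarrow> bool"
  where "orthogonal_collection C w S \<longleftrightarrow> finite S \<and>
    (\<forall>s \<in> S. skew_field (End C s)) \<and>
    (\<forall>s \<in> S. \<forall>t \<in> S. s \<noteq> t \<longrightarrow> Mor C s t = {Zero C s t}) \<and>
    (\<forall>s \<in> S. \<forall>t \<in> S. \<forall>l \<in> {1..<w}.
       Mor C s ((Desusp C ^^ l) t) = {Zero C s ((Desusp C ^^ l) t)})"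

definition simple_minded_system :: "('k, 'o, 'm, 'z) tri_cat_scheme \<Rightarrow> nat \<Rightarrow> 'o set \<Rightarrow> bool"
  where "simple_minded_system C w S \<longleftrightarrow> orthogonal_collection C w S \<and>
    desusp_star C (ext_closure C S) (w - 1) = UNIV"

section \<open>Covers, envelopes and tilting\<close>

definition right_perp :: "('k, 'o, 'm, 'z) lin_cat_scheme \<Rightarrow> 'o set \<Rightarrow> 'o set"
  where "right_perp C X = {c. \<forall>x \<in> X. Mor C x c = {Zero C x c}}"

definition left_perp :: "('k, 'o, 'm, 'z) lin_cat_scheme \<Rightarrow> 'o set \<Rightarrow> 'o set"
  where "left_perp C X = {c. \<forall>x \<in> X. Mor C c x = {Zero C c x}}"

definition is_cover ::
    "('k, 'o, 'm, 'z) lin_cat_scheme \<Rightarrow> 'o set \<Rightarrow> 'o \<Rightarrow> 'o \<Rightarrow> 'm \<Rightarrow> bool"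
  where "is_cover C X x c \<tau> \<longleftrightarrow> x \<in> X \<and> \<tau> \<in> Mor C x c \<and>
    (\<forall>x' \<in> X. \<forall>f \<in> Mor C x' c. \<exists>g \<in> Mor C x' x. f = \<tau> \<cdot>\<^bsub>C\<^esub> g) \<and>
    (\<forall>\<phi> \<in> Mor C x x. \<tau> \<cdot>\<^bsub>C\<^esub> \<phi> = \<tau> \<longrightarrow> is_iso C x x \<phi>)"

definition is_envelope ::
    "('k, 'o, 'm, 'z) lin_cat_scheme \<Rightarrow> 'o set \<Rightarrow> 'o \<Rightarrow> 'o \<Rightarrow> 'm \<Rightarrow> bool"
  where "is_envelope C X c x \<gamma> \<longleftrightarrow> x \<in> X \<and> \<gamma> \<in> Mor C c x \<and>
    (\<forall>x' \<in> X. \<forall>f \<in> Mor C c x'. \<exists>g \<in> Mor C x x'. f = g \<cdot>\<^bsub>C\<^esub> \<gamma>) \<and>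
    (\<forall>\<phi> \<in> Mor C x x. \<phi> \<cdot>\<^bsub>C\<^esub> \<gamma> = \<gamma> \<longrightarrow> is_iso C x x \<phi>)"

text \<open>
  Covers and cones are unique only up to isomorphism.  Hence \<^term>\<open>left_tilt C S' S L\<close> says that the
  set \<^term>\<open>L\<close> is obtained from some choice of covers and triangles, and in particular that the
  covers exist; similarly for \<^term>\<open>right_tilt C S'' S R\<close>, where \<^term>\<open>R\<close> is a set of objects.
\<close>

definition left_tilt ::
    "('k, 'o, 'm, 'z) tri_cat_scheme \<Rightarrow> 'o set \<Rightarrow> 'o set \<Rightarrow> 'o set \<Rightarrow> bool"
  where "left_tilt C S' S L \<longleftrightarrow> (\<exists>l. L = l ` S \<and>
    (\<forall>s \<in> S'. l s = Desusp C s) \<and>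
    (\<forall>s \<in> S - S'. \<exists>t \<tau> g h.
       is_cover C (Desusp C ` ext_closure C S') (Desusp C t) s \<tau> \<and>
       Tri C (Desusp C t) s (l s) \<tau> g h))"

definition right_tilt ::
    "('k, 'o, 'm, 'z) tri_cat_scheme \<Rightarrow> 'o set \<Rightarrow> 'o set \<Rightarrow> 'o set \<Rightarrow> bool"
  where "right_tilt C S'' S R \<longleftrightarrow> (\<exists>r. R = r ` S \<and>
    (\<forall>s \<in> S''. r s = Susp C s) \<and>
    (\<forall>s \<in> S - S''. \<exists>t \<gamma> f g.
       is_envelope C (Susp C ` ext_closure C S'') s (Susp C t) \<gamma> \<and>
       Tri C t (r s) s f g \<gamma>))"

section \<open>Abelian subcategories and torsion pairs\<close>

text \<open>
  A set \<^term>\<open>A\<close> of objects stands for the full subcategory on \<^term>\<open>A\<close>; kernels, cokernels,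
  monomorphisms and epimorphisms are those of this subcategory.
\<close>

definition kernel_in ::
    "('k, 'o, 'm, 'z) lin_cat_scheme \<Rightarrow> 'o set \<Rightarrow> 'o \<Rightarrow> 'o \<Rightarrow> 'o \<Rightarrow> 'm \<Rightarrow> 'm \<Rightarrow> bool"
  where "kernel_in C A n x y \<kappa> f \<longleftrightarrow> n \<in> A \<and> x \<in> A \<and> y \<in> A \<and>
    \<kappa> \<in> Mor C n x \<and> f \<in> Mor C x y \<and> f \<cdot>\<^bsub>C\<^esub> \<kappa> = Zero C n y \<and>
    (\<forall>u \<in> A. \<forall>h \<in> Mor C u x. f \<cdot>\<^bsub>C\<^esub> h = Zero C u y \<longrightarrow>
       (\<exists>!h'. h' \<in> Mor C u n \<and> \<kappa> \<cdot>\<^bsub>C\<^esub> h' = h))"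

definition cokernel_in ::
    "('k, 'o, 'm, 'z) lin_cat_scheme \<Rightarrow> 'o set \<Rightarrow> 'o \<Rightarrow> 'o \<Rightarrow> 'o \<Rightarrow> 'm \<Rightarrow> 'm \<Rightarrow> bool"
  where "cokernel_in C A x y q f \<pi> \<longleftrightarrow> x \<in> A \<and> y \<in> A \<and> q \<in> A \<and>
    f \<in> Mor C x y \<and> \<pi> \<in> Mor C y q \<and> \<pi> \<cdot>\<^bsub>C\<^esub> f = Zero C x q \<and>
    (\<forall>u \<in> A. \<forall>h \<in> Mor C y u. h \<cdot>\<^bsub>C\<^esub> f = Zero C x u \<longrightarrow>
       (\<exists>!h'. h' \<in> Mor C q u \<and> h' \<cdot>\<^bsub>C\<^esub> \<pi> = h))"

definition mono_in ::
    "('k, 'o, 'm, 'z) lin_cat_scheme \<Rightarrow> 'o set \<Rightarrow> 'o \<Rightarrow> 'o \<Rightarrow> 'm \<Rightarrow> bool"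
  where "mono_in C A x y f \<longleftrightarrow> x \<in> A \<and> y \<in> A \<and> f \<in> Mor C x y \<and>
    (\<forall>u \<in> A. \<forall>g \<in> Mor C u x. \<forall>h \<in> Mor C u x. f \<cdot>\<^bsub>C\<^esub> g = f \<cdot>\<^bsub>C\<^esub> h \<longrightarrow> g = h)"

definition epi_in ::
    "('k, 'o, 'm, 'z) lin_cat_scheme \<Rightarrow> 'o set \<Rightarrow> 'o \<Rightarrow> 'o \<Rightarrow> 'm \<Rightarrow> bool"
  where "epi_in C A x y f \<longleftrightarrow> x \<in> A \<and> y \<in> A \<and> f \<in> Mor C x y \<and>
    (\<forall>u \<in> A. \<forall>g \<in> Mor C y u. \<forall>h \<in> Mor C y u. g \<cdot>\<^bsub>C\<^esub> f = h \<cdot>\<^bsub>C\<^esub> f \<longrightarrow> g = h)"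

definition abelian_subcategory :: "('k, 'o, 'm, 'z) lin_cat_scheme \<Rightarrow> 'o set \<Rightarrow> bool"
  where "abelian_subcategory C A \<longleftrightarrow>
    (\<exists>z \<in> A. zero_object C z) \<and>
    (\<forall>x \<in> A. \<forall>y \<in> A. \<exists>b \<in> A. biproduct C x y b) \<and>
    (\<forall>x \<in> A. \<forall>y \<in> A. \<forall>f \<in> Mor C x y.
       (\<exists>n \<kappa>. kernel_in C A n x y \<kappa> f) \<and> (\<exists>q \<pi>. cokernel_in C A x y q f \<pi>)) \<and>
    (\<forall>x y f. mono_in C A x y f \<longrightarrow> (\<exists>z g. kernel_in C A x y z f g)) \<and>
    (\<forall>x y f. epi_in C A x y f \<longrightarrow> (\<exists>z g. cokernel_in C A z x y g f))"

definition short_exact_in ::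
    "('k, 'o, 'm, 'z) lin_cat_scheme \<Rightarrow> 'o set \<Rightarrow> 'o \<Rightarrow> 'o \<Rightarrow> 'o \<Rightarrow> 'm \<Rightarrow> 'm \<Rightarrow> bool"
  where "short_exact_in C A x y z f g \<longleftrightarrow> kernel_in C A x y z f g \<and> cokernel_in C A x y z f g"

definition torsion_pair ::
    "('k, 'o, 'm, 'z) lin_cat_scheme \<Rightarrow> 'o set \<Rightarrow> 'o set \<Rightarrow> 'o set \<Rightarrow> bool"
  where "torsion_pair C A T F \<longleftrightarrow> abelian_subcategory C A \<and>
    T \<subseteq> A \<and> F \<subseteq> A \<and>
    (\<forall>x \<in> T. \<forall>y \<in> A. isomorphic C x y \<longrightarrow> y \<in> T) \<and>
    (\<forall>x \<in> F. \<forall>y \<in> A. isomorphic C x y \<longrightarrow> y \<in> F) \<and>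
    (\<forall>t \<in> T. \<forall>f \<in> F. Mor C t f = {Zero C t f}) \<and>
    (\<forall>a \<in> A. \<exists>t \<in> T. \<exists>f \<in> F. \<exists>i p. short_exact_in C A t a f i p)"

end

theory Submission
  imports Defs
begin

text \<open>
  Write $A = \langle S \rangle$, $T = \langle S' \rangle$ and $F = T^\perp \cap A$.

  The class $A$ behaves like a category of objects of finite length with simple objects $S$: the cone of
  a nonzero map from some $s \in S$ to an object of $A$ is shorter by one
  (\<open>cone_of_simple_in_ext_power\<close>).  Induction on length then shows that every morphism of $A$ factors
  through an image, with triangles for kernel and cokernel (\<open>ext_closure_factorization\<close>).  Together with
  $\mathrm{Hom}(A, \Sigma^{-1}A) = 0$ this makes $A$ abelian with the short triangles as short exact
  sequences.  Splitting off simple subobjects from $S'$ gives $A \subseteq T * F$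
  (\<open>torsion_decomposition\<close>), which is the torsion pair of the original heart.

  Covers exist because generation provides approximations and because an approximation of least length
  is minimal (\<open>cover_of_precover\<close>).  For a tilted object $Ls$ with $s \notin S'$, minimality of the cover
  gives $\mathrm{Hom}(T, Ls) = 0$, that is $Ls \in F$ (\<open>tilt_in_F\<close>), and Wakamatsu's lemma gives
  $\mathrm{Hom}(\Sigma^{-1}T, Ls) = 0$ (\<open>DT_tilt\<close>).  These two facts identify $\mathrm{Hom}(Ls, Lu)$ with
  $\mathrm{Hom}(s, u)$ and yield the orthogonality of the tilted collection; only in the last degree is
  Serre duality used, to pass from $\mathrm{Hom}(u, Ls) = 0$ to $\mathrm{Hom}(Ls, \Sigma^{-w}u) = 0$.

  The tilted heart is $F * \Sigma^{-1}T$ (\<open>tilted_eq\<close>), which is its torsion pair.  This product is closed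
  under extensions because a map from a torsion-free to a torsion object has a torsion-free kernel and a
  torsion cokernel (\<open>DT_F\<close>), and $F$ consists of iterated extensions of tilted objects by induction on
  length (\<open>F_tilted\<close>).

  For generation, the envelopes by $T$ show that every object is an extension of an object of $T$ by an
  object of ${}^\perp T$.  After applying $\Sigma^{-w}$, Serre duality turns the second class into a
  subclass of $T^\perp$, and $T^\perp \subseteq F * \Sigma^{-1}A * \cdots * \Sigma^{-w+1}A$
  (\<open>right_perp_subset\<close>).  Replacing each $A$ by $T * F$ and pairing each shift of $F$ with the following
  shift of $T$ leaves a product of $w$ consecutive shifts of the tilted heart (\<open>tilt_generates\<close>).

  Right tilting is left tilting in the opposite category.
\<close>

section \<open>Linear categories\<close>

definition hom_zero :: "('k, 'o, 'm, 'z) lin_cat_scheme \<Rightarrow> 'o \<Rightarrow> 'o \<Rightarrow> bool"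
  where "hom_zero C x y \<longleftrightarrow> Mor C x y = {Zero C x y}"

context linear_category
begin

lemma hom_abelian: "abelian_group (Hom C x y)"
  using hom_vectorspace[of x y] by (simp add: vectorspace_def module_def)

lemma zero_mor [simp, intro]: "Zero C x y \<in> Mor C x y"
  using hom_abelian abelian_group.axioms(1) abelian_monoid.zero_closed by blast

lemma neg_mor: "f \<in> Mor C x y \<Longrightarrow> \<ominus>\<^bsub>Hom C x y\<^esub> f \<in> Mor C x y"
  by (rule abelian_group.a_inv_closed[OF hom_abelian])

lemma diff_mor: "f \<in> Mor C x y \<Longrightarrow> g \<in> Mor C x y \<Longrightarrow> f \<ominus>\<^bsub>Hom C x y\<^esub> g \<in> Mor C x y"
  by (rule abelian_group.minus_closed[OF hom_abelian])

lemma diff_eq_zero: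
  "f \<in> Mor C x y \<Longrightarrow> g \<in> Mor C x y \<Longrightarrow> f \<ominus>\<^bsub>Hom C x y\<^esub> g = Zero C x y \<Longrightarrow> f = g"
  using abelian_group.minus_equality[OF hom_abelian] abelian_group.minus_minus[OF hom_abelian]
  unfolding a_minus_def by (metis abelian_group.a_inv_closed hom_abelian)

lemma linear_map_zero:
  assumes "\<phi> \<in> module_hom K (Hom C x y) (Hom C x' y')"
  shows "\<phi> (Zero C x y) = Zero C x' y'"
proof -
  interpret mod_hom K "Hom C x y" "Hom C x' y'" \<phi>
    using assms hom_vectorspace by (simp add: mod_hom_def mod_hom_axioms_def vectorspace_def)
  show ?thesis by simp
qed

lemma linear_map_add:
  assumes "\<phi> \<in> module_hom K (Hom C x y) (Hom C x' y')" "f \<in> Mor C x y" "g \<in> Mor C x y"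
  shows "\<phi> (f \<oplus>\<^bsub>Hom C x y\<^esub> g) = \<phi> f \<oplus>\<^bsub>Hom C x' y'\<^esub> \<phi> g"
  using assms by (simp add: module_hom_add)

lemma linear_map_neg:
  assumes "\<phi> \<in> module_hom K (Hom C x y) (Hom C x' y')" and f: "f \<in> Mor C x y"
  shows "\<phi> (\<ominus>\<^bsub>Hom C x y\<^esub> f) = \<ominus>\<^bsub>Hom C x' y'\<^esub> \<phi> f"
proof -
  interpret A: abelian_group "Hom C x y" by (rule hom_abelian)
  interpret B: abelian_group "Hom C x' y'" by (rule hom_abelian)
  have c: "\<phi> f \<in> Mor C x' y'" "\<phi> (\<ominus>\<^bsub>Hom C x y\<^esub> f) \<in> Mor C x' y'"
    using module_hom_closed[OF assms(1)] f by auto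
  have "\<phi> (\<ominus>\<^bsub>Hom C x y\<^esub> f) \<oplus>\<^bsub>Hom C x' y'\<^esub> \<phi> f = Zero C x' y'"
    using linear_map_add[OF assms(1), of "\<ominus>\<^bsub>Hom C x y\<^esub> f" f] f linear_map_zero[OF assms(1)]
    by (simp add: A.l_neg)
  then show ?thesis using c B.minus_equality by metis
qed

lemma linear_map_diff:
  assumes "\<phi> \<in> module_hom K (Hom C x y) (Hom C x' y')" "f \<in> Mor C x y" "g \<in> Mor C x y"
  shows "\<phi> (f \<ominus>\<^bsub>Hom C x y\<^esub> g) = \<phi> f \<ominus>\<^bsub>Hom C x' y'\<^esub> \<phi> g"
  using assms by (simp add: a_minus_def linear_map_add linear_map_neg neg_mor)

lemma comp_zero_left: "f \<in> Mor C x y \<Longrightarrow> Zero C y z \<cdot> f = Zero C x z"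
  using linear_map_zero[OF precomp_linear] .

lemma comp_zero_right: "g \<in> Mor C y z \<Longrightarrow> g \<cdot> Zero C x y = Zero C x z"
  using linear_map_zero[OF postcomp_linear] .

lemma comp_neg_left: "f \<in> Mor C x y \<Longrightarrow> g \<in> Mor C y z
    \<Longrightarrow> (\<ominus>\<^bsub>Hom C y z\<^esub> g) \<cdot> f = \<ominus>\<^bsub>Hom C x z\<^esub> (g \<cdot> f)"
  using linear_map_neg[OF precomp_linear] .

lemma comp_neg_right: "f \<in> Mor C x y \<Longrightarrow> g \<in> Mor C y z
    \<Longrightarrow> g \<cdot> (\<ominus>\<^bsub>Hom C x y\<^esub> f) = \<ominus>\<^bsub>Hom C x z\<^esub> (g \<cdot> f)"
  using linear_map_neg[OF postcomp_linear] .

lemma comp_diff_left: "f \<in> Mor C x y \<Longrightarrow> g \<in> Mor C y z \<Longrightarrow> g' \<in> Mor C y z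
    \<Longrightarrow> (g \<ominus>\<^bsub>Hom C y z\<^esub> g') \<cdot> f = (g \<cdot> f) \<ominus>\<^bsub>Hom C x z\<^esub> (g' \<cdot> f)"
  using linear_map_diff[OF precomp_linear] .

lemma comp_diff_right: "f \<in> Mor C x y \<Longrightarrow> f' \<in> Mor C x y \<Longrightarrow> g \<in> Mor C y z
    \<Longrightarrow> g \<cdot> (f \<ominus>\<^bsub>Hom C x y\<^esub> f') = (g \<cdot> f) \<ominus>\<^bsub>Hom C x z\<^esub> (g \<cdot> f')"
  using linear_map_diff[OF postcomp_linear] .

lemma comp_add_left: "f \<in> Mor C x y \<Longrightarrow> g \<in> Mor C y z \<Longrightarrow> g' \<in> Mor C y z
    \<Longrightarrow> (g \<oplus>\<^bsub>Hom C y z\<^esub> g') \<cdot> f = (g \<cdot> f) \<oplus>\<^bsub>Hom C x z\<^esub> (g' \<cdot> f)"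
  using linear_map_add[OF precomp_linear] .

lemma comp_add_right: "f \<in> Mor C x y \<Longrightarrow> f' \<in> Mor C x y \<Longrightarrow> g \<in> Mor C y z
    \<Longrightarrow> g \<cdot> (f \<oplus>\<^bsub>Hom C x y\<^esub> f') = (g \<cdot> f) \<oplus>\<^bsub>Hom C x z\<^esub> (g \<cdot> f')"
  using linear_map_add[OF postcomp_linear] .

lemma neg_neg: "f \<in> Mor C x y \<Longrightarrow> \<ominus>\<^bsub>Hom C x y\<^esub> (\<ominus>\<^bsub>Hom C x y\<^esub> f) = f"
  by (rule abelian_group.minus_minus[OF hom_abelian])

lemma neg_zero: "\<ominus>\<^bsub>Hom C x y\<^esub> (Zero C x y) = Zero C x y"
  using abelian_group.minus_equality[OF hom_abelian] zero_mor
    abelian_monoid.l_zero[OF abelian_group.axioms(1)[OF hom_abelian]] by blast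

lemma neg_eq_zero: "f \<in> Mor C x y \<Longrightarrow> \<ominus>\<^bsub>Hom C x y\<^esub> f = Zero C x y \<Longrightarrow> f = Zero C x y"
  using neg_neg neg_zero by metis

lemma diff_self: "f \<in> Mor C x y \<Longrightarrow> f \<ominus>\<^bsub>Hom C x y\<^esub> f = Zero C x y"
  unfolding a_minus_def by (rule abelian_group.r_neg[OF hom_abelian])

lemma left_cancel:
  assumes "g \<in> Mor C y z" "f \<in> Mor C x y" "f' \<in> Mor C x y" "g \<cdot> f = g \<cdot> f'"
    and "\<And>d. d \<in> Mor C x y \<Longrightarrow> g \<cdot> d = Zero C x z \<Longrightarrow> d = Zero C x y"
  shows "f = f'"
proof -
  have "g \<cdot> (f \<ominus>\<^bsub>Hom C x y\<^esub> f') = Zero C x z"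
    using assms comp_closed[OF assms(3,1)] by (simp add: comp_diff_right diff_self)
  then show ?thesis using assms diff_mor diff_eq_zero by blast
qed

lemma right_cancel:
  assumes "f \<in> Mor C x y" "g \<in> Mor C y z" "g' \<in> Mor C y z" "g \<cdot> f = g' \<cdot> f"
    and "\<And>d. d \<in> Mor C y z \<Longrightarrow> d \<cdot> f = Zero C x z \<Longrightarrow> d = Zero C y z"
  shows "g = g'"
proof -
  have "(g \<ominus>\<^bsub>Hom C y z\<^esub> g') \<cdot> f = Zero C x z"
    using assms comp_closed[OF assms(1,3)] by (simp add: comp_diff_left diff_self)
  then show ?thesis using assms diff_mor diff_eq_zero by blast
qed

lemma comp_middle:
  assumes "f \<in> Mor C x y" "g \<in> Mor C y z" "h \<in> Mor C z u" "k \<in> Mor C u v"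
  shows "(k \<cdot> h) \<cdot> (g \<cdot> f) = k \<cdot> ((h \<cdot> g) \<cdot> f)"
  using comp_assoc[OF comp_closed[OF assms(1,2)] assms(3,4)] comp_assoc[OF assms(1-3)] by simp

lemma hom_zeroD: "hom_zero C x y \<Longrightarrow> f \<in> Mor C x y \<Longrightarrow> f = Zero C x y"
  by (simp add: hom_zero_def)

lemma hom_zeroI: "(\<And>f. f \<in> Mor C x y \<Longrightarrow> f = Zero C x y) \<Longrightarrow> hom_zero C x y"
  unfolding hom_zero_def using zero_mor by blast

lemma is_isoE:
  assumes "is_iso C x y f"
  obtains g where "f \<in> Mor C x y" "g \<in> Mor C y x" "g \<cdot> f = Id C x" "f \<cdot> g = Id C y" "is_iso C y x g"
  using assms unfolding is_iso_def by auto

lemma is_isoI: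
  "f \<in> Mor C x y \<Longrightarrow> g \<in> Mor C y x \<Longrightarrow> g \<cdot> f = Id C x \<Longrightarrow> f \<cdot> g = Id C y \<Longrightarrow> is_iso C x y f"
  unfolding is_iso_def by auto

lemma is_iso_id [simp, intro]: "is_iso C x x (Id C x)"
  by (rule is_isoI) (auto simp: id_closed intro: id_left id_closed)

lemma is_iso_neg:
  assumes "is_iso C x y f" shows "is_iso C x y (\<ominus>\<^bsub>Hom C x y\<^esub> f)"
proof -
  obtain g where g: "f \<in> Mor C x y" "g \<in> Mor C y x" "g \<cdot> f = Id C x" "f \<cdot> g = Id C y"
    using assms by (rule is_isoE)
  have "(\<ominus>\<^bsub>Hom C y x\<^esub> g) \<cdot> (\<ominus>\<^bsub>Hom C x y\<^esub> f) = Id C x"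
    using g by (simp add: comp_neg_left[OF neg_mor] comp_neg_right neg_neg id_closed)
  moreover have "(\<ominus>\<^bsub>Hom C x y\<^esub> f) \<cdot> (\<ominus>\<^bsub>Hom C y x\<^esub> g) = Id C y"
    using g by (simp add: comp_neg_left[OF neg_mor] comp_neg_right neg_neg id_closed)
  ultimately show ?thesis using g neg_mor by (blast intro: is_isoI)
qed

lemma isomorphic_sym: "isomorphic C x y \<Longrightarrow> isomorphic C y x"
  unfolding isomorphic_def by (meson is_isoE)

lemma zero_object_iff_id: "zero_object C x \<longleftrightarrow> Id C x = Zero C x x"
proof
  assume "zero_object C x"
  then show "Id C x = Zero C x x" unfolding zero_object_def using id_closed by blast
next
  assume z: "Id C x = Zero C x x"
  have "f = Zero C x y" if "f \<in> Mor C x y" for f y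
    using that z id_right comp_zero_right by metis
  moreover have "f = Zero C y x" if "f \<in> Mor C y x" for f y
    using that z id_left comp_zero_left by metis
  ultimately show "zero_object C x" unfolding zero_object_def using zero_mor by blast
qed

lemma hom_zero_self: "hom_zero C x x \<longleftrightarrow> zero_object C x"
  unfolding zero_object_iff_id hom_zero_def using id_closed zero_object_iff_id zero_object_def
  by (metis singletonD)

lemma zero_object_hom_zero: "zero_object C x \<Longrightarrow> hom_zero C x y" "zero_object C x \<Longrightarrow> hom_zero C y x"
  by (auto simp: zero_object_def hom_zero_def)

lemma is_iso_zero_objects: "zero_object C x \<Longrightarrow> zero_object C y \<Longrightarrow> is_iso C x y (Zero C x y)"
  by (rule is_isoI[where g = "Zero C y x"]) (auto simp: zero_object_iff_id comp_zero_left)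

lemma iso_hom_zero:
  assumes "is_iso C x x' a" "is_iso C y y' b" "hom_zero C x y" shows "hom_zero C x' y'"
proof (rule hom_zeroI)
  fix f assume f: "f \<in> Mor C x' y'"
  obtain a' where a: "a \<in> Mor C x x'" "a' \<in> Mor C x' x" "a \<cdot> a' = Id C x'"
    using assms(1) by (rule is_isoE)
  obtain b' where b: "b \<in> Mor C y y'" "b' \<in> Mor C y' y" "b \<cdot> b' = Id C y'"
    using assms(2) by (rule is_isoE)
  have "b' \<cdot> (f \<cdot> a) = Zero C x y"
    using f a b assms(3) by (meson hom_zeroD comp_closed)
  moreover have "b \<cdot> ((b' \<cdot> (f \<cdot> a)) \<cdot> a') = f"
  proof -
    have fa: "f \<cdot> a \<in> Mor C x y'" using f a comp_closed by blast
    have "b \<cdot> ((b' \<cdot> (f \<cdot> a)) \<cdot> a') = b \<cdot> (b' \<cdot> ((f \<cdot> a) \<cdot> a'))"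
      using fa a b comp_assoc by metis
    also have "(f \<cdot> a) \<cdot> a' = f" using f a comp_assoc id_right by metis
    also have "b \<cdot> (b' \<cdot> f) = f" using f b comp_assoc id_left by metis
    finally show ?thesis .
  qed
  ultimately show "f = Zero C x' y'" using a b by (metis comp_zero_left comp_zero_right)
qed

text \<open>
  A finite-dimensional vector space admits no injective endomorphism that is not surjective; here
  the space is the endomorphism algebra of an object, and the endomorphism is composition with \<open>\<phi>\<close>.
\<close>

lemma left_cancellable_endo_is_iso:
  assumes fin: "hom_finite K C" and \<phi>: "\<phi> \<in> Mor C x x"
    and inj: "\<And>\<psi>. \<psi> \<in> Mor C x x \<Longrightarrow> \<phi> \<cdot> \<psi> = Zero C x x \<Longrightarrow> \<psi> = Zero C x x"
  shows "is_iso C x x \<phi>"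
proof -
  interpret V: vectorspace K "Hom C x x" by (rule hom_vectorspace)
  interpret T: linear_map K "Hom C x x" "Hom C x x" "\<lambda>\<psi>. \<phi> \<cdot> \<psi>"
    using postcomp_linear[OF \<phi>, of x] hom_vectorspace[of x x]
    by (simp add: linear_map_def mod_hom_def mod_hom_axioms_def vectorspace_def)
  have fd: "V.fin_dim" using fin unfolding hom_finite_def by blast
  have inj_on: "inj_on (\<lambda>\<psi>. \<phi> \<cdot> \<psi>) (Mor C x x)"
    using left_cancel[OF \<phi>] inj by (auto intro!: inj_onI)
  \<comment> \<open>The image of a basis is again independent, hence spans the whole space for dimension reasons.\<close>
  let ?W = "V.vs T.imT"
  have sub: "subspace K T.imT (Hom C x x)" by (rule T.imT_is_subspace)
  interpret W: vectorspace K ?W using sub V.subspace_is_vs by blast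
  interpret TW: linear_map K "Hom C x x" ?W "\<lambda>\<psi>. \<phi> \<cdot> \<psi>"
    using postcomp_linear[OF \<phi>, of x] hom_vectorspace[of x x] W.vectorspace_axioms
    unfolding linear_map_def mod_hom_def mod_hom_axioms_def vectorspace_def
    by (auto simp: module_hom_def T.im_def)
  obtain B where B: "finite B" "V.basis B" using V.finite_basis_exists[OF fd] by blast
  have WB: "W.basis ((\<lambda>\<psi>. \<phi> \<cdot> \<psi>) ` B)"
    by (rule TW.linear_inj_image_is_basis[OF inj_on _ B(2) fd]) (auto simp: T.im_def)
  have "V.basis ((\<lambda>\<psi>. \<phi> \<cdot> \<psi>) ` B)"
  proof (rule V.dim_li_is_basis[OF fd])
    show "finite ((\<lambda>\<psi>. \<phi> \<cdot> \<psi>) ` B)" using B by simp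
    show "(\<lambda>\<psi>. \<phi> \<cdot> \<psi>) ` B \<subseteq> Mor C x x"
      using B(2) comp_closed[OF _ \<phi>] unfolding V.basis_def by auto
    show "V.dim \<le> card ((\<lambda>\<psi>. \<phi> \<cdot> \<psi>) ` B)"
      using V.dim_basis[OF B] B(2) inj_on unfolding V.basis_def
      by (simp add: card_image inj_on_subset)
    show "\<not> V.module.lin_dep ((\<lambda>\<psi>. \<phi> \<cdot> \<psi>) ` B)"
      using WB sub V.span_li_not_depend(2)[of "(\<lambda>\<psi>. \<phi> \<cdot> \<psi>) ` B" T.imT]
      unfolding W.basis_def by (auto simp: subspace_def)
  qed
  then have "V.span ((\<lambda>\<psi>. \<phi> \<cdot> \<psi>) ` B) = Mor C x x" unfolding V.basis_def by simp
  moreover have "V.span ((\<lambda>\<psi>. \<phi> \<cdot> \<psi>) ` B) \<subseteq> T.imT"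
    using sub V.span_is_subset WB unfolding W.basis_def by (auto simp: subspace_def)
  ultimately obtain \<psi> where \<psi>: "\<psi> \<in> Mor C x x" "\<phi> \<cdot> \<psi> = Id C x"
    using id_closed[of x] by (force simp: T.im_def)
  have "\<psi> \<cdot> \<phi> = Id C x"
  proof (rule left_cancel[OF \<phi> comp_closed[OF \<phi> \<psi>(1)] id_closed])
    show "\<phi> \<cdot> (\<psi> \<cdot> \<phi>) = \<phi> \<cdot> Id C x"
      using comp_assoc[OF \<phi> \<psi>(1) \<phi>] \<psi>(2) by (simp add: id_left[OF \<phi>] id_right[OF \<phi>])
  qed (rule inj)
  then show ?thesis using \<phi> \<psi> by (blast intro: is_isoI)
qed

end

section \<open>Triangles\<close>

context triangulated_category
begin

declare susp_desusp_obj [simp] desusp_susp_obj [simp]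

lemma susp_mor: "f \<in> Mor C x y \<Longrightarrow> SuspM C f \<in> Mor C (Susp C x) (Susp C y)"
  using module_hom_closed[OF susp_linear] by blast

lemma desusp_mor_from: "f \<in> Mor C x (Susp C y) \<Longrightarrow> DesuspM C f \<in> Mor C (Desusp C x) y"
  using desusp_closed[of f x "Susp C y"] by simp

lemma susp_inj: "f \<in> Mor C x y \<Longrightarrow> g \<in> Mor C x y \<Longrightarrow> SuspM C f = SuspM C g \<Longrightarrow> f = g"
  using desusp_susp by metis

lemma susp_zero: "SuspM C (Zero C x y) = Zero C (Susp C x) (Susp C y)"
  by (rule linear_map_zero[OF susp_linear])

lemma susp_neg: "f \<in> Mor C x y
    \<Longrightarrow> SuspM C (\<ominus>\<^bsub>Hom C x y\<^esub> f) = \<ominus>\<^bsub>Hom C (Susp C x) (Susp C y)\<^esub> SuspM C f"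
  by (rule linear_map_neg[OF susp_linear])

lemma desusp_id: "DesuspM C (Id C x) = Id C (Desusp C x)"
  using susp_inj[of "DesuspM C (Id C x)" "Desusp C x" "Desusp C x" "Id C (Desusp C x)"]
  by (simp add: desusp_closed id_closed susp_desusp[OF id_closed] susp_id)

lemma desusp_comp:
  assumes f: "f \<in> Mor C x y" and g: "g \<in> Mor C y z"
  shows "DesuspM C (g \<cdot> f) = DesuspM C g \<cdot> DesuspM C f"
proof (rule susp_inj)
  show "DesuspM C (g \<cdot> f) \<in> Mor C (Desusp C x) (Desusp C z)"
    by (rule desusp_closed[OF comp_closed[OF f g]])
  show "DesuspM C g \<cdot> DesuspM C f \<in> Mor C (Desusp C x) (Desusp C z)"
    by (rule comp_closed[OF desusp_closed[OF f] desusp_closed[OF g]])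
  show "SuspM C (DesuspM C (g \<cdot> f)) = SuspM C (DesuspM C g \<cdot> DesuspM C f)"
    by (simp add: susp_comp[OF desusp_closed[OF f] desusp_closed[OF g]] susp_desusp[OF f]
        susp_desusp[OF g] susp_desusp[OF comp_closed[OF f g]])
qed

lemma desusp_linear:
  "DesuspM C \<in> module_hom K (Hom C x y) (Hom C (Desusp C x) (Desusp C y))"
proof -
  interpret V: vectorspace K "Hom C x y" by (rule hom_vectorspace)
  interpret W: vectorspace K "Hom C (Desusp C x) (Desusp C y)" by (rule hom_vectorspace)
  note S = susp_linear[of "Desusp C x" "Desusp C y", simplified]
  have "DesuspM C (f \<oplus>\<^bsub>Hom C x y\<^esub> g)
      = DesuspM C f \<oplus>\<^bsub>Hom C (Desusp C x) (Desusp C y)\<^esub> DesuspM C g"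
    if f: "f \<in> Mor C x y" and g: "g \<in> Mor C x y" for f g
    by (rule susp_inj[of _ "Desusp C x" "Desusp C y"])
      (simp_all add: desusp_closed f g module_hom_add[OF S desusp_closed[OF f] desusp_closed[OF g]]
        susp_desusp[OF f] susp_desusp[OF g] susp_desusp[OF V.M.add.m_closed[OF f g]])
  moreover have "DesuspM C (r \<odot>\<^bsub>Hom C x y\<^esub> f)
      = r \<odot>\<^bsub>Hom C (Desusp C x) (Desusp C y)\<^esub> DesuspM C f"
    if f: "f \<in> Mor C x y" and r: "r \<in> carrier K" for f r
    by (rule susp_inj[of _ "Desusp C x" "Desusp C y"])
      (simp_all add: desusp_closed f r module_hom_smult[OF S r desusp_closed[OF f]]
        susp_desusp[OF f] susp_desusp[OF V.smult_closed[OF r f]])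
  ultimately show ?thesis unfolding module_hom_def by (simp add: desusp_closed)
qed

lemma desusp_zero: "DesuspM C (Zero C x y) = Zero C (Desusp C x) (Desusp C y)"
  by (rule linear_map_zero[OF desusp_linear])

lemma desusp_neg: "f \<in> Mor C x y
    \<Longrightarrow> DesuspM C (\<ominus>\<^bsub>Hom C x y\<^esub> f) = \<ominus>\<^bsub>Hom C (Desusp C x) (Desusp C y)\<^esub> DesuspM C f"
  by (rule linear_map_neg[OF desusp_linear])

lemma susp_iso: "is_iso C x y f \<Longrightarrow> is_iso C (Susp C x) (Susp C y) (SuspM C f)"
  by (erule is_isoE, rule is_isoI, erule susp_mor, erule susp_mor)
    (simp_all flip: susp_comp susp_id)

lemma desusp_iso: "is_iso C x y f \<Longrightarrow> is_iso C (Desusp C x) (Desusp C y) (DesuspM C f)"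
  by (erule is_isoE, rule is_isoI, erule desusp_closed, erule desusp_closed)
    (simp_all flip: desusp_comp desusp_id)

lemma hom_zero_desusp: "hom_zero C (Desusp C x) (Desusp C y) \<longleftrightarrow> hom_zero C x y"
proof
  assume h: "hom_zero C (Desusp C x) (Desusp C y)"
  show "hom_zero C x y"
  proof (rule hom_zeroI)
    fix f assume f: "f \<in> Mor C x y"
    then have "DesuspM C f = Zero C (Desusp C x) (Desusp C y)"
      using h desusp_closed hom_zeroD by blast
    then show "f = Zero C x y" using susp_desusp[OF f] susp_zero[of "Desusp C x" "Desusp C y"] by simp
  qed
next
  assume h: "hom_zero C x y"
  show "hom_zero C (Desusp C x) (Desusp C y)"
  proof (rule hom_zeroI)
    fix f assume f: "f \<in> Mor C (Desusp C x) (Desusp C y)"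
    then have "SuspM C f = Zero C x y" using h susp_mor[OF f] hom_zeroD by auto
    then show "f = Zero C (Desusp C x) (Desusp C y)" using desusp_susp[OF f] desusp_zero by metis
  qed
qed

lemma hom_zero_susp: "hom_zero C (Susp C x) (Susp C y) \<longleftrightarrow> hom_zero C x y"
  using hom_zero_desusp[of "Susp C x" "Susp C y"] by simp

lemma zero_object_desusp: "zero_object C (Desusp C x) \<longleftrightarrow> zero_object C x"
  using hom_zero_desusp[of x x] hom_zero_self by blast

lemma zero_object_susp: "zero_object C (Susp C x) \<longleftrightarrow> zero_object C x"
  using hom_zero_susp[of x x] hom_zero_self by blast

subsection \<open>Rotation\<close>

lemma tri_mor:
  assumes "Tri C x y z f g h"
  shows "f \<in> Mor C x y" "g \<in> Mor C y z" "h \<in> Mor C z (Susp C x)"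
  using tri_closed[OF assms] by auto

lemma tri_neg_last:
  assumes t: "Tri C x y z f g h"
  shows "Tri C x y z f (\<ominus>\<^bsub>Hom C y z\<^esub> g) (\<ominus>\<^bsub>Hom C z (Susp C x)\<^esub> h)"
proof (rule tri_iso[OF t is_iso_id is_iso_id is_iso_neg[OF is_iso_id]])
  note m = tri_mor[OF t]
  show "f \<cdot> Id C x = Id C y \<cdot> f" using m by (simp add: id_left id_right)
  show "(\<ominus>\<^bsub>Hom C y z\<^esub> g) \<cdot> Id C y = (\<ominus>\<^bsub>Hom C z z\<^esub> Id C z) \<cdot> g"
    using m by (simp add: comp_neg_left[OF m(2) id_closed] id_left id_right[OF neg_mor])
  show "(\<ominus>\<^bsub>Hom C z (Susp C x)\<^esub> h) \<cdot> (\<ominus>\<^bsub>Hom C z z\<^esub> Id C z) = SuspM C (Id C x) \<cdot> h"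
    using m by (simp add: comp_neg_right[OF id_closed neg_mor] id_right[OF neg_mor] neg_neg susp_id
        id_left)
qed (use tri_mor[OF t] neg_mor in auto)

lemma tri_neg_first:
  assumes t: "Tri C x y z f g h"
  shows "Tri C x y z (\<ominus>\<^bsub>Hom C x y\<^esub> f) (\<ominus>\<^bsub>Hom C y z\<^esub> g) h"
proof (rule tri_iso[OF t is_iso_id is_iso_neg[OF is_iso_id] is_iso_id])
  note m = tri_mor[OF t]
  show "(\<ominus>\<^bsub>Hom C x y\<^esub> f) \<cdot> Id C x = (\<ominus>\<^bsub>Hom C y y\<^esub> Id C y) \<cdot> f"
    using m by (simp add: comp_neg_left[OF m(1) id_closed] id_left id_right[OF neg_mor])
  show "(\<ominus>\<^bsub>Hom C y z\<^esub> g) \<cdot> (\<ominus>\<^bsub>Hom C y y\<^esub> Id C y) = Id C z \<cdot> g"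
    using m by (simp add: comp_neg_right[OF id_closed neg_mor] id_right[OF neg_mor] neg_neg id_left)
  show "h \<cdot> Id C z = SuspM C (Id C x) \<cdot> h" using m by (simp add: susp_id id_left id_right)
qed (use tri_mor[OF t] neg_mor in auto)

lemma tri_rotate_fwd:
  assumes t: "Tri C x y z f g h"
  shows "Tri C y z (Susp C x) g h (\<ominus>\<^bsub>Hom C (Susp C x) (Susp C y)\<^esub> SuspM C f)"
  using tri_rotate[OF tri_mor[OF t]] t by simp

lemma tri_rotate_bwd:
  assumes t: "Tri C x y z f g h"
  shows "Tri C (Desusp C z) x y (\<ominus>\<^bsub>Hom C (Desusp C z) x\<^esub> DesuspM C h) f g"
proof -
  note m = tri_mor[OF t]
  have d: "DesuspM C h \<in> Mor C (Desusp C z) x" by (rule desusp_mor_from[OF m(3)])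
  show ?thesis
    using t tri_rotate[OF neg_mor[OF d] m(1), of g] m
    by (simp add: susp_neg[OF d] susp_desusp[OF m(3)] neg_neg)
qed

lemma tri_susp:
  assumes t: "Tri C x y z f g h"
  shows "Tri C (Susp C x) (Susp C y) (Susp C z) (SuspM C f) (SuspM C g)
    (\<ominus>\<^bsub>Hom C (Susp C z) (Susp C (Susp C x))\<^esub> SuspM C h)"
proof -
  note m = tri_mor[OF t]
  show ?thesis
    using tri_neg_first[OF tri_rotate_fwd[OF tri_rotate_fwd[OF tri_rotate_fwd[OF t]]]] m
    by (simp add: neg_neg susp_mor)
qed

lemma tri_desusp:
  assumes t: "Tri C x y z f g h"
  shows "Tri C (Desusp C x) (Desusp C y) (Desusp C z) (DesuspM C f) (DesuspM C g)
    (\<ominus>\<^bsub>Hom C (Desusp C z) x\<^esub> DesuspM C h)"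
proof -
  note m = tri_mor[OF t]
  show ?thesis
    using tri_neg_first[OF tri_rotate_bwd[OF tri_rotate_bwd[OF tri_rotate_bwd[OF t]]]] m
    by (simp add: neg_neg desusp_closed)
qed

subsection \<open>Long exact sequences\<close>

text \<open>
  The functors $\mathrm{Hom}(w,-)$ and $\mathrm{Hom}(-,w)$ are exact on triangles.  Exactness is used
  in the form of lifting and extension of single morphisms; \<open>tri_mono\<close> and \<open>tri_epi\<close> are the places
  where the neighbouring term of the long exact sequence vanishes, so that a map of the triangle can
  be cancelled.
\<close>

lemma tri_comp_zero:
  assumes t: "Tri C x y z f g h"
  shows "g \<cdot> f = Zero C x z" and "h \<cdot> g = Zero C y (Susp C x)" and "SuspM C f \<cdot> h = Zero C z (Susp C y)"
proof -
  have 1: "g' \<cdot> f' = Zero C x' z'" if t: "Tri C x' y' z' f' g' h'" for x' y' z' f' g' h'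
  proof -
    note m = tri_mor[OF t]
    obtain o' where z: "zero_object C o'" using ex_zero_object by blast
    obtain c where c: "c \<in> Mor C o' z'" "g' \<cdot> f' = c \<cdot> Zero C x' o'"
      using tri_morphism[OF tri_id[OF z, of x'] t id_closed m(1)] by auto
    then show ?thesis by (simp add: comp_zero_right)
  qed
  note m = tri_mor[OF t]
  show "g \<cdot> f = Zero C x z" "h \<cdot> g = Zero C y (Susp C x)"
    using 1[OF t] 1[OF tri_rotate_fwd[OF t]] by auto
  have "\<ominus>\<^bsub>Hom C z (Susp C y)\<^esub> (SuspM C f \<cdot> h) = Zero C z (Susp C y)"
    using 1[OF tri_rotate_fwd[OF tri_rotate_fwd[OF t]]] m by (simp add: comp_neg_left susp_mor)
  then show "SuspM C f \<cdot> h = Zero C z (Susp C y)"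
    using neg_eq_zero[OF comp_closed[OF m(3) susp_mor[OF m(1)]]] by simp
qed

lemma tri_lift:
  assumes t: "Tri C x y z f g h" and u: "u \<in> Mor C w y" "g \<cdot> u = Zero C w z"
  obtains v where "v \<in> Mor C w x" "u = f \<cdot> v"
proof -
  note m = tri_mor[OF t]
  obtain o' where z: "zero_object C o'" using ex_zero_object by blast
  obtain c where c: "c \<in> Mor C (Susp C w) (Susp C x)"
      "(\<ominus>\<^bsub>Hom C (Susp C x) (Susp C y)\<^esub> SuspM C f) \<cdot> c
        = SuspM C u \<cdot> (\<ominus>\<^bsub>Hom C (Susp C w) (Susp C w)\<^esub> SuspM C (Id C w))"
    using tri_morphism[OF tri_rotate_fwd[OF tri_id[OF z, of w]] tri_rotate_fwd[OF t] u(1)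
        zero_mor[of o' z]] u comp_zero_left[OF zero_mor[of w o']] by auto
  have d: "DesuspM C c \<in> Mor C w x" using desusp_closed[OF c(1)] by simp
  have "SuspM C f \<cdot> c = SuspM C u"
  proof -
    have "\<ominus>\<^bsub>Hom C (Susp C w) (Susp C y)\<^esub> (SuspM C f \<cdot> c)
        = \<ominus>\<^bsub>Hom C (Susp C w) (Susp C y)\<^esub> SuspM C u"
      using c m u by (simp add: susp_id comp_neg_left[OF c(1) susp_mor[OF m(1)]]
          comp_neg_right[OF id_closed susp_mor[OF u(1)]] id_right[OF susp_mor])
    then show ?thesis using neg_neg susp_mor c m u comp_closed by metis
  qed
  then have "SuspM C (f \<cdot> DesuspM C c) = SuspM C u"
    using susp_comp[OF d m(1)] susp_desusp[OF c(1)] by simp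
  then have "u = f \<cdot> DesuspM C c" using susp_inj[OF comp_closed[OF d m(1)] u(1)] by simp
  then show ?thesis using that d by blast
qed

lemma tri_extend:
  assumes t: "Tri C x y z f g h" and u: "u \<in> Mor C y w" "u \<cdot> f = Zero C x w"
  obtains v where "v \<in> Mor C z w" "u = v \<cdot> g"
proof -
  note m = tri_mor[OF t]
  obtain o' where z: "zero_object C o'" using ex_zero_object by blast
  have t2: "Tri C (Desusp C o') w w (Zero C (Desusp C o') w) (Id C w) (Zero C w o')"
    using tri_rotate_bwd[OF tri_id[OF z, of w]] desusp_zero[of o' "Susp C w"] neg_zero by simp
  obtain c where c: "c \<in> Mor C z w" "Id C w \<cdot> u = c \<cdot> g"
    using tri_morphism[OF t t2 zero_mor u(1)] comp_zero_left[OF zero_mor[of x "Desusp C o'"], of w] u(2) by auto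
  then show ?thesis using that u by (simp add: id_left)
qed

lemma tri_lift2:
  assumes t: "Tri C x y z f g h" and u: "u \<in> Mor C w z" "h \<cdot> u = Zero C w (Susp C x)"
  obtains v where "v \<in> Mor C w y" "u = g \<cdot> v"
  using tri_lift[OF tri_rotate_fwd[OF t] u] .

lemma tri_extend2:
  assumes t: "Tri C x y z f g h" and u: "u \<in> Mor C z w" "u \<cdot> g = Zero C y w"
  obtains v where "v \<in> Mor C (Susp C x) w" "u = v \<cdot> h"
  using tri_extend[OF tri_rotate_fwd[OF t] u] .

lemma tri_mono:
  assumes t: "Tri C x y z f g h" and h: "hom_zero C w (Desusp C z)"
    and u: "u \<in> Mor C w x" "f \<cdot> u = Zero C w y"
  shows "u = Zero C w x"
proof -
  obtain v where v: "v \<in> Mor C w (Desusp C z)" "u = (\<ominus>\<^bsub>Hom C (Desusp C z) x\<^esub> DesuspM C h) \<cdot> v"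
    using tri_lift[OF tri_rotate_bwd[OF t] u] .
  then show ?thesis
    using hom_zeroD[OF h v(1)] comp_zero_right[OF neg_mor[OF desusp_mor_from[OF tri_mor(3)[OF t]]]] by simp
qed

lemma tri_epi:
  assumes t: "Tri C x y z f g h" and h: "hom_zero C (Susp C x) w"
    and u: "u \<in> Mor C z w" "u \<cdot> g = Zero C y w"
  shows "u = Zero C z w"
proof -
  obtain v where v: "v \<in> Mor C (Susp C x) w" "u = v \<cdot> h"
    using tri_extend2[OF t u] .
  then show ?thesis using hom_zeroD[OF h v(1)] comp_zero_left[OF tri_mor(3)[OF t]] by simp
qed

text \<open>
  This is the morphism axiom of the opposite category; a rotation reduces it to the original one.
\<close>

lemma tri_fill_middle:
  assumes t: "Tri C x y z f g h" and t': "Tri C x' y' z' f' g' h'"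
    and a: "a \<in> Mor C x x'" and c: "c \<in> Mor C z z'" and eq: "h' \<cdot> c = SuspM C a \<cdot> h"
  obtains b where "b \<in> Mor C y y'" "f' \<cdot> a = b \<cdot> f" "g' \<cdot> b = c \<cdot> g"
proof -
  note m = tri_mor[OF t] and m' = tri_mor[OF t']
  have eq2: "DesuspM C h' \<cdot> DesuspM C c = a \<cdot> DesuspM C h"
    using arg_cong[OF eq, of "DesuspM C"] desusp_comp[OF c m'(3)] desusp_comp[OF m(3) susp_mor[OF a]]
      desusp_susp[OF a] by simp
  have "(\<ominus>\<^bsub>Hom C (Desusp C z') x'\<^esub> DesuspM C h') \<cdot> DesuspM C c
      = a \<cdot> (\<ominus>\<^bsub>Hom C (Desusp C z) x\<^esub> DesuspM C h)"
    using eq2 comp_neg_left[OF desusp_closed[OF c] desusp_mor_from[OF m'(3)]]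
      comp_neg_right[OF desusp_mor_from[OF m(3)] a] by simp
  from tri_morphism[OF tri_rotate_bwd[OF t] tri_rotate_bwd[OF t'] desusp_closed[OF c] a this]
  obtain b where "b \<in> Mor C y y'" "f' \<cdot> a = b \<cdot> f" "g' \<cdot> b = SuspM C (DesuspM C c) \<cdot> g" by blast
  then show ?thesis using that susp_desusp[OF c] by simp
qed

lemma tri_iso_of_zero:
  assumes t: "Tri C x y z f g h" and z: "zero_object C z"
  shows "is_iso C x y f"
proof -
  note m = tri_mor[OF t]
  have g: "g = Zero C y z" using m z by (simp add: zero_object_def)
  obtain v where v: "v \<in> Mor C y x" "Id C y = f \<cdot> v"
    using tri_lift[OF t id_closed] g comp_zero_left[OF id_closed] by auto
  have "v \<cdot> f = Id C x"
  proof (rule left_cancel[OF m(1) comp_closed[OF m(1) v(1)] id_closed])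
    show "f \<cdot> (v \<cdot> f) = f \<cdot> Id C x"
      using comp_assoc[OF m(1) v(1) m(1)] v(2) id_left[OF m(1)] id_right[OF m(1)] by simp
    show "d = Zero C x x" if "d \<in> Mor C x x" "f \<cdot> d = Zero C x y" for d
      using tri_mono[OF t _ that] zero_object_hom_zero z zero_object_desusp by blast
  qed
  then show ?thesis using is_isoI[OF m(1) v(1)] v(2) by simp
qed

lemma tri_of_iso:
  assumes i: "is_iso C x y f" and z: "zero_object C z"
  shows "Tri C x y z f (Zero C y z) (Zero C z (Susp C x))"
proof -
  obtain f' where f: "f \<in> Mor C x y" "f' \<in> Mor C y x" "f' \<cdot> f = Id C x"
    using i by (rule is_isoE)
  show ?thesis
    by (rule tri_iso[OF tri_id[OF z] is_iso_id i is_iso_id])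
      (use f in \<open>simp_all add: id_right[OF f(1)] id_right[OF zero_mor] id_left[OF zero_mor]
        comp_zero_left[OF f(1)] susp_id\<close>)
qed

end

section \<open>The opposite triangulated category\<close>

text \<open>
  A triangle of the opposite category, whose suspension is $\Sigma^{-1}$, is a triangle
  $\Sigma^{-1}x \to z \to y \to x$ of the original category.  With this choice the rotation axiom holds
  without a correction of signs.
\<close>

definition op_cat :: "('k, 'o, 'm, 'z) tri_cat_scheme \<Rightarrow> ('k, 'o, 'm) tri_cat"
  where "op_cat C = \<lparr>Hom = \<lambda>x y. Hom C y x, Id = Id C, Comp = \<lambda>g f. f \<cdot>\<^bsub>C\<^esub> g,
    Susp = Desusp C, SuspM = DesuspM C, Desusp = Susp C, DesuspM = SuspM C,
    Tri = \<lambda>x y z f g h. Tri C (Desusp C x) z y h g f\<rparr>"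

lemma op_cat_simps [simp]:
  "Hom (op_cat C) x y = Hom C y x"
  "Id (op_cat C) = Id C"
  "g \<cdot>\<^bsub>op_cat C\<^esub> f = f \<cdot>\<^bsub>C\<^esub> g"
  "Susp (op_cat C) = Desusp C" "SuspM (op_cat C) = DesuspM C"
  "Desusp (op_cat C) = Susp C" "DesuspM (op_cat C) = SuspM C"
  "Tri (op_cat C) x y z f g h \<longleftrightarrow> Tri C (Desusp C x) z y h g f"
  by (simp_all add: op_cat_def)

lemma is_iso_op [simp]: "is_iso (op_cat C) x y f \<longleftrightarrow> is_iso C y x f"
  by (auto simp: is_iso_def)

lemma isomorphic_op: "isomorphic (op_cat C) x y \<longleftrightarrow> isomorphic C y x"
  by (simp add: isomorphic_def)

lemma zero_object_op [simp]: "zero_object (op_cat C) x \<longleftrightarrow> zero_object C x"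
  by (auto simp: zero_object_def)

lemma hom_zero_op [simp]: "hom_zero (op_cat C) x y \<longleftrightarrow> hom_zero C y x"
  by (auto simp: hom_zero_def)

lemma biproduct_op: "biproduct (op_cat C) x y b \<longleftrightarrow> biproduct C x y b"
  unfolding biproduct_def by (simp, blast)

lemma hom_finite_op: "hom_finite K C \<Longrightarrow> hom_finite K (op_cat C)"
  by (simp add: hom_finite_def)

context triangulated_category
begin

text \<open>
  An octahedron on fibres is the desuspension of the octahedron on cones.  Each rotation changes one
  sign and two changed signs cancel, so that no sign remains in the conclusion.
\<close>

lemma octahedral_op:
  assumes f: "Tri C (Desusp C x) u y f2 f1 f" and g: "Tri C (Desusp C y) v z g2 g1 g"
    and h: "Tri C (Desusp C x) t z h2 h1 (f \<cdot> g)"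
  obtains p q where "Tri C (Desusp C u) v t (g2 \<cdot> DesuspM C f1) q p"
    "f1 \<cdot> p = g \<cdot> h1" "p \<cdot> h2 = f2" "h1 \<cdot> q = g1" "q \<cdot> g2 = h2 \<cdot> DesuspM C f"
proof -
  note mf = tri_mor[OF f, simplified] and mg = tri_mor[OF g, simplified]
    and mh = tri_mor[OF h, simplified]
  \<comment> \<open>Two rotations turn the fibres into suspended cones, to which the octahedral axiom applies.\<close>
  have rot: "Tri C b c (Susp C a) k (SuspM C i) (SuspM C j)"
    if "Tri C (Desusp C c) a b i j k" for a b c i j k
  proof -
    note m = tri_mor[OF that, simplified]
    have si: "SuspM C i \<in> Mor C c (Susp C a)" using susp_mor[OF m(1)] by simp
    show ?thesis
      using tri_neg_last[OF tri_rotate_fwd[OF tri_rotate_fwd[OF that]]]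
      by (simp add: neg_neg[OF si] neg_neg[OF susp_mor[OF m(2)]])
  qed
  obtain P Q where PQ: "Tri C (Susp C v) (Susp C t) (Susp C u) P Q (SuspM C (SuspM C g2) \<cdot> SuspM C f1)"
    "P \<cdot> SuspM C g2 = SuspM C h2 \<cdot> f" "SuspM C h1 \<cdot> P = SuspM C g1"
    "Q \<cdot> SuspM C h2 = SuspM C f2" "SuspM C f1 \<cdot> Q = SuspM C g \<cdot> SuspM C h1"
    using tri_octahedral[OF rot[OF g] rot[OF f] rot[OF h]] by blast
  note mPQ = tri_mor[OF PQ(1)]
  have q: "DesuspM C P \<in> Mor C v t" and p: "DesuspM C Q \<in> Mor C t u"
    using desusp_closed[OF mPQ(1)] desusp_closed[OF mPQ(2)] by simp_all
  have P: "P = SuspM C (DesuspM C P)" and Q: "Q = SuspM C (DesuspM C Q)"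
    using susp_desusp[OF mPQ(1)] susp_desusp[OF mPQ(2)] by simp_all
  have sg2: "SuspM C g2 \<in> Mor C y (Susp C v)" and sf2: "SuspM C f2 \<in> Mor C x (Susp C u)"
    and sh2: "SuspM C h2 \<in> Mor C x (Susp C t)"
    using susp_mor[OF mg(1)] susp_mor[OF mf(1)] susp_mor[OF mh(1)] by simp_all
  have D: "DesuspM C (SuspM C (SuspM C g2) \<cdot> SuspM C f1) = SuspM C g2 \<cdot> f1"
    using desusp_comp[OF susp_mor[OF mf(2)] susp_mor[OF sg2]] desusp_susp[OF mf(2)] desusp_susp[OF sg2]
    by simp
  note c = comp_closed[OF mf(2) sg2]
  have "Tri C v t u (DesuspM C P) (DesuspM C Q) (\<ominus>\<^bsub>Hom C u (Susp C v)\<^esub> (SuspM C g2 \<cdot> f1))"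
    using tri_desusp[OF PQ(1)] D by simp
  from tri_rotate_bwd[OF this]
  have "Tri C (Desusp C u) v t (DesuspM C (SuspM C g2 \<cdot> f1)) (DesuspM C P) (DesuspM C Q)"
    using desusp_mor_from[OF c] by (simp add: desusp_neg[OF c] neg_neg)
  then have "Tri C (Desusp C u) v t (g2 \<cdot> DesuspM C f1) (DesuspM C P) (DesuspM C Q)"
    using desusp_comp[OF mf(2) sg2] desusp_susp[OF mg(1)] by simp
  moreover have "f1 \<cdot> DesuspM C Q = g \<cdot> h1"
    using arg_cong[OF PQ(5), of "DesuspM C"] desusp_comp[OF mPQ(2) susp_mor[OF mf(2)]]
      desusp_comp[OF susp_mor[OF mh(2)] susp_mor[OF mg(3)]]
      desusp_susp[OF mf(2)] desusp_susp[OF mg(3)] desusp_susp[OF mh(2)] by simp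
  moreover have "DesuspM C Q \<cdot> h2 = f2"
    using arg_cong[OF PQ(4), of "DesuspM C"] desusp_comp[OF sh2 mPQ(2)]
      desusp_susp[OF mf(1)] desusp_susp[OF mh(1)] by simp
  moreover have "h1 \<cdot> DesuspM C P = g1"
    using arg_cong[OF PQ(3), of "DesuspM C"] desusp_comp[OF mPQ(1) susp_mor[OF mh(2)]]
      desusp_susp[OF mg(2)] desusp_susp[OF mh(2)] by simp
  moreover have "DesuspM C P \<cdot> g2 = h2 \<cdot> DesuspM C f"
    using arg_cong[OF PQ(2), of "DesuspM C"] desusp_comp[OF sg2 mPQ(1)] desusp_comp[OF mf(3) sh2]
      desusp_susp[OF mg(1)] desusp_susp[OF mh(1)] by simp
  ultimately show ?thesis by (rule that)
qed

text \<open>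
  Kernels and cokernels, covers and envelopes, left and right tilts are exchanged by passing to the
  opposite category.  Since that category is triangulated again, each such pair is treated only once
  below.
\<close>

lemma op_triangulated: "triangulated_category K (op_cat C)"
proof (intro triangulated_category.intro additive_linear_category.intro linear_category.intro
    additive_linear_category_axioms.intro triangulated_category_axioms.intro)
  show "\<exists>x. zero_object (op_cat C) x" using ex_zero_object by simp
  show "\<exists>b. biproduct (op_cat C) x y b" for x y using ex_biproduct by (simp add: biproduct_op)
  show "field K" by (rule field_K)
  show "SuspM (op_cat C) (g \<cdot>\<^bsub>op_cat C\<^esub> f) = SuspM (op_cat C) g \<cdot>\<^bsub>op_cat C\<^esub> SuspM (op_cat C) f"
    if "f \<in> Mor (op_cat C) x y" "g \<in> Mor (op_cat C) y z" for f g x y z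
    using that desusp_comp[of g z y f x] by simp
  show "Tri (op_cat C) x' y' z' f' g' h'"
    if t: "Tri (op_cat C) x y z f g h" and a: "is_iso (op_cat C) x x' a"
      and b: "is_iso (op_cat C) y y' b" and c: "is_iso (op_cat C) z z' c"
      and f': "f' \<in> Mor (op_cat C) x' y'" and g': "g' \<in> Mor (op_cat C) y' z'"
      and h': "h' \<in> Mor (op_cat C) z' (Susp (op_cat C) x')"
      and e: "f' \<cdot>\<^bsub>op_cat C\<^esub> a = b \<cdot>\<^bsub>op_cat C\<^esub> f" "g' \<cdot>\<^bsub>op_cat C\<^esub> b = c \<cdot>\<^bsub>op_cat C\<^esub> g"
        "h' \<cdot>\<^bsub>op_cat C\<^esub> c = SuspM (op_cat C) a \<cdot>\<^bsub>op_cat C\<^esub> h"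
    for x y z f g h x' y' z' a b c f' g' h'
  proof -
    have t: "Tri C (Desusp C x) z y h g f" using t by simp
    note m = tri_mor[OF t, simplified]
    have f': "f' \<in> Mor C y' x'" and g': "g' \<in> Mor C z' y'" and h': "h' \<in> Mor C (Desusp C x') z'"
      using f' g' h' by auto
    have e: "a \<cdot> f' = f \<cdot> b" "b \<cdot> g' = g \<cdot> c" "c \<cdot> h' = h \<cdot> DesuspM C a" using e by auto
    obtain a' where A: "a \<in> Mor C x' x" "a' \<in> Mor C x x'" "a' \<cdot> a = Id C x'" "a \<cdot> a' = Id C x"
        "is_iso C x x' a'"
      using a by (auto elim: is_isoE)
    obtain b' where B: "b \<in> Mor C y' y" "b' \<in> Mor C y y'" "b' \<cdot> b = Id C y'" "b \<cdot> b' = Id C y"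
        "is_iso C y y' b'"
      using b by (auto elim: is_isoE)
    obtain c' where Cc: "c \<in> Mor C z' z" "c' \<in> Mor C z z'" "c' \<cdot> c = Id C z'" "c \<cdot> c' = Id C z"
        "is_iso C z z' c'"
      using c by (auto elim: is_isoE)
    \<comment> \<open>The given squares are inverted, one at a time.\<close>
    have inv: "v \<cdot> l' = k' \<cdot> u"
      if "k \<in> Mor C p q" "k' \<in> Mor C q p" "k' \<cdot> k = Id C p" "l \<in> Mor C r s" "l' \<in> Mor C s r"
        "l \<cdot> l' = Id C s" "v \<in> Mor C r p" "u \<in> Mor C s q" "k \<cdot> v = u \<cdot> l"
      for k k' l l' u v p q r s
    proof -
      have "v \<cdot> l' = (k' \<cdot> k) \<cdot> (v \<cdot> l')" using that(3) id_left[OF comp_closed[OF that(5,7)]] by simp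
      also have "\<dots> = k' \<cdot> ((k \<cdot> v) \<cdot> l')" using comp_middle[OF that(5,7,1,2)] .
      also have "\<dots> = k' \<cdot> (u \<cdot> (l \<cdot> l'))" using that(9) comp_assoc[OF that(5,4,8)] by simp
      also have "\<dots> = k' \<cdot> u" using that by (simp add: id_right[OF that(8)])
      finally show ?thesis .
    qed
    have DA: "DesuspM C a \<in> Mor C (Desusp C x') (Desusp C x)" "DesuspM C a' \<in> Mor C (Desusp C x) (Desusp C x')"
        "DesuspM C a \<cdot> DesuspM C a' = Id C (Desusp C x)"
      using desusp_closed[OF A(1)] desusp_closed[OF A(2)] desusp_comp[OF A(2,1)] A(4) desusp_id by simp_all
    have "Tri C (Desusp C x') z' y' h' g' f'"
    proof (rule tri_iso[OF t desusp_iso[OF A(5)] Cc(5) B(5) h' g'])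
      show "f' \<in> Mor C y' (Susp C (Desusp C x'))" using f' by simp
      show "h' \<cdot> DesuspM C a' = c' \<cdot> h" by (rule inv[OF Cc(1-3) DA h' m(1) e(3)])
      show "g' \<cdot> c' = b' \<cdot> g" by (rule inv[OF B(1-3) Cc(1,2,4) g' m(2) e(2)])
      show "f' \<cdot> b' = SuspM C (DesuspM C a') \<cdot> f"
        unfolding susp_desusp[OF A(2)] by (rule inv[OF A(1-3) B(1,2,4) f' m(3) e(1)])
    qed
    then show ?thesis by simp
  qed
  show "Tri (op_cat C) x x z (Id (op_cat C) x) (Zero (op_cat C) x z) (Zero (op_cat C) z (Susp (op_cat C) x))"
    if z: "zero_object (op_cat C) z" for x z
  proof -
    have "zero_object C (Susp C z)" using z zero_object_susp by simp
    from tri_rotate_bwd[OF tri_rotate_bwd[OF tri_id[OF this, of x]]]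
    show ?thesis using desusp_zero[of "Susp C z" "Susp C x"] neg_zero by (simp add: desusp_zero)
  qed
  show "\<exists>z g h. Tri (op_cat C) x y z f g h" if f: "f \<in> Mor (op_cat C) x y" for f x y
  proof -
    obtain w g h where t: "Tri C y x w f g h" using tri_complete[of f y x] f by auto
    show ?thesis using tri_rotate_bwd[OF tri_rotate_bwd[OF t]] by force
  qed
  show "Tri (op_cat C) x y z f g h \<longleftrightarrow> Tri (op_cat C) y z (Susp (op_cat C) x) g h
      (\<ominus>\<^bsub>Hom (op_cat C) (Susp (op_cat C) x) (Susp (op_cat C) y)\<^esub> (SuspM (op_cat C) f))"
    if "f \<in> Mor (op_cat C) x y" "g \<in> Mor (op_cat C) y z" "h \<in> Mor (op_cat C) z (Susp (op_cat C) x)"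
    for x y z f g h
  proof -
    have m: "f \<in> Mor C y x" "g \<in> Mor C z y" "h \<in> Mor C (Desusp C x) z" using that by auto
    note d = desusp_closed[OF m(1)]
    show ?thesis
      using tri_rotate[OF neg_mor[OF d] m(3), of g] m
      by (simp add: susp_neg[OF d] susp_desusp[OF m(1)] neg_neg)
  qed
  show "\<exists>c\<in>Mor (op_cat C) z z'. g' \<cdot>\<^bsub>op_cat C\<^esub> b = c \<cdot>\<^bsub>op_cat C\<^esub> g \<and>
      h' \<cdot>\<^bsub>op_cat C\<^esub> c = SuspM (op_cat C) a \<cdot>\<^bsub>op_cat C\<^esub> h"
    if t: "Tri (op_cat C) x y z f g h" and t': "Tri (op_cat C) x' y' z' f' g' h'"
      and a: "a \<in> Mor (op_cat C) x x'" and b: "b \<in> Mor (op_cat C) y y'"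
      and e: "f' \<cdot>\<^bsub>op_cat C\<^esub> a = b \<cdot>\<^bsub>op_cat C\<^esub> f"
    for x y z f g h x' y' z' f' g' h' a b
  proof -
    have a: "a \<in> Mor C x' x" and b: "b \<in> Mor C y' y" using a b by auto
    have e': "f \<cdot> b = SuspM C (DesuspM C a) \<cdot> f'" using e susp_desusp[OF a] by simp
    obtain c where "c \<in> Mor C z' z" "h \<cdot> DesuspM C a = c \<cdot> h'" "g \<cdot> c = b \<cdot> g'"
      using tri_fill_middle[OF t'[simplified] t[simplified] desusp_closed[OF a] b e'] .
    then show ?thesis by (auto intro!: bexI[of _ c])
  qed
  show "\<exists>p q. Tri (op_cat C) u t v p q (SuspM (op_cat C) f1 \<cdot>\<^bsub>op_cat C\<^esub> g2) \<and>
      p \<cdot>\<^bsub>op_cat C\<^esub> f1 = h1 \<cdot>\<^bsub>op_cat C\<^esub> g \<and> h2 \<cdot>\<^bsub>op_cat C\<^esub> p = f2 \<and>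
      q \<cdot>\<^bsub>op_cat C\<^esub> h1 = g1 \<and> g2 \<cdot>\<^bsub>op_cat C\<^esub> q = SuspM (op_cat C) f \<cdot>\<^bsub>op_cat C\<^esub> h2"
    if t: "Tri (op_cat C) x y u f f1 f2" "Tri (op_cat C) y z v g g1 g2"
      "Tri (op_cat C) x z t (g \<cdot>\<^bsub>op_cat C\<^esub> f) h1 h2"
    for x y u f f1 f2 z v g g1 g2 t h1 h2
  proof -
    obtain p q where "Tri C (Desusp C u) v t (g2 \<cdot> DesuspM C f1) q p"
        "f1 \<cdot> p = g \<cdot> h1" "p \<cdot> h2 = f2" "h1 \<cdot> q = g1" "q \<cdot> g2 = h2 \<cdot> DesuspM C f"
      by (rule octahedral_op[OF t(1)[simplified] t(2)[simplified] t(3)[simplified]])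
    then show ?thesis by auto
  qed
qed (auto simp: hom_vectorspace id_closed comp_closed id_left id_right comp_assoc susp_id susp_comp
    precomp_linear postcomp_linear desusp_linear desusp_id susp_mor susp_desusp desusp_susp
    dest: hom_disjoint tri_mor)

end

section \<open>Extensions of classes of objects\<close>

definition iso_closed :: "('k, 'o, 'm, 'z) lin_cat_scheme \<Rightarrow> 'o set \<Rightarrow> bool"
  where "iso_closed C A \<longleftrightarrow> (\<forall>x\<in>A. \<forall>y. isomorphic C x y \<longrightarrow> y \<in> A)"

definition hom_orth :: "('k, 'o, 'm, 'z) lin_cat_scheme \<Rightarrow> 'o set \<Rightarrow> 'o set \<Rightarrow> bool"
  where "hom_orth C A B \<longleftrightarrow> (\<forall>a\<in>A. \<forall>b\<in>B. hom_zero C a b)"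

lemma hom_orth_op: "hom_orth (op_cat C) A B \<longleftrightarrow> hom_orth C B A"
  by (auto simp: hom_orth_def)

lemma hom_orthD: "hom_orth C A B \<Longrightarrow> a \<in> A \<Longrightarrow> b \<in> B \<Longrightarrow> hom_zero C a b"
  by (simp add: hom_orth_def)

lemma hom_orth_subset: "hom_orth C A B \<Longrightarrow> A' \<subseteq> A \<Longrightarrow> B' \<subseteq> B \<Longrightarrow> hom_orth C A' B'"
  by (auto simp: hom_orth_def)

lemma starI: "Tri C a e b f g h \<Longrightarrow> a \<in> A \<Longrightarrow> b \<in> B \<Longrightarrow> e \<in> star C A B"
  unfolding star_def by blast

lemma starE:
  assumes "e \<in> star C A B"
  obtains a b f g h where "a \<in> A" "b \<in> B" "Tri C a e b f g h"
  using assms by (auto simp: star_def)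

lemma star_mono: "A \<subseteq> A' \<Longrightarrow> B \<subseteq> B' \<Longrightarrow> star C A B \<subseteq> star C A' B'"
  unfolding star_def by blast

lemma right_perp_eq: "right_perp C X = {c. hom_orth C X {c}}"
  by (auto simp: right_perp_def hom_orth_def hom_zero_def)

lemma left_perp_eq: "left_perp C X = {c. hom_orth C {c} X}"
  by (auto simp: left_perp_def hom_orth_def hom_zero_def)

lemma right_perp_op: "right_perp (op_cat C) X = left_perp C X"
  by (simp add: right_perp_eq left_perp_eq hom_orth_op)

context triangulated_category
begin

lemma isomorphicI: "is_iso C x y f \<Longrightarrow> isomorphic C x y"
  by (auto simp: isomorphic_def)

lemma star_iso_closed: "iso_closed C (star C A B)"
  unfolding iso_closed_def
proof (intro ballI allI impI)
  fix e e' assume "e \<in> star C A B" and i: "isomorphic C e e'"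
  then obtain a b f g h where ab: "a \<in> A" "b \<in> B" and t: "Tri C a e b f g h" by (elim starE)
  note m = tri_mor[OF t]
  obtain u where "is_iso C e e' u" using i by (auto simp: isomorphic_def)
  then obtain v where uv: "u \<in> Mor C e e'" "v \<in> Mor C e' e" "v \<cdot> u = Id C e" "is_iso C e e' u"
    using is_isoE by metis
  have "Tri C a e' b (u \<cdot> f) (g \<cdot> v) h"
    by (rule tri_iso[OF t is_iso_id uv(4) is_iso_id])
      (simp_all add: comp_closed[OF m(1) uv(1)] comp_closed[OF uv(2) m(2)] m
        id_right[OF comp_closed[OF m(1) uv(1)]] comp_assoc[OF uv(1,2) m(2)] uv id_left[OF m(2)]
        id_right[OF m(2)] id_right[OF m(3)] id_left[OF m(3)] susp_id)
  then show "e' \<in> star C A B" using ab starI by metis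
qed

lemma star_op: "star (op_cat C) A B = star C B A"
proof -
  have "e \<in> star C B A" if e: "e \<in> star (op_cat C) A B" for e
  proof -
    obtain a b f g h where ab: "a \<in> A" "b \<in> B" and t: "Tri C (Desusp C a) b e h g f"
      using e by (auto elim!: starE)
    show ?thesis using starI[OF tri_rotate_fwd[OF t] ab(2)] ab(1) by simp
  qed
  moreover have "e \<in> star (op_cat C) A B" if "e \<in> star C B A" for e
  proof -
    obtain a b f g h where ab: "a \<in> A" "b \<in> B" and t: "Tri C b e a f g h" using \<open>e \<in> star C B A\<close> by (elim starE)
    have "Tri (op_cat C) a e b g f (\<ominus>\<^bsub>Hom C (Desusp C a) b\<^esub> DesuspM C h)"
      using tri_rotate_bwd[OF t] by simp
    then show ?thesis using ab by (rule starI)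
  qed
  ultimately show ?thesis by blast
qed

text \<open>
  If $a \to x \to b$ and $x \to e \to d$ are short triangles, then the octahedron on $a \to x \to e$
  exhibits the cone of $a \to e$ as an extension of $d$ by $b$.  The reverse inclusion of
  associativity is the same statement in the opposite category.
\<close>

lemma star_assoc_subset: "star C (star C A B) D \<subseteq> star C A (star C B D)"
proof
  fix e assume "e \<in> star C (star C A B) D"
  then obtain x d g g1 g2 where "x \<in> star C A B" and d: "d \<in> D" and t: "Tri C x e d g g1 g2"
    by (rule starE)
  then obtain a b f f1 f2 where a: "a \<in> A" and b: "b \<in> B" and t': "Tri C a x b f f1 f2"
    by - (erule starE)
  obtain c h1 h2 where t'': "Tri C a e c (g \<cdot> f) h1 h2"
    using tri_complete[OF comp_closed[OF tri_mor(1)[OF t'] tri_mor(1)[OF t]]] by blast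
  obtain p q r where "Tri C b c d p q r" using tri_octahedral[OF t' t t''] by blast
  then show "e \<in> star C A (star C B D)" using starI[OF t'' a] starI b d by metis
qed

lemma star_assoc: "star C (star C A B) D = star C A (star C B D)"
proof
  interpret op: triangulated_category K "op_cat C" by (rule op_triangulated)
  show "star C A (star C B D) \<subseteq> star C (star C A B) D"
    using op.star_assoc_subset[of D B A] by (simp add: star_op)
qed (rule star_assoc_subset)

lemma tri_id': "zero_object C z \<Longrightarrow> Tri C z x x (Zero C z x) (Id C x) (Zero C x (Susp C z))"
  using tri_rotate_bwd[OF tri_id[of "Susp C z" x]] zero_object_susp
  by (simp add: desusp_zero[of "Susp C z", simplified] neg_zero desusp_zero)

lemma star_zero_right: "iso_closed C A \<Longrightarrow> star C A {x. zero_object C x} = A"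
proof
  assume A: "iso_closed C A"
  show "star C A {x. zero_object C x} \<subseteq> A"
  proof
    fix e assume "e \<in> star C A {x. zero_object C x}"
    then obtain a z f g h where "a \<in> A" "zero_object C z" "Tri C a e z f g h" by (auto elim!: starE)
    then show "e \<in> A" using A tri_iso_of_zero isomorphicI unfolding iso_closed_def by metis
  qed
  obtain z where "zero_object C z" using ex_zero_object by blast
  then show "A \<subseteq> star C A {x. zero_object C x}" using starI[OF tri_id] by auto
qed

lemma zero_iso_closed: "iso_closed C {x. zero_object C x}"
  unfolding iso_closed_def isomorphic_def
  using iso_hom_zero hom_zero_self by (metis mem_Collect_eq)

lemma ext_power_iso_closed: "iso_closed C (ext_power C S n)"
  by (cases n) (simp_all add: zero_iso_closed star_iso_closed)

lemma ext_power_add: "star C (ext_power C S m) (ext_power C S n) = ext_power C S (m + n)"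
  by (induction n) (simp_all add: star_zero_right[OF ext_power_iso_closed] flip: star_assoc)

lemma star_zeros_subset:
  "star C A {x. zero_object C x} \<subseteq> star C {x. zero_object C x} A"
proof
  fix e assume "e \<in> star C A {x. zero_object C x}"
  then obtain a z f g h where a: "a \<in> A" and z: "zero_object C z" and t: "Tri C a e z f g h"
    by (auto elim!: starE)
  obtain f' where "is_iso C e a f'" using tri_iso_of_zero[OF t z] by (rule is_isoE)
  from tri_rotate_bwd[OF tri_of_iso[OF this z]] show "e \<in> star C {x. zero_object C x} A"
    by (rule starI) (simp_all add: z zero_object_desusp a)
qed

lemma star_zeros_commute:
  "star C {x. zero_object C x} A = star C A {x. zero_object C x}"
proof
  interpret op: triangulated_category K "op_cat C" by (rule op_triangulated)
  show "star C {x. zero_object C x} A \<subseteq> star C A {x. zero_object C x}"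
    using op.star_zeros_subset[of A] by (simp add: star_op)
qed (rule star_zeros_subset)

text \<open>
  Filtrations are built by adding factors at the top.  Associativity allows them to be peeled off at
  the bottom as well, which also makes extension closures self-dual.
\<close>

lemma ext_power_Suc_left:
  "ext_power C S (Suc n) = star C (S \<union> {x. zero_object C x}) (ext_power C S n)"
proof (induction n)
  case 0
  show ?case by (simp add: star_zeros_commute)
next
  case (Suc n)
  show ?case using Suc by (simp add: star_assoc)
qed

lemma ext_power_op: "ext_power (op_cat C) S n = ext_power C S n"
proof (induction n)
  case (Suc n)
  then show ?case using ext_power_Suc_left[of S n] by (simp add: star_op)
qed simp

lemma ext_closure_op: "ext_closure (op_cat C) S = ext_closure C S"
  by (simp add: ext_closure_def ext_power_op)

lemma ext_power_Suc_mono: "ext_power C S n \<subseteq> ext_power C S (Suc n)"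
  using ex_zero_object starI[OF tri_id] by auto

lemma ext_power_mono: "m \<le> n \<Longrightarrow> ext_power C S m \<subseteq> ext_power C S n"
  by (induction rule: dec_induct) (use ext_power_Suc_mono in blast)+

lemma subset_ext_power_1: "S \<subseteq> ext_power C S 1"
  using starI[OF tri_id'] ex_zero_object by fastforce

lemma ext_closure_superset: "S \<subseteq> ext_closure C S"
  using subset_ext_power_1[of S] unfolding ext_closure_def by blast

lemma zero_in_ext_closure: "zero_object C x \<Longrightarrow> x \<in> ext_closure C S"
  unfolding ext_closure_def by (auto intro!: exI[of _ 0])

lemma ext_closure_iso_closed: "iso_closed C (ext_closure C S)"
  using ext_power_iso_closed[of S] unfolding ext_closure_def iso_closed_def by blast

lemma ext_closure_star: "star C (ext_closure C S) (ext_closure C S) \<subseteq> ext_closure C S"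
proof
  fix e assume "e \<in> star C (ext_closure C S) (ext_closure C S)"
  then obtain a b f g h m n where "a \<in> ext_power C S m" "b \<in> ext_power C S n" "Tri C a e b f g h"
    by (auto elim!: starE simp: ext_closure_def)
  then have "e \<in> ext_power C S (m + n)" using starI ext_power_add by metis
  then show "e \<in> ext_closure C S" by (auto simp: ext_closure_def)
qed

lemma ext_closure_extension:
  "Tri C a e b f g h \<Longrightarrow> a \<in> ext_closure C S \<Longrightarrow> b \<in> ext_closure C S \<Longrightarrow> e \<in> ext_closure C S"
  by (rule subsetD[OF ext_closure_star starI])

lemma ext_closure_least:
  assumes "S \<subseteq> X" "{x. zero_object C x} \<subseteq> X" "star C X X \<subseteq> X"
  shows "ext_closure C S \<subseteq> X"
proof -
  have "ext_power C S n \<subseteq> X" for n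
  proof (induction n)
    case (Suc n)
    then have "ext_power C S (Suc n) \<subseteq> star C X X" using assms star_mono[of _ X _ X C] by simp
    then show ?case using assms by blast
  qed (use assms in simp)
  then show ?thesis by (auto simp: ext_closure_def)
qed

lemma ext_closure_mono: "S \<subseteq> S' \<Longrightarrow> ext_closure C S \<subseteq> ext_closure C S'"
  by (rule ext_closure_least)
    (use ext_closure_superset ext_closure_star zero_in_ext_closure in blast)+

lemma star_desusp: "star C (Desusp C ` A) (Desusp C ` B) = Desusp C ` star C A B"
proof
  show "Desusp C ` star C A B \<subseteq> star C (Desusp C ` A) (Desusp C ` B)"
    by (auto elim!: starE) (rule starI[OF tri_desusp], auto)
  show "star C (Desusp C ` A) (Desusp C ` B) \<subseteq> Desusp C ` star C A B"
  proof
    fix e assume "e \<in> star C (Desusp C ` A) (Desusp C ` B)"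
    then obtain a b f g h where "a \<in> A" "b \<in> B" "Tri C (Desusp C a) e (Desusp C b) f g h"
      by (auto elim!: starE)
    then have "Susp C e \<in> star C A B" using tri_susp starI by (metis susp_desusp_obj)
    then show "e \<in> Desusp C ` star C A B" by (metis desusp_susp_obj imageI)
  qed
qed

lemma zeros_desusp: "Desusp C ` {x. zero_object C x} = {x. zero_object C x}"
  using zero_object_desusp zero_object_susp by (auto simp: image_iff) (metis desusp_susp_obj)

lemma ext_power_desusp: "ext_power C (Desusp C ` S) n = Desusp C ` ext_power C S n"
  by (induction n) (simp_all add: zeros_desusp image_Un flip: star_desusp)

lemma ext_closure_desusp: "ext_closure C (Desusp C ` S) = Desusp C ` ext_closure C S"
  by (auto simp: ext_closure_def ext_power_desusp)

lemma desusp_pow_Suc_image: "(Desusp C ^^ Suc l) ` A = Desusp C ` (Desusp C ^^ l) ` A"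
  by (simp add: image_comp)

lemma ext_closure_desusp_pow:
  "ext_closure C ((Desusp C ^^ l) ` S) = (Desusp C ^^ l) ` ext_closure C S"
  by (induction l) (simp, simp only: desusp_pow_Suc_image ext_closure_desusp)

lemma star_desusp_pow:
  "star C ((Desusp C ^^ l) ` A) ((Desusp C ^^ l) ` B) = (Desusp C ^^ l) ` star C A B"
  by (induction l) (simp, simp only: desusp_pow_Suc_image star_desusp)

lemma hom_orth_star_left: "hom_orth C A Y \<Longrightarrow> hom_orth C B Y \<Longrightarrow> hom_orth C (star C A B) Y"
  unfolding hom_orth_def
proof (intro ballI hom_zeroI)
  fix e y u assume A: "\<forall>a\<in>A. \<forall>b\<in>Y. hom_zero C a b" and B: "\<forall>a\<in>B. \<forall>b\<in>Y. hom_zero C a b"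
    and e: "e \<in> star C A B" and y: "y \<in> Y" and u: "u \<in> Mor C e y"
  obtain a b f g h where ab: "a \<in> A" "b \<in> B" and t: "Tri C a e b f g h" using e by (elim starE)
  have "u \<cdot> f = Zero C a y" using A ab y comp_closed[OF tri_mor(1)[OF t] u] hom_zeroD by metis
  then obtain v where v: "v \<in> Mor C b y" "u = v \<cdot> g" by (rule tri_extend[OF t u])
  then show "u = Zero C e y" using B ab y hom_zeroD comp_zero_left[OF tri_mor(2)[OF t]] by metis
qed

lemma hom_orth_star_right: "hom_orth C X A \<Longrightarrow> hom_orth C X B \<Longrightarrow> hom_orth C X (star C A B)"
proof -
  interpret op: triangulated_category K "op_cat C" by (rule op_triangulated)
  show "hom_orth C X A \<Longrightarrow> hom_orth C X B \<Longrightarrow> hom_orth C X (star C A B)"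
    using op.hom_orth_star_left[of B X A] by (simp add: star_op hom_orth_op)
qed

lemma hom_orth_ext_closure_left: "hom_orth C S Y \<Longrightarrow> hom_orth C (ext_closure C S) Y"
proof -
  assume S: "hom_orth C S Y"
  define X where "X = {x. \<forall>y\<in>Y. hom_zero C x y}"
  have X: "hom_orth C A Y \<longleftrightarrow> A \<subseteq> X" for A
    by (auto simp: hom_orth_def X_def)
  have "ext_closure C S \<subseteq> X"
  proof (rule ext_closure_least)
    show "star C X X \<subseteq> X" using hom_orth_star_left[of X Y X] X by simp
    show "{x. zero_object C x} \<subseteq> X" using zero_object_hom_zero(1) by (simp add: X_def Collect_mono)
  qed (use S X in simp)
  then show ?thesis by (simp add: X)
qed

lemma hom_orth_ext_closure_right: "hom_orth C X S \<Longrightarrow> hom_orth C X (ext_closure C S)"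
proof -
  interpret op: triangulated_category K "op_cat C" by (rule op_triangulated)
  show "hom_orth C X S \<Longrightarrow> hom_orth C X (ext_closure C S)"
    using op.hom_orth_ext_closure_left[of S X] by (simp add: ext_closure_op hom_orth_op)
qed

lemma hom_orth_ext_closures:
  "hom_orth C S S' \<Longrightarrow> hom_orth C (ext_closure C S) (ext_closure C S')"
  by (intro hom_orth_ext_closure_left hom_orth_ext_closure_right)

lemma hom_orth_desusp: "hom_orth C (Desusp C ` A) (Desusp C ` B) \<longleftrightarrow> hom_orth C A B"
  by (simp add: hom_orth_def hom_zero_desusp)

end

section \<open>Semibricks and their hearts\<close>

text \<open>
  Up to isomorphism between its members, a semibrick is a set of pairwise orthogonal objects whose
  endomorphism rings are skew fields.  The extension closure of a semibrick behaves like a category of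
  objects of finite length with these objects as the simple ones.
\<close>

definition semibrick :: "('k, 'o, 'm, 'z) lin_cat_scheme \<Rightarrow> 'o set \<Rightarrow> bool"
  where "semibrick C S \<longleftrightarrow> (\<forall>s\<in>S. \<not> zero_object C s) \<and>
    (\<forall>s\<in>S. \<forall>t\<in>S. \<forall>f\<in>Mor C s t. f \<noteq> Zero C s t \<longrightarrow> is_iso C s t f)"

text \<open>
  One degree of negative orthogonality makes the extension closure an abelian category in which short
  triangles are the short exact sequences; this is a $2$-orthogonal collection of arbitrary size.
\<close>

definition proper_semibrick :: "('k, 'o, 'm, 'z) tri_cat_scheme \<Rightarrow> 'o set \<Rightarrow> bool"
  where "proper_semibrick C S \<longleftrightarrow> semibrick C S \<and> hom_orth C S (Desusp C ` S)"

lemma semibrick_op: "semibrick (op_cat C) S \<longleftrightarrow> semibrick C S"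
  by (auto simp: semibrick_def)

lemma semibrick_subset: "semibrick C S \<Longrightarrow> S' \<subseteq> S \<Longrightarrow> semibrick C S'"
  unfolding semibrick_def by (meson subsetD)

lemma proper_semibrick_subset: "proper_semibrick C S \<Longrightarrow> S' \<subseteq> S \<Longrightarrow> proper_semibrick C S'"
  unfolding proper_semibrick_def by (meson semibrick_subset hom_orth_subset image_mono)

lemma kernel_in_op: "kernel_in (op_cat C) A n x y \<kappa> f \<longleftrightarrow> cokernel_in C A y x n f \<kappa>"
  by (auto simp: kernel_in_def cokernel_in_def)

lemma cokernel_in_op: "cokernel_in (op_cat C) A x y q f \<pi> \<longleftrightarrow> kernel_in C A q y x \<pi> f"
  by (auto simp: kernel_in_def cokernel_in_def)

lemma mono_in_op: "mono_in (op_cat C) A x y f \<longleftrightarrow> epi_in C A y x f"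
  by (auto simp: mono_in_def epi_in_def)

context triangulated_category
begin

text \<open>
  The octahedron in terms of fibres.  The fibre \<open>k\<close> of the composite is given rather than constructed,
  so that a known object can be recognised as an extension.
\<close>

lemma fibre_of_comp:
  assumes t: "Tri C s x y f g h" and t': "Tri C s' y z f' g' h'" and k: "Tri C k x z u (g' \<cdot> g) v"
  obtains p q r where "Tri C s k s' p q r"
proof -
  obtain p q where "Tri C (Desusp C s') s k
      ((\<ominus>\<^bsub>Hom C (Desusp C y) s\<^esub> DesuspM C h) \<cdot> DesuspM C f') p q"
    by (rule octahedral_op[OF tri_rotate_bwd[OF t'] tri_rotate_bwd[OF t] tri_rotate_bwd[OF k]])
  from tri_rotate_fwd[OF this] show ?thesis using that by simp
qed

lemma fibre_of_comp_exists:
  assumes t: "Tri C s x y f g h" and t': "Tri C s' y z f' g' h'"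
  obtains k u v p q r where "Tri C k x z u (g' \<cdot> g) v" "Tri C s k s' p q r"
proof -
  obtain w a b where w: "Tri C x z w (g' \<cdot> g) a b"
    using tri_complete[OF comp_closed[OF tri_mor(2)[OF t] tri_mor(2)[OF t']]] by blast
  show ?thesis by (rule fibre_of_comp[OF t t' tri_rotate_bwd[OF w]]) (rule that[OF tri_rotate_bwd[OF w]])
qed

lemma tri_iso_first:
  assumes t: "Tri C x y z f g h" and p: "is_iso C x' x p"
  obtains h' where "Tri C x' y z (f \<cdot> p) g h'"
proof -
  note m = tri_mor[OF t]
  obtain p' where p': "p \<in> Mor C x' x" "p' \<in> Mor C x x'" "p' \<cdot> p = Id C x'" "p \<cdot> p' = Id C x"
    "is_iso C x x' p'" using p by (rule is_isoE)
  have "Tri C x' y z (f \<cdot> p) g (SuspM C p' \<cdot> h)"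
    by (rule tri_iso[OF t p'(5) is_iso_id is_iso_id])
      (simp_all add: comp_closed[OF p'(1) m(1)] m comp_closed[OF m(3) susp_mor[OF p'(2)]]
        comp_assoc[OF p'(2,1) m(1)] p' id_right[OF m(1)] id_left[OF m(1)] id_right[OF m(2)]
        id_left[OF m(2)] id_right[OF comp_closed[OF m(3) susp_mor[OF p'(2)]]])
  then show ?thesis by (rule that)
qed

lemma tri_iso_of_zero_left:
  assumes t: "Tri C x y z f g h" and x: "zero_object C x"
  shows "is_iso C y z g"
  using tri_iso_of_zero[OF tri_rotate_fwd[OF t]] x zero_object_susp by blast

text \<open>
  A nonzero map from a simple object is like the inclusion of a simple subobject: its quotient has
  length one less.  Let $s'$ be the top factor of $a$.  If $s \to a \to s'$ vanishes, then $s$ maps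
  into the first part of the filtration, and induction applies there.  Otherwise $s \to s'$ is
  invertible, $a$ splits, and the quotient by $s$ is the first part.
\<close>

lemma cone_of_simple_in_ext_power:
  assumes S: "semibrick C S" and s: "s \<in> S"
  shows "a \<in> ext_power C S n \<Longrightarrow> Tri C s a c f g h \<Longrightarrow> f \<noteq> Zero C s a
    \<Longrightarrow> \<exists>m. n = Suc m \<and> c \<in> ext_power C S m"
proof (induction n arbitrary: a c f g h)
  case 0
  then show ?case using tri_mor(1)[OF 0(2)] zero_object_hom_zero(2) hom_zeroD by force
next
  case (Suc n)
  note m = tri_mor[OF Suc.prems(2)]
  obtain a' s' i p r where a': "a' \<in> ext_power C S n" and s': "s' \<in> S \<union> {x. zero_object C x}"
    and t: "Tri C a' a s' i p r" using Suc.prems(1) unfolding ext_power.simps by (rule starE)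
  note mt = tri_mor[OF t]
  show ?case
  proof (cases "p \<cdot> f = Zero C s s'")
    case True
    then obtain f' where f': "f' \<in> Mor C s a'" "f = i \<cdot> f'" by (rule tri_lift[OF t m(1)])
    have nz: "f' \<noteq> Zero C s a'" using f' Suc.prems(3) comp_zero_right[OF mt(1)] by auto
    obtain c' g' h' where c': "Tri C s a' c' f' g' h'" using tri_complete[OF f'(1)] by blast
    obtain k where k: "n = Suc k" "c' \<in> ext_power C S k" using Suc.IH[OF a' c' nz] by blast
    obtain p' q' r' where "Tri C c' c s' p' q' r'"
      using tri_octahedral[OF c' t] Suc.prems(2) f'(2) by blast
    then have "c \<in> star C (ext_power C S k) (S \<union> {x. zero_object C x})" using k(2) s' by (rule starI)
    then show ?thesis using k(1) by simp
  next
    case False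
    have pf: "p \<cdot> f \<in> Mor C s s'" by (rule comp_closed[OF m(1) mt(2)])
    have "s' \<in> S" using s' False pf zero_object_hom_zero(2)[of s' s] hom_zeroD by auto
    then have iso: "is_iso C s s' (p \<cdot> f)" using S s pf False by (simp add: semibrick_def)
    obtain z where z: "zero_object C z" using ex_zero_object by blast
    obtain p' q' r' where "Tri C c z (Susp C a') p' q' r'"
      using tri_octahedral[OF Suc.prems(2) tri_rotate_fwd[OF t] tri_of_iso[OF iso z]] by blast
    from tri_iso_of_zero[OF tri_rotate_bwd[OF this] z] have "isomorphic C a' c"
      by (auto dest: isomorphicI)
    then show ?thesis using a' ext_power_iso_closed unfolding iso_closed_def by blast
  qed
qed

lemma cone_of_simple:
  assumes S: "semibrick C S" and s: "s \<in> S" and a: "a \<in> ext_closure C S"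
    and t: "Tri C s a c f g h" and f: "f \<noteq> Zero C s a"
  shows "c \<in> ext_closure C S"
  using cone_of_simple_in_ext_power[OF S s _ t f] a by (auto simp: ext_closure_def)

text \<open>
  The cone of a morphism $f : a \to b$ is an extension of a cokernel $q$ by a suspended kernel
  $\Sigma k$, and the fibre $m$ of $b \to q$ is the image.  The induction peels off a simple
  subobject $s$ of $a$.  If $f$ kills $s$, then $s$ is added to the kernel of the induced map
  $a/s \to b$.  If not, then $s$ embeds into $b$, the map $a/s \to b/s$ has the same cone as $f$, and
  $s$ is added to the image.  The membership of $m$ is carried along because it does not follow from
  the decomposition of the cone.
\<close>

lemma ext_closure_cone_decomposition:
  assumes S: "semibrick C S"
  shows "a \<in> ext_power C S n \<Longrightarrow> b \<in> ext_closure C S \<Longrightarrow> Tri C a b c f g h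
    \<Longrightarrow> \<exists>k\<in>ext_closure C S. \<exists>q\<in>ext_closure C S. \<exists>m\<in>ext_closure C S. \<exists>u \<pi> v i d.
      Tri C (Susp C k) c q u \<pi> v \<and> Tri C m b q i (\<pi> \<cdot> g) d"
proof (induction n arbitrary: a b c f g h)
  case 0
  then have z: "zero_object C a" and t: "Tri C a b c f g h" by auto
  note m = tri_mor[OF t]
  have "isomorphic C b c" using tri_iso_of_zero_left[OF t z] by (rule isomorphicI)
  then have "c \<in> ext_closure C S" using 0(2) ext_closure_iso_closed unfolding iso_closed_def by blast
  moreover have "Tri C (Susp C a) c c (Zero C (Susp C a) c) (Id C c) (Zero C c (Susp C (Susp C a)))"
    using tri_id' z zero_object_susp by blast
  moreover have "Tri C a b c f (Id C c \<cdot> g) h" using t id_left[OF m(2)] by simp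
  ultimately show ?case using zero_in_ext_closure[OF z, of S] by blast
next
  case (Suc n)
  note t = Suc.prems(3)
  note m = tri_mor[OF t]
  obtain s a' j e r where s: "s \<in> S \<union> {x. zero_object C x}" and a': "a' \<in> ext_power C S n"
    and ts: "Tri C s a a' j e r"
    using Suc.prems(1) unfolding ext_power_Suc_left by (rule starE)
  note ms = tri_mor[OF ts]
  have s': "s \<in> ext_closure C S" using s ext_closure_superset zero_in_ext_closure by blast
  show ?case
  proof (cases "f \<cdot> j = Zero C s b")
    case True
    then obtain f' where f': "f' \<in> Mor C a' b" "f = f' \<cdot> e" by (rule tri_extend[OF ts m(1)])
    obtain c' g' h' where c': "Tri C a' b c' f' g' h'" using tri_complete[OF f'(1)] by blast
    note mc = tri_mor[OF c']
    obtain k q n' u \<pi> v i d where kq: "k \<in> ext_closure C S" "q \<in> ext_closure C S"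
        "n' \<in> ext_closure C S" "Tri C (Susp C k) c' q u \<pi> v" "Tri C n' b q i (\<pi> \<cdot> g') d"
      using Suc.IH[OF a' Suc.prems(2) c'] by blast
    obtain P Q R where PQ: "Tri C (Susp C s) c c' P Q R" "Q \<cdot> g = g'"
      using tri_octahedral[OF tri_rotate_fwd[OF ts] c'] t f'(2) by blast
    obtain w u' v' p' q' r' where w: "Tri C w c q u' (\<pi> \<cdot> Q) v'" "Tri C (Susp C s) w (Susp C k) p' q' r'"
      by (rule fibre_of_comp_exists[OF PQ(1) kq(4)])
    have "Desusp C w \<in> ext_closure C S"
      using ext_closure_extension[OF tri_desusp[OF w(2)]] s' kq(1) by simp
    moreover have "Tri C n' b q i ((\<pi> \<cdot> Q) \<cdot> g) d"
      using kq(5) PQ(2) comp_assoc[OF m(2) tri_mor(2)[OF PQ(1)] tri_mor(2)[OF kq(4)]] by simp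
    moreover have "Tri C (Susp C (Desusp C w)) c q u' (\<pi> \<cdot> Q) v'" using w(1) by simp
    ultimately show ?thesis using kq(2,3) by blast
  next
    case False
    have fj: "f \<cdot> j \<in> Mor C s b" by (rule comp_closed[OF ms(1) m(1)])
    have sS: "s \<in> S" using s False fj zero_object_hom_zero(1)[of s b] hom_zeroD by auto
    obtain b' \<beta> \<gamma> where b': "Tri C s b b' (f \<cdot> j) \<beta> \<gamma>" using tri_complete[OF fj] by blast
    note mb = tri_mor[OF b']
    have b'S: "b' \<in> ext_closure C S" by (rule cone_of_simple[OF S sS Suc.prems(2) b' False])
    obtain P Q R where PQ: "Tri C a' b' c P Q R" "Q \<cdot> \<beta> = g"
      using tri_octahedral[OF ts t b'] by blast
    obtain k q n' u \<pi> v i d where kq: "k \<in> ext_closure C S" "q \<in> ext_closure C S"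
        "n' \<in> ext_closure C S" "Tri C (Susp C k) c q u \<pi> v" "Tri C n' b' q i (\<pi> \<cdot> Q) d"
      using Suc.IH[OF a' b'S PQ(1)] by blast
    obtain w u' v' p' q' r' where w: "Tri C w b q u' ((\<pi> \<cdot> Q) \<cdot> \<beta>) v'" "Tri C s w n' p' q' r'"
      by (rule fibre_of_comp_exists[OF b' kq(5)])
    have "w \<in> ext_closure C S" using ext_closure_extension[OF w(2)] s' kq(3) by simp
    moreover have "Tri C w b q u' (\<pi> \<cdot> g) v'"
      using w(1) PQ(2) comp_assoc[OF mb(2) tri_mor(2)[OF PQ(1)] tri_mor(2)[OF kq(4)]] by simp
    ultimately show ?thesis using kq by blast
  qed
qed

text \<open>
  The octahedron on $b \to c \to q$, where $c$ is the cone of $f$, turns the decomposition of $c$ into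
  a factorization of $f$ through its image.
\<close>

lemma ext_closure_factorization:
  assumes S: "semibrick C S" and a: "a \<in> ext_closure C S" and b: "b \<in> ext_closure C S"
    and f: "f \<in> Mor C a b"
  obtains k m q \<kappa> p r i \<pi> d where "k \<in> ext_closure C S" "m \<in> ext_closure C S" "q \<in> ext_closure C S"
    "Tri C k a m \<kappa> p r" "Tri C m b q i \<pi> d" "f = i \<cdot> p"
proof -
  obtain c g h where t: "Tri C a b c f g h" using tri_complete[OF f] by blast
  note mt = tri_mor[OF t]
  obtain n where "a \<in> ext_power C S n" using a by (auto simp: ext_closure_def)
  from ext_closure_cone_decomposition[OF S this b t]
  obtain k q m u \<pi> v i d where kq: "k \<in> ext_closure C S" "q \<in> ext_closure C S" "m \<in> ext_closure C S"
    "Tri C (Susp C k) c q u \<pi> v" "Tri C m b q i (\<pi> \<cdot> g) d" by blast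
  note mi = tri_mor[OF kq(5)]
  obtain P Q R where PQ: "Tri C (Susp C a) (Susp C m) (Susp C (Susp C k)) P Q R"
    "(\<ominus>\<^bsub>Hom C (Susp C m) (Susp C b)\<^esub> SuspM C i) \<cdot> P = \<ominus>\<^bsub>Hom C (Susp C a) (Susp C b)\<^esub> SuspM C f"
    using tri_octahedral[OF tri_rotate_fwd[OF t] tri_rotate_fwd[OF kq(4)] tri_rotate_fwd[OF kq(5)]]
    by blast
  note P = tri_mor(1)[OF PQ(1)]
  have p: "DesuspM C P \<in> Mor C a m" using desusp_closed[OF P] by simp
  have "SuspM C i \<cdot> P = SuspM C f"
    using PQ(2) comp_neg_left[OF P susp_mor[OF mi(1)]]
      neg_neg[OF comp_closed[OF P susp_mor[OF mi(1)]]] neg_neg[OF susp_mor[OF f]] by metis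
  then have "f = i \<cdot> DesuspM C P"
    using desusp_comp[OF P susp_mor[OF mi(1)]] desusp_susp[OF mi(1)] desusp_susp[OF f] by simp
  moreover obtain \<kappa> r where "Tri C k a m \<kappa> (DesuspM C P) r"
    using tri_rotate_bwd[OF tri_desusp[OF PQ(1)]] by auto
  ultimately show ?thesis using that kq by blast
qed

lemma proper_semibrick_orth:
  "proper_semibrick C S \<Longrightarrow> hom_orth C (ext_closure C S) (Desusp C ` ext_closure C S)"
  unfolding proper_semibrick_def using hom_orth_ext_closures by (metis ext_closure_desusp)

lemma hom_orth_susp_left: "hom_orth C (Susp C ` A) B \<longleftrightarrow> hom_orth C A (Desusp C ` B)"
  unfolding hom_orth_def using hom_zero_desusp[of "Susp C _", simplified] by auto

lemma proper_semibrick_op: "proper_semibrick (op_cat C) S \<longleftrightarrow> proper_semibrick C S"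
  unfolding proper_semibrick_def by (simp add: semibrick_op hom_orth_op hom_orth_susp_left)

lemma proper_semibrick_desusp: "proper_semibrick C S \<Longrightarrow> proper_semibrick C (Desusp C ` S)"
proof -
  assume S: "proper_semibrick C S"
  have "is_iso C (Desusp C s) (Desusp C t) f"
    if "s \<in> S" "t \<in> S" and f: "f \<in> Mor C (Desusp C s) (Desusp C t)" "f \<noteq> Zero C (Desusp C s) (Desusp C t)"
    for s t f
  proof -
    have Sf: "SuspM C f \<in> Mor C s t" using susp_mor[OF f(1)] by simp
    have "SuspM C f \<noteq> Zero C s t" using desusp_susp[OF f(1)] desusp_zero[of s t] f(2) by auto
    then have "is_iso C s t (SuspM C f)"
      using S that Sf by (simp add: proper_semibrick_def semibrick_def)
    from desusp_iso[OF this] show ?thesis using desusp_susp[OF f(1)] by simp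
  qed
  then show ?thesis
    using S by (auto simp: proper_semibrick_def semibrick_def hom_orth_desusp zero_object_desusp)
qed

subsection \<open>The abelian structure\<close>

text \<open>
  The lifting exists in any triangle; its uniqueness is where $\mathrm{Hom}(X, \Sigma^{-1}X) = 0$ enters.
\<close>

lemma triangle_kernel:
  assumes X: "hom_orth C X (Desusp C ` X)" and t: "Tri C x y z f g h"
    and m: "x \<in> X" "y \<in> X" "z \<in> X"
  shows "kernel_in C X x y z f g"
  unfolding kernel_in_def
proof (intro conjI ballI impI)
  note mt = tri_mor[OF t]
  fix u k assume u: "u \<in> X" and k: "k \<in> Mor C u y" "g \<cdot> k = Zero C u z"
  obtain l where l: "l \<in> Mor C u x" "k = f \<cdot> l" by (rule tri_lift[OF t k])
  have "l' = l" if "l' \<in> Mor C u x" "f \<cdot> l' = k" for l'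
  proof (rule left_cancel[OF mt(1) that(1) l(1)])
    show "d = Zero C u x" if "d \<in> Mor C u x" "f \<cdot> d = Zero C u y" for d
      using tri_mono[OF t _ that] X u m(3) by (simp add: hom_orth_def)
  qed (use that l in simp)
  then show "\<exists>!l. l \<in> Mor C u x \<and> f \<cdot> l = k" using l by metis
qed (use m tri_mor[OF t] tri_comp_zero[OF t] in auto)

lemma triangle_short_exact:
  assumes X: "hom_orth C X (Desusp C ` X)" and t: "Tri C x y z f g h"
    and m: "x \<in> X" "y \<in> X" "z \<in> X"
  shows "short_exact_in C X x y z f g"
proof -
  interpret op: triangulated_category K "op_cat C" by (rule op_triangulated)
  have "kernel_in (op_cat C) X z y x g f"
    by (rule op.triangle_kernel[where h = "\<ominus>\<^bsub>Hom C (Desusp C z) x\<^esub> DesuspM C h"])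
      (use X t m in \<open>simp_all add: hom_orth_op hom_orth_susp_left tri_rotate_bwd\<close>)
  then show ?thesis unfolding short_exact_in_def kernel_in_op using triangle_kernel[OF X t m] by simp
qed

text \<open>
  In the factorization of a monomorphism the kernel part is killed, so the first map is invertible and
  the cone is the cokernel.
\<close>

lemma cone_of_monomorphism:
  assumes S: "proper_semibrick C S" and a: "a \<in> ext_closure C S" and b: "b \<in> ext_closure C S"
    and f: "f \<in> Mor C a b"
    and mono: "\<And>u h. u \<in> ext_closure C S \<Longrightarrow> h \<in> Mor C u a \<Longrightarrow> f \<cdot> h = Zero C u b \<Longrightarrow> h = Zero C u a"
  obtains q g h where "q \<in> ext_closure C S" "Tri C a b q f g h"
proof -
  have sb: "semibrick C S" using S by (simp add: proper_semibrick_def)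
  obtain k m q \<kappa> p r i \<pi> d where F: "k \<in> ext_closure C S" "m \<in> ext_closure C S" "q \<in> ext_closure C S"
    "Tri C k a m \<kappa> p r" "Tri C m b q i \<pi> d" "f = i \<cdot> p"
    by (rule ext_closure_factorization[OF sb a b f])
  note m1 = tri_mor[OF F(4)] and m2 = tri_mor[OF F(5)]
  have "f \<cdot> \<kappa> = Zero C k b"
    using F(6) comp_assoc[OF m1(1,2) m2(1)] tri_comp_zero(1)[OF F(4)] comp_zero_right[OF m2(1)] by simp
  then have "\<kappa> = Zero C k a" using mono[OF F(1) m1(1)] by simp
  then have "\<kappa> \<cdot> Id C k = Zero C k a" using comp_zero_left[OF id_closed] by simp
  then have "Id C k = Zero C k k"
    using tri_mono[OF F(4) _ id_closed] proper_semibrick_orth[OF S] F(1,2) by (simp add: hom_orth_def)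
  then have "is_iso C a m p" using tri_iso_of_zero_left[OF F(4)] zero_object_iff_id by blast
  from tri_iso_first[OF F(5) this] show ?thesis using that[OF F(3)] F(6) by metis
qed

lemma ext_closure_kernels:
  assumes S: "proper_semibrick C S" and a: "a \<in> ext_closure C S" and b: "b \<in> ext_closure C S"
    and f: "f \<in> Mor C a b"
  shows "\<exists>k \<kappa>. kernel_in C (ext_closure C S) k a b \<kappa> f"
proof -
  have sb: "semibrick C S" using S by (simp add: proper_semibrick_def)
  let ?A = "ext_closure C S"
  obtain k m q \<kappa> p r i \<pi> d where F: "k \<in> ?A" "m \<in> ?A" "q \<in> ?A"
    "Tri C k a m \<kappa> p r" "Tri C m b q i \<pi> d" "f = i \<cdot> p"
    by (rule ext_closure_factorization[OF sb a b f])
  note m1 = tri_mor[OF F(4)] and m2 = tri_mor[OF F(5)]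
  have ker: "kernel_in C ?A k a m \<kappa> p"
    by (rule triangle_kernel[OF proper_semibrick_orth[OF S] F(4,1) a F(2)])
  have "p \<cdot> h = Zero C u m" if u: "u \<in> ?A" and h: "h \<in> Mor C u a" and "f \<cdot> h = Zero C u b" for u h
  proof (rule tri_mono[OF F(5) _ comp_closed[OF h m1(2)]])
    show "hom_zero C u (Desusp C q)"
      using proper_semibrick_orth[OF S] u F(3) by (simp add: hom_orth_def)
    show "i \<cdot> (p \<cdot> h) = Zero C u b" using that F(6) comp_assoc[OF h m1(2) m2(1)] by simp
  qed
  moreover have "f \<cdot> \<kappa> = Zero C k b"
    using F(6) comp_assoc[OF m1(1,2) m2(1)] tri_comp_zero(1)[OF F(4)] comp_zero_right[OF m2(1)] by simp
  ultimately have "kernel_in C ?A k a b \<kappa> f"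
    using ker b f unfolding kernel_in_def by simp
  then show ?thesis by blast
qed

lemma ext_closure_mono_kernel:
  assumes S: "proper_semibrick C S" and f: "mono_in C (ext_closure C S) x y f"
  shows "\<exists>z g. kernel_in C (ext_closure C S) x y z f g"
proof -
  have m: "x \<in> ext_closure C S" "y \<in> ext_closure C S" "f \<in> Mor C x y" using f by (auto simp: mono_in_def)
  obtain q g h where q: "q \<in> ext_closure C S" "Tri C x y q f g h"
  proof (rule cone_of_monomorphism[OF S m])
    fix u h assume u: "u \<in> ext_closure C S" "h \<in> Mor C u x" and z: "f \<cdot> h = Zero C u y"
    have "f \<cdot> h = f \<cdot> Zero C u x" using z comp_zero_right[OF m(3)] by simp
    then show "h = Zero C u x" using f u zero_mor[of u x] unfolding mono_in_def by blast
  qed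
  then show ?thesis using triangle_kernel[OF proper_semibrick_orth[OF S] q(2) m(1,2) q(1)] by blast
qed

text \<open>
  Working with a trivial extension rather than with a given biproduct of the ambient category shows at
  once that the sum lies in the extension closure.
\<close>

lemma biproduct_of_trivial_extension:
  assumes t: "Tri C x b y i q (Zero C y (Susp C x))"
  shows "biproduct C x y b"
proof -
  note m = tri_mor[OF t]
  obtain j where j: "j \<in> Mor C y b" "Id C y = q \<cdot> j"
    using tri_lift2[OF t id_closed] comp_zero_left[OF id_closed] by metis
  have "Zero C (Desusp C y) x = \<ominus>\<^bsub>Hom C (Desusp C y) x\<^esub> DesuspM C (Zero C y (Susp C x))"
    by (simp add: desusp_zero neg_zero)
  then have t': "Tri C (Desusp C y) x b (Zero C (Desusp C y) x) i q" using tri_rotate_bwd[OF t] by simp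
  \<comment> \<open>The retraction along \<open>i\<close> is chosen to vanish on the complement \<open>j\<close>.\<close>
  have jq: "j \<cdot> q \<in> Mor C b b" by (rule comp_closed[OF m(2) j(1)])
  define e where "e = Id C b \<ominus>\<^bsub>Hom C b b\<^esub> (j \<cdot> q)"
  have e: "e \<in> Mor C b b" unfolding e_def by (rule diff_mor[OF id_closed jq])
  have qjq: "q \<cdot> (j \<cdot> q) = q" using comp_assoc[OF m(2) j(1) m(2)] j(2) id_left[OF m(2)] by simp
  have "q \<cdot> e = Zero C b y"
    unfolding e_def using comp_diff_right[OF id_closed jq m(2)] qjq diff_self[OF m(2)] id_right[OF m(2)]
    by simp
  then obtain p where p: "p \<in> Mor C b x" "e = i \<cdot> p" by (rule tri_lift[OF t e])
  have inj: "d = Zero C w x" if d: "d \<in> Mor C w x" "i \<cdot> d = Zero C w b" for d w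
  proof -
    obtain v where "v \<in> Mor C w (Desusp C y)" "d = Zero C (Desusp C y) x \<cdot> v" by (rule tri_lift[OF t' d])
    then show ?thesis by (simp add: comp_zero_left)
  qed
  have "e \<cdot> i = i"
  proof -
    have "(j \<cdot> q) \<cdot> i = Zero C x b"
      using comp_assoc[OF m(1,2) j(1)] tri_comp_zero(1)[OF t] comp_zero_right[OF j(1)] by simp
    then have "e \<cdot> i = i \<ominus>\<^bsub>Hom C x b\<^esub> Zero C x b"
      unfolding e_def using comp_diff_left[OF m(1) id_closed jq] id_left[OF m(1)] by simp
    then show ?thesis using abelian_monoid.r_zero[OF abelian_group.axioms(1)[OF hom_abelian]] m(1)
      by (simp add: a_minus_def neg_zero)
  qed
  then have "i \<cdot> (p \<cdot> i) = i \<cdot> Id C x"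
    using comp_assoc[OF m(1) p(1) m(1)] p(2) id_right[OF m(1)] by simp
  then have pi: "p \<cdot> i = Id C x" using left_cancel[OF m(1) comp_closed[OF m(1) p(1)] id_closed] inj by blast
  have "e \<cdot> j = Zero C y b"
  proof -
    have "(j \<cdot> q) \<cdot> j = j" using comp_assoc[OF j(1) m(2) j(1)] j(2) id_right[OF j(1)] by simp
    then show ?thesis
      unfolding e_def using comp_diff_left[OF j(1) id_closed jq] id_left[OF j(1)] diff_self[OF j(1)] by simp
  qed
  then have "i \<cdot> (p \<cdot> j) = Zero C y b" using comp_assoc[OF j(1) p(1) m(1)] p(2) by simp
  then have pj: "p \<cdot> j = Zero C y x" using inj[OF comp_closed[OF j(1) p(1)]] by simp
  have sum: "(i \<cdot> p) \<oplus>\<^bsub>Hom C b b\<^esub> (j \<cdot> q) = Id C b"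
  proof -
    interpret A: abelian_group "Hom C b b" by (rule hom_abelian)
    show ?thesis unfolding p(2)[symmetric] e_def a_minus_def
      using A.a_assoc[OF id_closed neg_mor[OF jq] jq] A.l_neg[OF jq] A.r_zero[OF id_closed] by simp
  qed
  show ?thesis
    unfolding biproduct_def using m j p(1) pi pj sum tri_comp_zero(1)[OF t] by metis
qed

lemma ext_closure_biproducts:
  assumes x: "x \<in> ext_closure C S" and y: "y \<in> ext_closure C S"
  shows "\<exists>b\<in>ext_closure C S. biproduct C x y b"
proof -
  obtain b i q where t: "Tri C (Desusp C y) x b (Zero C (Desusp C y) x) i q"
    using tri_complete[OF zero_mor] by blast
  have "Tri C x b y i q (Zero C y (Susp C x))"
    using tri_rotate_fwd[OF t] by (simp add: susp_zero neg_zero)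
  then show ?thesis using biproduct_of_trivial_extension ext_closure_extension x y by blast
qed

lemma proper_semibrick_abelian:
  assumes S: "proper_semibrick C S"
  shows "abelian_subcategory C (ext_closure C S)"
proof -
  interpret op: triangulated_category K "op_cat C" by (rule op_triangulated)
  have S': "proper_semibrick (op_cat C) S" using S by (simp add: proper_semibrick_op)
  have "\<exists>q \<pi>. cokernel_in C (ext_closure C S) x y q f \<pi>"
    if "x \<in> ext_closure C S" "y \<in> ext_closure C S" "f \<in> Mor C x y" for x y f
    using op.ext_closure_kernels[OF S', of y x f] that by (simp add: ext_closure_op kernel_in_op)
  moreover have "\<exists>z g. cokernel_in C (ext_closure C S) z x y g f"
    if "epi_in C (ext_closure C S) x y f" for x y f
    using op.ext_closure_mono_kernel[OF S', of y x f] that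
    by (simp add: ext_closure_op kernel_in_op mono_in_op)
  ultimately show ?thesis
    unfolding abelian_subcategory_def
    using ex_zero_object zero_in_ext_closure ext_closure_biproducts ext_closure_kernels[OF S]
      ext_closure_mono_kernel[OF S] by metis
qed

end

section \<open>Torsion decompositions and covers\<close>

text \<open>
  A cover without the minimality condition, also called a right approximation.
\<close>

definition is_precover ::
    "('k, 'o, 'm, 'z) lin_cat_scheme \<Rightarrow> 'o set \<Rightarrow> 'o \<Rightarrow> 'o \<Rightarrow> 'm \<Rightarrow> bool"
  where "is_precover C X x c \<tau> \<longleftrightarrow> x \<in> X \<and> \<tau> \<in> Mor C x c \<and>
    (\<forall>x' \<in> X. \<forall>f \<in> Mor C x' c. \<exists>g \<in> Mor C x' x. f = \<tau> \<cdot>\<^bsub>C\<^esub> g)"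

definition retract_closed :: "('k, 'o, 'm, 'z) lin_cat_scheme \<Rightarrow> 'o set \<Rightarrow> bool"
  where "retract_closed C Y \<longleftrightarrow>
    (\<forall>y\<in>Y. \<forall>c. \<forall>\<iota>\<in>Mor C c y. \<forall>\<pi>\<in>Mor C y c. \<pi> \<cdot>\<^bsub>C\<^esub> \<iota> = Id C c \<longrightarrow> c \<in> Y)"

lemma is_cover_precover: "is_cover C X x c \<tau> \<longleftrightarrow> is_precover C X x c \<tau> \<and>
    (\<forall>\<phi> \<in> Mor C x x. \<tau> \<cdot>\<^bsub>C\<^esub> \<phi> = \<tau> \<longrightarrow> is_iso C x x \<phi>)"
  by (auto simp: is_cover_def is_precover_def)

lemma precover_factor:
  assumes "is_precover C X x c \<tau>" "x' \<in> X" "f \<in> Mor C x' c"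
  obtains g where "g \<in> Mor C x' x" "f = \<tau> \<cdot>\<^bsub>C\<^esub> g"
  using assms unfolding is_precover_def by blast

lemma precover_mor: "is_precover C X x c \<tau> \<Longrightarrow> \<tau> \<in> Mor C x c" "is_precover C X x c \<tau> \<Longrightarrow> x \<in> X"
  by (auto simp: is_precover_def)

context triangulated_category
begin

lemma in_right_perp_ext_closure: "c \<in> right_perp C (ext_closure C S) \<longleftrightarrow> hom_orth C S {c}"
  unfolding right_perp_eq
  using hom_orth_ext_closure_left[of S "{c}"] hom_orth_subset[OF _ ext_closure_superset, of C S "{c}" "{c}"]
  by blast

text \<open>
  As long as some member of \<open>S'\<close> maps nontrivially to \<open>a\<close>, it can be split off as a subobject and
  shortens \<open>a\<close>; these subobjects build up the torsion part.  The torsion-free quotient is no longer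
  than \<open>a\<close>, and this bound drives a later induction on length.
\<close>

lemma torsion_decomposition:
  assumes S: "semibrick C S" and S': "S' \<subseteq> S"
  shows "a \<in> ext_power C S n \<Longrightarrow>
    a \<in> star C (ext_closure C S') (right_perp C (ext_closure C S') \<inter> ext_power C S n)"
proof (induction n arbitrary: a rule: less_induct)
  case (less n)
  let ?T = "ext_closure C S'" and ?F = "right_perp C (ext_closure C S')"
  show ?case
  proof (cases "hom_orth C S' {a}")
    case True
    obtain z where z: "zero_object C z" using ex_zero_object by blast
    show ?thesis
      by (rule starI[OF tri_id'[OF z]]) (use True less.prems z zero_in_ext_closure in_right_perp_ext_closure in auto)
  next
    case False
    then obtain s f where s: "s \<in> S'" and f: "f \<in> Mor C s a" "f \<noteq> Zero C s a"
      unfolding hom_orth_def by (metis hom_zeroI singletonD)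
    obtain c g h where t: "Tri C s a c f g h" using tri_complete[OF f(1)] by blast
    obtain m where m: "n = Suc m" "c \<in> ext_power C S m"
      using cone_of_simple_in_ext_power[OF S _ less.prems t f(2)] s S' by blast
    have "c \<in> star C ?T (?F \<inter> ext_power C S m)" using less.IH m by simp
    then have "c \<in> star C ?T (?F \<inter> ext_power C S n)"
      using star_mono[of ?T ?T "?F \<inter> ext_power C S m" "?F \<inter> ext_power C S n" C]
        ext_power_mono[of m n S] m(1) by auto
    then have "a \<in> star C ?T (star C ?T (?F \<inter> ext_power C S n))"
      using s ext_closure_superset[of S'] starI[OF t] by blast
    then have "a \<in> star C (star C ?T ?T) (?F \<inter> ext_power C S n)" by (simp add: star_assoc)
    then show ?thesis using star_mono[OF ext_closure_star[of S'] subset_refl] by blast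
  qed
qed

lemma ext_closure_torsion:
  assumes S: "semibrick C S" and S': "S' \<subseteq> S" and a: "a \<in> ext_closure C S"
  shows "a \<in> star C (ext_closure C S') (right_perp C (ext_closure C S') \<inter> ext_closure C S)"
proof -
  obtain n where "a \<in> ext_power C S n" using a by (auto simp: ext_closure_def)
  moreover have "right_perp C (ext_closure C S') \<inter> ext_power C S n
      \<subseteq> right_perp C (ext_closure C S') \<inter> ext_closure C S"
    by (auto simp: ext_closure_def)
  ultimately show ?thesis using torsion_decomposition[OF S S'] star_mono[OF subset_refl] by blast
qed

subsection \<open>Covers\<close>

text \<open>
  Injectivity of $\varphi \circ -$ passes from simple objects to all objects of finite length: a map
  killed by \<open>\<phi>\<close> vanishes on the bottom factor, hence factors through the quotient, and it is still
  killed there because $\mathrm{Hom}(\Sigma S, y) = 0$.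
\<close>

lemma faithful_on_ext_closure:
  assumes \<phi>: "\<phi> \<in> Mor C x y" and y: "hom_orth C S (Desusp C ` {y})"
    and inj: "\<And>s f. s \<in> S \<Longrightarrow> f \<in> Mor C s x \<Longrightarrow> \<phi> \<cdot> f = Zero C s y \<Longrightarrow> f = Zero C s x"
  shows "u \<in> ext_power C S n \<Longrightarrow> h \<in> Mor C u x \<Longrightarrow> \<phi> \<cdot> h = Zero C u y \<Longrightarrow> h = Zero C u x"
proof (induction n arbitrary: u h)
  case 0
  then show ?case using zero_object_hom_zero(1) hom_zeroD by auto
next
  case (Suc n)
  obtain s u' j e r where s: "s \<in> S \<union> {x. zero_object C x}" and u': "u' \<in> ext_power C S n"
    and t: "Tri C s u u' j e r"
    using Suc.prems(1) unfolding ext_power_Suc_left by (rule starE)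
  note m = tri_mor[OF t] and h = Suc.prems(2)
  have hj: "h \<cdot> j \<in> Mor C s x" by (rule comp_closed[OF m(1) h])
  have "\<phi> \<cdot> (h \<cdot> j) = Zero C s y" using comp_assoc[OF m(1) h \<phi>] Suc.prems(3) comp_zero_left[OF m(1)] by simp
  then have "h \<cdot> j = Zero C s x"
    using s inj[OF _ hj] zero_object_hom_zero(1)[of s x] hom_zeroD[OF _ hj] by auto
  then obtain h' where h': "h' \<in> Mor C u' x" "h = h' \<cdot> e" by (rule tri_extend[OF t h])
  have "hom_zero C (Susp C s) y"
    using s y zero_object_hom_zero(1)[of "Susp C s" y] hom_zero_desusp[of "Susp C s" y]
    by (auto simp: hom_orth_def zero_object_susp)
  moreover have "(\<phi> \<cdot> h') \<cdot> e = Zero C u y"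
    using comp_assoc[OF m(2) h'(1) \<phi>] h'(2) Suc.prems(3) by simp
  ultimately have "\<phi> \<cdot> h' = Zero C u' y" using tri_epi[OF t _ comp_closed[OF h'(1) \<phi>]] by simp
  then have "h' = Zero C u' x" by (rule Suc.IH[OF u' h'(1)])
  then show ?case using h'(2) comp_zero_left[OF m(2)] by simp
qed

text \<open>
  Among all precovers of \<open>c\<close> take one whose source has least length.  It cannot kill a simple
  subobject, since otherwise it would factor through a shorter quotient that is again a precover.  An
  endomorphism \<open>\<phi>\<close> with \<open>\<tau> \<cdot> \<phi> = \<tau>\<close> then kills no simple subobject either, so it is a
  monomorphism, and finite-dimensionality of the endomorphism ring makes it invertible.
\<close>

lemma cover_of_precover:
  assumes fin: "hom_finite K C" and S: "proper_semibrick C S"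
    and pre: "is_precover C (ext_closure C S) x0 c \<tau>0"
  obtains x \<tau> where "is_cover C (ext_closure C S) x c \<tau>"
proof -
  define P where "P = (\<lambda>n. \<exists>x\<in>ext_power C S n. \<exists>\<tau>. is_precover C (ext_closure C S) x c \<tau>)"
  have "\<exists>n. P n" using pre unfolding P_def is_precover_def ext_closure_def by blast
  then obtain n where n: "P n" "\<And>m. m < n \<Longrightarrow> \<not> P m" using exists_least_iff[of P] by blast
  then obtain x \<tau> where x: "x \<in> ext_power C S n" and \<tau>: "is_precover C (ext_closure C S) x c \<tau>"
    unfolding P_def by blast
  have sb: "semibrick C S" using S by (simp add: proper_semibrick_def)
  note m = precover_mor[OF \<tau>]
  have simple: "f = Zero C s x" if s: "s \<in> S" and f: "f \<in> Mor C s x" and z: "\<tau> \<cdot> f = Zero C s c" for s f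
  proof (rule ccontr)
    assume nz: "f \<noteq> Zero C s x"
    obtain x' g h where t: "Tri C s x x' f g h" using tri_complete[OF f] by blast
    note mt = tri_mor[OF t]
    obtain k where k: "n = Suc k" "x' \<in> ext_power C S k"
      using cone_of_simple_in_ext_power[OF sb s x t nz] by blast
    obtain \<tau>' where \<tau>': "\<tau>' \<in> Mor C x' c" "\<tau> = \<tau>' \<cdot> g" by (rule tri_extend[OF t m(1) z])
    have "is_precover C (ext_closure C S) x' c \<tau>'"
      unfolding is_precover_def
    proof (intro conjI ballI)
      fix u q assume u: "u \<in> ext_closure C S" and q: "q \<in> Mor C u c"
      obtain v where v: "v \<in> Mor C u x" "q = \<tau> \<cdot> v" by (rule precover_factor[OF \<tau> u q])
      then have "q = \<tau>' \<cdot> (g \<cdot> v)" using \<tau>'(2) comp_assoc[OF v(1) mt(2) \<tau>'(1)] by simp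
      then show "\<exists>w\<in>Mor C u x'. q = \<tau>' \<cdot> w" using comp_closed[OF v(1) mt(2)] by blast
    qed (use k \<tau>' in \<open>auto simp: ext_closure_def\<close>)
    then have "P k" unfolding P_def using k(2) by blast
    then show False using n(2)[of k] k(1) by simp
  qed
  have "is_iso C x x \<phi>" if \<phi>: "\<phi> \<in> Mor C x x" and e: "\<tau> \<cdot> \<phi> = \<tau>" for \<phi>
  proof (rule left_cancellable_endo_is_iso[OF fin \<phi>])
    fix \<psi> assume \<psi>: "\<psi> \<in> Mor C x x" "\<phi> \<cdot> \<psi> = Zero C x x"
    show "\<psi> = Zero C x x"
    proof (rule faithful_on_ext_closure[OF \<phi> _ _ x \<psi>])
      show "hom_orth C S (Desusp C ` {x})"
        by (rule hom_orth_subset[OF proper_semibrick_orth[OF S] ext_closure_superset]) (simp add: m(2))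
      fix s f assume s: "s \<in> S" and f: "f \<in> Mor C s x" and z: "\<phi> \<cdot> f = Zero C s x"
      have "\<tau> \<cdot> f = Zero C s c" using comp_assoc[OF f \<phi> m(1)] e z comp_zero_right[OF m(1)] by simp
      then show "f = Zero C s x" by (rule simple[OF s f])
    qed
  qed
  then show ?thesis using that[of x \<tau>] \<tau> unfolding is_cover_precover by blast
qed

text \<open>
  The first term of a short triangle approximates the middle one as soon as nothing maps to the third.
\<close>

lemma precover_of_star:
  assumes XY: "hom_orth C X Y" and c: "c \<in> star C X Y"
  obtains x \<tau> y g h where "is_precover C X x c \<tau>" "y \<in> Y" "Tri C x c y \<tau> g h"
proof -
  obtain x y \<tau> g h where xy: "x \<in> X" "y \<in> Y" and t: "Tri C x c y \<tau> g h" using c by (rule starE)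
  note m = tri_mor[OF t]
  have "\<exists>v\<in>Mor C u x. q = \<tau> \<cdot> v" if u: "u \<in> X" and q: "q \<in> Mor C u c" for u q
  proof -
    have "g \<cdot> q = Zero C u y"
      using hom_zeroD[OF hom_orthD[OF XY u xy(2)] comp_closed[OF q m(2)]] .
    from tri_lift[OF t q this] show ?thesis by blast
  qed
  then have "is_precover C X x c \<tau>" using xy m by (simp add: is_precover_def)
  then show ?thesis using that xy t by blast
qed

lemma precover_comp:
  assumes \<tau>: "is_precover C X x c \<tau>" and \<sigma>: "is_precover C X' x' x \<sigma>" and X': "X' \<subseteq> X"
  shows "is_precover C X' x' c (\<tau> \<cdot> \<sigma>)"
  unfolding is_precover_def
proof (intro conjI ballI)
  note m = precover_mor[OF \<tau>] precover_mor[OF \<sigma>]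
  fix u q assume u: "u \<in> X'" and q: "q \<in> Mor C u c"
  obtain v where v: "v \<in> Mor C u x" "q = \<tau> \<cdot> v" using precover_factor[OF \<tau> _ q] u X' by blast
  obtain w where w: "w \<in> Mor C u x'" "v = \<sigma> \<cdot> w" by (rule precover_factor[OF \<sigma> u v(1)])
  show "\<exists>g\<in>Mor C u x'. q = (\<tau> \<cdot> \<sigma>) \<cdot> g"
    using v(2) w comp_assoc[OF w(1) m(3) m(1)] by (intro bexI[of _ w]) simp_all
qed (use precover_mor[OF \<tau>] precover_mor[OF \<sigma>] comp_closed in auto)

lemma tri_complete_third:
  assumes w: "w \<in> Mor C z (Susp C x)"
  obtains y f g where "Tri C x y z f g w"
proof -
  have d: "DesuspM C w \<in> Mor C (Desusp C z) x" by (rule desusp_mor_from[OF w])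
  obtain y f g where "Tri C (Desusp C z) x y (\<ominus>\<^bsub>Hom C (Desusp C z) x\<^esub> DesuspM C w) f g"
    using tri_complete[OF neg_mor[OF d]] by blast
  from tri_rotate_fwd[OF this] have "Tri C x y z f g w"
    using susp_mor[OF d] by (simp add: susp_neg[OF d] susp_desusp[OF w] neg_neg w)
  then show ?thesis by (rule that)
qed

text \<open>
  Wakamatsu's lemma.  A map \<open>u\<close> from \<open>x'\<close> to the cone defines an extension \<open>e\<close> of \<open>x'\<close> by \<open>x\<close> that
  maps to \<open>c\<close>.  As \<open>e\<close> lies in \<open>X\<close>, this map factors through the cover, and minimality makes the
  extension split.  Hence \<open>u\<close> comes from a map to \<open>c\<close>, which factors through the cover and dies in the
  cone.
\<close>

lemma cover_cone_orth:
  assumes \<tau>: "is_cover C X x c \<tau>" and t: "Tri C x c y \<tau> g h" and X: "star C X X \<subseteq> X"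
  shows "hom_orth C X {y}"
  unfolding hom_orth_def
proof (intro ballI hom_zeroI)
  fix x' y' u assume x': "x' \<in> X" and y': "y' \<in> {y}" and "u \<in> Mor C x' y'"
  then have u: "u \<in> Mor C x' y" by simp
  note m = tri_mor[OF t]
  have pre: "is_precover C X x c \<tau>" using \<tau> by (simp add: is_cover_precover)
  have hu: "h \<cdot> u \<in> Mor C x' (Susp C x)" by (rule comp_closed[OF u m(3)])
  obtain e i r where te: "Tri C x e x' i r (h \<cdot> u)" by (rule tri_complete_third[OF hu])
  note me = tri_mor[OF te]
  have "e \<in> X" using starI[OF te precover_mor(2)[OF pre] x'] X by blast
  have "h \<cdot> u = SuspM C (Id C x) \<cdot> (h \<cdot> u)" using id_left[OF hu] by (simp add: susp_id)
  then obtain \<beta> where \<beta>: "\<beta> \<in> Mor C e c" "\<tau> \<cdot> Id C x = \<beta> \<cdot> i"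
    using tri_fill_middle[OF te t id_closed u] by blast
  obtain \<gamma> where \<gamma>: "\<gamma> \<in> Mor C e x" "\<beta> = \<tau> \<cdot> \<gamma>" by (rule precover_factor[OF pre \<open>e \<in> X\<close> \<beta>(1)])
  have "\<tau> \<cdot> (\<gamma> \<cdot> i) = \<tau>"
    using \<beta>(2) \<gamma>(2) comp_assoc[OF me(1) \<gamma>(1) m(1)] id_right[OF m(1)] by simp
  then have "is_iso C x x (\<gamma> \<cdot> i)" using \<tau> comp_closed[OF me(1) \<gamma>(1)] by (simp add: is_cover_def)
  from susp_iso[OF this] obtain \<rho> where \<rho>: "\<rho> \<in> Mor C (Susp C x) (Susp C x)"
    "\<rho> \<cdot> SuspM C (\<gamma> \<cdot> i) = Id C (Susp C x)" by (rule is_isoE)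
  have "SuspM C (\<gamma> \<cdot> i) \<cdot> (h \<cdot> u) = Zero C x' (Susp C x)"
    using susp_comp[OF me(1) \<gamma>(1)] comp_assoc[OF me(3) susp_mor[OF me(1)] susp_mor[OF \<gamma>(1)]]
      tri_comp_zero(3)[OF te] comp_zero_right[OF susp_mor[OF \<gamma>(1)]] by simp
  then have "h \<cdot> u = Zero C x' (Susp C x)"
    using comp_assoc[OF hu susp_mor[OF comp_closed[OF me(1) \<gamma>(1)]] \<rho>(1)] \<rho>(2) id_left[OF hu]
      comp_zero_right[OF \<rho>(1)] by simp
  then obtain v where v: "v \<in> Mor C x' c" "u = g \<cdot> v" by (rule tri_lift2[OF t u])
  obtain q where q: "q \<in> Mor C x' x" "v = \<tau> \<cdot> q" by (rule precover_factor[OF pre x' v(1)])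
  have "u = Zero C x' y"
    using v q comp_assoc[OF q(1) m(1,2)] tri_comp_zero(1)[OF t] comp_zero_left[OF q(1)] by simp
  then show "u = Zero C x' y'" using y' by simp
qed

text \<open>
  A decomposition of an object with first part in the extension closure yields some precover with cone
  in \<open>Y\<close>.  The cover is a retract of that precover, so its cone is a retract of an object of \<open>Y\<close>.
  Allowing \<open>c\<close> to be a retract of the decomposed object \<open>e\<close> gives closure of the product under
  retracts at the same time.
\<close>

lemma cover_cone_in:
  assumes fin: "hom_finite K C" and S: "proper_semibrick C S"
    and Y: "retract_closed C Y" and XY: "hom_orth C (ext_closure C S) Y"
    and e: "e \<in> star C (ext_closure C S) Y"
    and r: "\<iota> \<in> Mor C c e" "\<pi> \<in> Mor C e c" "\<pi> \<cdot> \<iota> = Id C c"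
  obtains x \<tau> y g h where "is_cover C (ext_closure C S) x c \<tau>" "Tri C x c y \<tau> g h" "y \<in> Y"
proof -
  let ?X = "ext_closure C S"
  obtain x \<sigma> y g h where \<sigma>: "is_precover C ?X x e \<sigma>" and y: "y \<in> Y" and t: "Tri C x e y \<sigma> g h"
    by (rule precover_of_star[OF XY e])
  note m = tri_mor[OF t]
  have "is_precover C ?X x c (\<pi> \<cdot> \<sigma>)"
    unfolding is_precover_def
  proof (intro conjI ballI)
    fix u q assume u: "u \<in> ?X" and q: "q \<in> Mor C u c"
    obtain v where v: "v \<in> Mor C u x" "\<iota> \<cdot> q = \<sigma> \<cdot> v"
      by (rule precover_factor[OF \<sigma> u comp_closed[OF q r(1)]])
    have "q = (\<pi> \<cdot> \<sigma>) \<cdot> v"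
      using comp_assoc[OF q r(1,2)] r(3) id_left[OF q] v(2) comp_assoc[OF v(1) m(1) r(2)] by simp
    then show "\<exists>g\<in>Mor C u x. q = (\<pi> \<cdot> \<sigma>) \<cdot> g" using v(1) by blast
  qed (use precover_mor[OF \<sigma>] comp_closed[OF m(1) r(2)] in auto)
  then obtain x0 \<tau> where \<tau>: "is_cover C ?X x0 c \<tau>" by (rule cover_of_precover[OF fin S])
  then have pre: "is_precover C ?X x0 c \<tau>" by (simp add: is_cover_precover)
  note m0 = precover_mor[OF pre]
  obtain y0 g0 h0 where t0: "Tri C x0 c y0 \<tau> g0 h0" using tri_complete[OF m0(1)] by blast
  note mt0 = tri_mor[OF t0]
  \<comment> \<open>The inclusion and the projection of the retract lift to the two triangles; minimality makes the
    induced endomorphism of the cone \<open>y0\<close> injective, hence invertible.\<close>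
  obtain \<alpha> where \<alpha>: "\<alpha> \<in> Mor C x0 x" "\<iota> \<cdot> \<tau> = \<sigma> \<cdot> \<alpha>"
    by (rule precover_factor[OF \<sigma> m0(2) comp_closed[OF m0(1) r(1)]])
  obtain \<beta> where \<beta>: "\<beta> \<in> Mor C x x0" "\<pi> \<cdot> \<sigma> = \<tau> \<cdot> \<beta>"
    by (rule precover_factor[OF pre precover_mor(2)[OF \<sigma>] comp_closed[OF m(1) r(2)]])
  obtain \<theta>1 where \<theta>1: "\<theta>1 \<in> Mor C y0 y" "g \<cdot> \<iota> = \<theta>1 \<cdot> g0" "h \<cdot> \<theta>1 = SuspM C \<alpha> \<cdot> h0"
    using tri_morphism[OF t0 t \<alpha>(1) r(1) \<alpha>(2)[symmetric]] by blast
  obtain \<theta>2 where \<theta>2: "\<theta>2 \<in> Mor C y y0" "g0 \<cdot> \<pi> = \<theta>2 \<cdot> g" "h0 \<cdot> \<theta>2 = SuspM C \<beta> \<cdot> h"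
    using tri_morphism[OF t t0 \<beta>(1) r(2) \<beta>(2)[symmetric]] by blast
  let ?\<theta> = "\<theta>2 \<cdot> \<theta>1"
  have \<theta>: "?\<theta> \<in> Mor C y0 y0" by (rule comp_closed[OF \<theta>1(1) \<theta>2(1)])
  have \<beta>\<alpha>: "\<beta> \<cdot> \<alpha> \<in> Mor C x0 x0" by (rule comp_closed[OF \<alpha>(1) \<beta>(1)])
  have "\<tau> \<cdot> (\<beta> \<cdot> \<alpha>) = (\<pi> \<cdot> \<sigma>) \<cdot> \<alpha>" using comp_assoc[OF \<alpha>(1) \<beta>(1) m0(1)] \<beta>(2) by simp
  also have "\<dots> = \<pi> \<cdot> (\<iota> \<cdot> \<tau>)" using comp_assoc[OF \<alpha>(1) m(1) r(2)] \<alpha>(2) by simp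
  also have "\<dots> = \<tau>" using comp_assoc[OF m0(1) r(1,2)] r(3) id_left[OF m0(1)] by simp
  finally have "is_iso C x0 x0 (\<beta> \<cdot> \<alpha>)" using \<tau> \<beta>\<alpha> by (simp add: is_cover_def)
  from susp_iso[OF this] obtain \<rho> where \<rho>: "\<rho> \<in> Mor C (Susp C x0) (Susp C x0)"
    "\<rho> \<cdot> SuspM C (\<beta> \<cdot> \<alpha>) = Id C (Susp C x0)" by (rule is_isoE)
  have \<theta>g: "?\<theta> \<cdot> g0 = g0"
  proof -
    have "?\<theta> \<cdot> g0 = \<theta>2 \<cdot> (g \<cdot> \<iota>)" using comp_assoc[OF mt0(2) \<theta>1(1) \<theta>2(1)] \<theta>1(2) by simp
    also have "\<dots> = (g0 \<cdot> \<pi>) \<cdot> \<iota>" using comp_assoc[OF r(1) m(2) \<theta>2(1)] \<theta>2(2) by simp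
    also have "\<dots> = g0" using comp_assoc[OF r(1,2) mt0(2)] r(3) id_right[OF mt0(2)] by simp
    finally show ?thesis .
  qed
  have h\<theta>: "h0 \<cdot> ?\<theta> = SuspM C (\<beta> \<cdot> \<alpha>) \<cdot> h0"
  proof -
    have "h0 \<cdot> ?\<theta> = SuspM C \<beta> \<cdot> (h \<cdot> \<theta>1)"
      using comp_assoc[OF \<theta>1(1) \<theta>2(1) mt0(3)] \<theta>2(3) comp_assoc[OF \<theta>1(1) m(3) susp_mor[OF \<beta>(1)]] by simp
    then show ?thesis
      using \<theta>1(3) susp_comp[OF \<alpha>(1) \<beta>(1)] comp_assoc[OF mt0(3) susp_mor[OF \<alpha>(1)] susp_mor[OF \<beta>(1)]] by simp
  qed
  have "is_iso C y0 y0 ?\<theta>"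
  proof (rule left_cancellable_endo_is_iso[OF fin \<theta>])
    fix \<psi> assume \<psi>: "\<psi> \<in> Mor C y0 y0" "?\<theta> \<cdot> \<psi> = Zero C y0 y0"
    have h\<psi>: "h0 \<cdot> \<psi> \<in> Mor C y0 (Susp C x0)" by (rule comp_closed[OF \<psi>(1) mt0(3)])
    have "SuspM C (\<beta> \<cdot> \<alpha>) \<cdot> (h0 \<cdot> \<psi>) = Zero C y0 (Susp C x0)"
      using comp_assoc[OF \<psi>(1) mt0(3) susp_mor[OF \<beta>\<alpha>]] h\<theta> comp_assoc[OF \<psi>(1) \<theta> mt0(3)] \<psi>(2)
        comp_zero_right[OF mt0(3)] by simp
    then have "h0 \<cdot> \<psi> = Zero C y0 (Susp C x0)"
      using comp_assoc[OF h\<psi> susp_mor[OF \<beta>\<alpha>] \<rho>(1)] \<rho>(2) id_left[OF h\<psi>] comp_zero_right[OF \<rho>(1)] by simp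
    then obtain v where v: "v \<in> Mor C y0 c" "\<psi> = g0 \<cdot> v" by (rule tri_lift2[OF t0 \<psi>(1)])
    then show "\<psi> = Zero C y0 y0" using comp_assoc[OF v(1) mt0(2) \<theta>] \<theta>g \<psi>(2) by simp
  qed
  then obtain \<omega> where \<omega>: "\<omega> \<in> Mor C y0 y0" "\<omega> \<cdot> ?\<theta> = Id C y0" by (rule is_isoE)
  have "(\<omega> \<cdot> \<theta>2) \<cdot> \<theta>1 = Id C y0" using comp_assoc[OF \<theta>1(1) \<theta>2(1) \<omega>(1)] \<omega>(2) by simp
  then have "y0 \<in> Y"
    using Y y \<theta>1(1) comp_closed[OF \<theta>2(1) \<omega>(1)] unfolding retract_closed_def by blast
  then show ?thesis using that \<tau> t0 by blast
qed

end

section \<open>Simple minded systems\<close>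

text \<open>
  Serre duality on the level of vanishing Hom spaces; in this symmetric form it passes to the
  opposite category.
\<close>

definition serre_vanishing :: "('k, 'o, 'm, 'z) tri_cat_scheme \<Rightarrow> nat \<Rightarrow> bool"
  where "serre_vanishing C w \<longleftrightarrow>
    (\<forall>x y. hom_zero C x y \<longleftrightarrow> hom_zero C y ((Desusp C ^^ w) x))"

context triangulated_category
begin

lemma ring_End: "ring (End C x)"
proof -
  interpret A: abelian_group "Hom C x x" by (rule hom_abelian)
  show ?thesis
  proof (rule ringI)
    show "abelian_group (End C x)"
      by (rule abelian_groupI) (auto simp: End_def A.a_ac intro: A.a_inv_closed A.l_neg)
    show "Group.monoid (End C x)"
      by (rule Group.monoidI)
        (simp_all add: End_def id_closed comp_closed[of _ x x _ x] comp_assoc[of _ x x _ x _ x]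
          id_left[of _ x x] id_right[of _ x x])
  qed (simp_all add: End_def comp_add_left[of _ x x _ x] comp_add_right[of _ x x _ _ x])
qed

text \<open>
  The zero ring is excluded on both sides: in it zero is a unit.
\<close>

lemma skew_field_End_iff: "skew_field (End C x) \<longleftrightarrow>
    \<not> zero_object C x \<and> (\<forall>f\<in>Mor C x x. f \<noteq> Zero C x x \<longrightarrow> is_iso C x x f)"
proof -
  have U: "Units (End C x) = {f. is_iso C x x f}"
    by (auto simp: Units_def End_def is_iso_def)
  have z: "is_iso C x x (Zero C x x) \<longleftrightarrow> zero_object C x"
    using is_iso_zero_objects zero_object_iff_id comp_zero_left by (metis is_isoE)
  have "{f. is_iso C x x f} = Mor C x x - {Zero C x x} \<longleftrightarrow>
    \<not> zero_object C x \<and> (\<forall>f\<in>Mor C x x. f \<noteq> Zero C x x \<longrightarrow> is_iso C x x f)"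
    using z by (auto simp: is_iso_def)
  then show ?thesis using ring_End by (simp add: skew_field_def U) (simp add: End_def)
qed

lemma orthogonal_collection_iff: "orthogonal_collection C w S \<longleftrightarrow>
    finite S \<and> (\<forall>s\<in>S. \<not> zero_object C s) \<and>
    (\<forall>s\<in>S. \<forall>f\<in>Mor C s s. f \<noteq> Zero C s s \<longrightarrow> is_iso C s s f) \<and>
    (\<forall>s\<in>S. \<forall>t\<in>S. s \<noteq> t \<longrightarrow> hom_zero C s t) \<and>
    (\<forall>l\<in>{1..<w}. hom_orth C S ((Desusp C ^^ l) ` S))"
  unfolding orthogonal_collection_def skew_field_End_iff hom_zero_def[symmetric] hom_orth_def by blast

lemma orthogonal_semibrick: "orthogonal_collection C w S \<Longrightarrow> semibrick C S"
  unfolding orthogonal_collection_iff semibrick_def using hom_zeroD by metis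

lemma orthogonal_proper_semibrick:
  assumes S: "orthogonal_collection C w S" and w: "w \<ge> 2"
  shows "proper_semibrick C S"
proof -
  have "(1::nat) \<in> {1..<w}" using w by simp
  then have "hom_orth C S ((Desusp C ^^ 1) ` S)" using S unfolding orthogonal_collection_iff by metis
  then show ?thesis using orthogonal_semibrick[OF S] by (simp add: proper_semibrick_def)
qed

lemma orthogonal_ext_closure:
  assumes "orthogonal_collection C w S" and "1 \<le> l" "l < w"
  shows "hom_orth C (ext_closure C S) ((Desusp C ^^ l) ` ext_closure C S)"
  using assms hom_orth_ext_closures[of S "(Desusp C ^^ l) ` S"]
  by (simp add: orthogonal_collection_iff ext_closure_desusp_pow)

lemma hom_orth_susp_pow_left:
  "hom_orth C ((Susp C ^^ l) ` A) B \<longleftrightarrow> hom_orth C A ((Desusp C ^^ l) ` B)"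
proof (induction l arbitrary: B)
  case (Suc l)
  have "(Susp C ^^ Suc l) ` A = Susp C ` (Susp C ^^ l) ` A" by (simp add: image_comp)
  moreover have "(Desusp C ^^ l) ` Desusp C ` B = (Desusp C ^^ Suc l) ` B"
    by (simp add: image_comp funpow_Suc_right del: funpow.simps)
  ultimately show ?case using Suc[of "Desusp C ` B"] hom_orth_susp_left by metis
qed simp

lemma orthogonal_collection_op: "orthogonal_collection (op_cat C) w S \<longleftrightarrow> orthogonal_collection C w S"
proof -
  interpret op: triangulated_category K "op_cat C" by (rule op_triangulated)
  show ?thesis
    unfolding op.orthogonal_collection_iff orthogonal_collection_iff
    by (auto simp: hom_orth_op hom_orth_susp_pow_left)
qed

text \<open>
  The iterated product $A * \Sigma^{-1}A * \cdots$ is bracketed to the left by definition; splitting off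
  its first factor exhibits the rest as a desuspended product of the same kind.
\<close>

lemma desusp_star_Suc_left:
  "desusp_star C A (Suc n) = star C A (Desusp C ` desusp_star C A n)"
proof (induction n)
  case (Suc n)
  have "desusp_star C A (Suc (Suc n)) = star C (desusp_star C A (Suc n)) (Desusp C ` (Desusp C ^^ Suc n) ` A)"
    unfolding desusp_star.simps(2)[of _ _ "Suc n"] desusp_pow_Suc_image[of "Suc n" A] ..
  also have "\<dots> = star C A (star C (Desusp C ` desusp_star C A n) (Desusp C ` (Desusp C ^^ Suc n) ` A))"
    unfolding Suc star_assoc ..
  also have "\<dots> = star C A (Desusp C ` desusp_star C A (Suc n))" unfolding star_desusp by simp
  finally show ?case .
qed simp

text \<open>
  In the opposite category the product reads $\Sigma^n A * \cdots * \Sigma A * A$ in terms of the original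
  one, which is the original product up to $\Sigma^n$.
\<close>

lemma desusp_star_op:
  "(Desusp C ^^ n) ` desusp_star (op_cat C) A n = desusp_star C A n"
proof (induction n)
  case (Suc n)
  have inv: "(Desusp C ^^ m) ((Susp C ^^ m) x) = x" for m x
    by (induction m arbitrary: x) (simp_all add: funpow_swap1)
  have A: "(Desusp C ^^ Suc n) ` (Susp C ^^ Suc n) ` A = A"
    using inv[of "Suc n"] by (simp add: image_comp comp_def del: funpow.simps)
  have "desusp_star (op_cat C) A (Suc n) = star C ((Susp C ^^ Suc n) ` A) (desusp_star (op_cat C) A n)"
    by (simp add: star_op)
  then have "(Desusp C ^^ Suc n) ` desusp_star (op_cat C) A (Suc n)
      = star C A (Desusp C ` (Desusp C ^^ n) ` desusp_star (op_cat C) A n)"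
    by (simp only: star_desusp_pow[symmetric] A) (simp only: desusp_pow_Suc_image)
  then show ?case using Suc desusp_star_Suc_left by metis
qed simp

lemma simple_minded_system_op: "simple_minded_system (op_cat C) w S \<longleftrightarrow> simple_minded_system C w S"
proof -
  have inv: "(Desusp C ^^ m) ((Susp C ^^ m) x) = x" "(Susp C ^^ m) ((Desusp C ^^ m) x) = x" for m x
    by (induction m arbitrary: x) (simp_all add: funpow_swap1)
  have s: "surj (Susp C ^^ n)" "surj (Desusp C ^^ n)" for n
    using surjI[of "Susp C ^^ n" "Desusp C ^^ n"] surjI[of "Desusp C ^^ n" "Susp C ^^ n"] inv by auto
  have "(Desusp C ^^ n) ` X = UNIV \<longleftrightarrow> X = UNIV" for n X
  proof
    assume "(Desusp C ^^ n) ` X = UNIV"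
    then have "(Susp C ^^ n) ` (Desusp C ^^ n) ` X = UNIV" using s by simp
    then show "X = UNIV" using inv by (simp add: image_image)
  qed (use s in simp)
  then have "desusp_star (op_cat C) (ext_closure C S) n = UNIV \<longleftrightarrow> desusp_star C (ext_closure C S) n = UNIV" for n
    using desusp_star_op by metis
  then show ?thesis by (simp add: simple_minded_system_def orthogonal_collection_op ext_closure_op)
qed

lemma serre_vanishing_op: "serre_vanishing (op_cat C) w \<longleftrightarrow> serre_vanishing C w"
proof -
  have "hom_zero C ((Susp C ^^ w) x) y \<longleftrightarrow> hom_zero C x ((Desusp C ^^ w) y)" for x y
    using hom_orth_susp_pow_left[of w "{x}" "{y}"] by (simp add: hom_orth_def)
  then show ?thesis unfolding serre_vanishing_def by auto
qed

lemma hom_orth_desusp_star: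
  assumes S: "orthogonal_collection C w S" and n: "Suc n < w"
  shows "hom_orth C (ext_closure C S) (Desusp C ` desusp_star C (ext_closure C S) n)"
  using n
proof (induction n)
  case 0
  then show ?case using orthogonal_ext_closure[OF S, of 1] by simp
next
  case (Suc n)
  have "hom_orth C (ext_closure C S) (Desusp C ` (Desusp C ^^ Suc n) ` ext_closure C S)"
    using orthogonal_ext_closure[OF S, of "Suc (Suc n)"] Suc.prems unfolding desusp_pow_Suc_image by simp
  then show ?case using Suc by (simp add: hom_orth_star_right flip: star_desusp)
qed

lemma retract_closed_desusp:
  assumes Y: "retract_closed C Y" shows "retract_closed C (Desusp C ` Y)"
  unfolding retract_closed_def
proof (intro ballI allI impI)
  fix y c \<iota> \<pi> assume "y \<in> Desusp C ` Y" and i: "\<iota> \<in> Mor C c y" and p: "\<pi> \<in> Mor C y c" and e: "\<pi> \<cdot> \<iota> = Id C c"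
  then have "Susp C y \<in> Y" by auto
  moreover have "SuspM C \<pi> \<cdot> SuspM C \<iota> = Id C (Susp C c)" using susp_comp[OF i p] e susp_id by simp
  ultimately have "Susp C c \<in> Y"
    using Y susp_mor[OF i] susp_mor[OF p] unfolding retract_closed_def by blast
  then show "c \<in> Desusp C ` Y" by (metis desusp_susp_obj imageI)
qed

lemma retract_closed_zeros: "retract_closed C {x. zero_object C x}"
  unfolding retract_closed_def
proof (intro ballI allI impI)
  fix y c \<iota> \<pi> assume y: "y \<in> {x. zero_object C x}" and i: "\<iota> \<in> Mor C c y" and p: "\<pi> \<in> Mor C y c"
    and e: "\<pi> \<cdot> \<iota> = Id C c"
  have "\<iota> = Zero C c y" using y i zero_object_hom_zero(2) hom_zeroD by blast
  then show "c \<in> {x. zero_object C x}" using e comp_zero_right[OF p] by (simp add: zero_object_iff_id)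
qed

lemma retract_closed_star:
  assumes fin: "hom_finite K C" and S: "proper_semibrick C S"
    and Y: "retract_closed C Y" and XY: "hom_orth C (ext_closure C S) Y"
  shows "retract_closed C (star C (ext_closure C S) Y)"
  unfolding retract_closed_def
proof (intro ballI allI impI)
  fix e c \<iota> \<pi> assume "e \<in> star C (ext_closure C S) Y" "\<iota> \<in> Mor C c e" "\<pi> \<in> Mor C e c" "\<pi> \<cdot> \<iota> = Id C c"
  then obtain x \<tau> y g h where "is_cover C (ext_closure C S) x c \<tau>" "Tri C x c y \<tau> g h" "y \<in> Y"
    by (rule cover_cone_in[OF fin S Y XY])
  then show "c \<in> star C (ext_closure C S) Y" using starI by (metis is_cover_def)
qed

lemma retract_closed_desusp_star:
  assumes fin: "hom_finite K C" and S: "orthogonal_collection C w S" and n: "n < w" and w: "2 \<le> w"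
  shows "retract_closed C (desusp_star C (ext_closure C S) n)"
  using n
proof (induction n)
  case 0
  note ps = orthogonal_proper_semibrick[OF S w]
  have "hom_orth C (ext_closure C S) {x. zero_object C x}"
    using zero_object_hom_zero(2) by (auto simp: hom_orth_def)
  from retract_closed_star[OF fin ps retract_closed_zeros this]
  show ?case by (simp add: star_zero_right[OF ext_closure_iso_closed])
next
  case (Suc n)
  show ?case
    unfolding desusp_star_Suc_left
    by (rule retract_closed_star[OF fin orthogonal_proper_semibrick[OF S w] retract_closed_desusp])
      (use Suc hom_orth_desusp_star[OF S] in auto)
qed

lemma simple_minded_star:
  assumes S: "simple_minded_system C w S" and w: "2 \<le> w"
  shows "star C (ext_closure C S) (Desusp C ` desusp_star C (ext_closure C S) (w - 2)) = UNIV"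
proof -
  have "w - 1 = Suc (w - 2)" using w by simp
  then show ?thesis using S desusp_star_Suc_left unfolding simple_minded_system_def by metis
qed

text \<open>
  Generation supplies a precover by the whole heart, because no other shift of the heart that occurs
  receives maps from it.  Its torsion part with respect to \<open>S'\<close> is a precover by the smaller class.
\<close>

lemma subset_cover_exists:
  assumes fin: "hom_finite K C" and S: "simple_minded_system C w S" and w: "2 \<le> w" and S': "S' \<subseteq> S"
  obtains t \<tau> where "is_cover C (ext_closure C S') t c \<tau>"
proof -
  have orth: "orthogonal_collection C w S" using S by (simp add: simple_minded_system_def)
  have ps: "proper_semibrick C S" by (rule orthogonal_proper_semibrick[OF orth w])
  have c: "c \<in> star C (ext_closure C S) (Desusp C ` desusp_star C (ext_closure C S) (w - 2))"
    using simple_minded_star[OF S w] by simp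
  have o1: "hom_orth C (ext_closure C S) (Desusp C ` desusp_star C (ext_closure C S) (w - 2))"
    by (rule hom_orth_desusp_star[OF orth]) (use w in simp)
  obtain a \<tau> where a: "is_precover C (ext_closure C S) a c \<tau>"
    using precover_of_star[OF o1 c] by blast
  have "a \<in> star C (ext_closure C S') (right_perp C (ext_closure C S') \<inter> ext_closure C S)"
    by (rule ext_closure_torsion[OF orthogonal_semibrick[OF orth] S' precover_mor(2)[OF a]])
  moreover have "hom_orth C (ext_closure C S') (right_perp C (ext_closure C S') \<inter> ext_closure C S)"
    unfolding right_perp_eq by (auto simp: hom_orth_def)
  ultimately obtain t \<sigma> where t: "is_precover C (ext_closure C S') t a \<sigma>"
    using precover_of_star by metis
  show ?thesis
    using cover_of_precover[OF fin proper_semibrick_subset[OF ps S']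
        precover_comp[OF a t ext_closure_mono[OF S']]] that by blast
qed

text \<open>
  By Wakamatsu's lemma the covers make the extension closure of \<open>S'\<close> the torsion class of a torsion
  pair in the whole triangulated category.
\<close>

lemma star_right_perp_UNIV:
  assumes fin: "hom_finite K C" and S: "simple_minded_system C w S" and w: "2 \<le> w" and S': "S' \<subseteq> S"
  shows "star C (ext_closure C S') (right_perp C (ext_closure C S')) = UNIV"
proof -
  have "c \<in> star C (ext_closure C S') (right_perp C (ext_closure C S'))" for c
  proof -
    obtain t \<tau> where t: "is_cover C (ext_closure C S') t c \<tau>" by (rule subset_cover_exists[OF assms])
    then have m: "t \<in> ext_closure C S'" "\<tau> \<in> Mor C t c" by (auto simp: is_cover_def)
    obtain y g h where T: "Tri C t c y \<tau> g h" using tri_complete[OF m(2)] by blast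
    have "y \<in> right_perp C (ext_closure C S')"
      unfolding right_perp_eq using cover_cone_orth[OF t T ext_closure_star] by simp
    then show ?thesis by (rule starI[OF T m(1)])
  qed
  then show ?thesis by blast
qed

lemma star_left_perp_UNIV:
  assumes fin: "hom_finite K C" and S: "simple_minded_system C w S" and w: "2 \<le> w" and S': "S' \<subseteq> S"
  shows "star C (left_perp C (ext_closure C S')) (ext_closure C S') = UNIV"
proof -
  interpret op: triangulated_category K "op_cat C" by (rule op_triangulated)
  show ?thesis
    using op.star_right_perp_UNIV[OF hom_finite_op[OF fin] _ w S'] S
    by (simp add: simple_minded_system_op ext_closure_op right_perp_op star_op)
qed

end

section \<open>Left tilting\<close>

context triangulated_category
begin

lemma inj_desusp: "inj (Desusp C)"
  by (rule inj_on_inverseI[where g = "Susp C"]) simp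

lemma cover_desusp:
  assumes \<tau>: "is_cover C X x c \<tau>"
  shows "is_cover C (Desusp C ` X) (Desusp C x) (Desusp C c) (DesuspM C \<tau>)"
  unfolding is_cover_def
proof (intro conjI ballI impI)
  have m: "x \<in> X" "\<tau> \<in> Mor C x c" using \<tau> by (auto simp: is_cover_def)
  show "Desusp C x \<in> Desusp C ` X" "DesuspM C \<tau> \<in> Mor C (Desusp C x) (Desusp C c)"
    using m desusp_closed by auto
  show "\<exists>g\<in>Mor C x' (Desusp C x). f = DesuspM C \<tau> \<cdot> g"
    if x': "x' \<in> Desusp C ` X" and f: "f \<in> Mor C x' (Desusp C c)" for x' f
  proof -
    obtain x1 where x1: "x1 \<in> X" "x' = Desusp C x1" using x' by blast
    have "SuspM C f \<in> Mor C x1 c" using susp_mor[OF f] x1(2) by simp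
    then obtain g where g: "g \<in> Mor C x1 x" "SuspM C f = \<tau> \<cdot> g" using \<tau> x1(1) unfolding is_cover_def by blast
    have "f = DesuspM C \<tau> \<cdot> DesuspM C g" using desusp_comp[OF g(1) m(2)] g(2) desusp_susp[OF f] by simp
    then show ?thesis using desusp_closed[OF g(1)] x1(2) by blast
  qed
  show "is_iso C (Desusp C x) (Desusp C x) \<phi>"
    if \<phi>: "\<phi> \<in> Mor C (Desusp C x) (Desusp C x)" and e: "DesuspM C \<tau> \<cdot> \<phi> = DesuspM C \<tau>" for \<phi>
  proof -
    have S\<phi>: "SuspM C \<phi> \<in> Mor C x x" using susp_mor[OF \<phi>] by simp
    have "\<tau> \<cdot> SuspM C \<phi> = \<tau>"
      using susp_comp[OF \<phi> desusp_closed[OF m(2)]] e susp_desusp[OF m(2)] by simp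
    then have "is_iso C x x (SuspM C \<phi>)" using \<tau> S\<phi> by (simp add: is_cover_def)
    from desusp_iso[OF this] show ?thesis using desusp_susp[OF \<phi>] by simp
  qed
qed

lemma left_tilt_exists:
  assumes fin: "hom_finite K C" and S: "simple_minded_system C w S" and w: "2 \<le> w" and S': "S' \<subseteq> S"
  shows "\<exists>L. left_tilt C S' S L"
proof -
  define P where "P = (\<lambda>s z. \<exists>t \<tau> g h. is_cover C (Desusp C ` ext_closure C S') (Desusp C t) s \<tau> \<and>
       Tri C (Desusp C t) s z \<tau> g h)"
  have ex: "\<exists>z. P s z" for s
  proof -
    obtain t \<tau> where "is_cover C (ext_closure C S') t (Susp C s) \<tau>" by (rule subset_cover_exists[OF assms])
    from cover_desusp[OF this]
    have c: "is_cover C (Desusp C ` ext_closure C S') (Desusp C t) s (DesuspM C \<tau>)" by simp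
    then have "DesuspM C \<tau> \<in> Mor C (Desusp C t) s" by (simp add: is_cover_def)
    from tri_complete[OF this] show ?thesis unfolding P_def using c by blast
  qed
  define l where "l = (\<lambda>s. if s \<in> S' then Desusp C s else SOME z. P s z)"
  have "P s (l s)" if "s \<in> S - S'" for s using ex[of s] that someI_ex[of "P s"] by (simp add: l_def)
  then have "left_tilt C S' S (l ` S)" unfolding left_tilt_def P_def
    by (intro exI[of _ l] conjI refl ballI) (simp_all add: l_def)
  then show ?thesis by blast
qed

text \<open>
  Replacing each \<open>A\<close> on the left by $T * F$ gives
  $F * \Sigma^{-1}T * \Sigma^{-1}F * \Sigma^{-2}T * \cdots$, and every $\Sigma^{-i}F$ is paired with the
  $\Sigma^{-i-1}T$ that follows it.
\<close>

lemma desusp_star_regroup: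
  assumes A: "A \<subseteq> star C T F" and B: "star C F (Desusp C ` T) \<subseteq> B"
  shows "star C (star C F (Desusp C ` desusp_star C A j)) ((Desusp C ^^ Suc (Suc j)) ` T)
    \<subseteq> desusp_star C B (Suc j)"
proof (induction j)
  case 0
  have "star C (star C F (Desusp C ` A)) (Desusp C ` Desusp C ` T)
      \<subseteq> star C (star C F (Desusp C ` star C T F)) (Desusp C ` Desusp C ` T)"
    by (intro star_mono image_mono A subset_refl)
  also have "\<dots> = star C (star C F (Desusp C ` T)) (Desusp C ` star C F (Desusp C ` T))"
    by (simp add: star_assoc flip: star_desusp)
  also have "\<dots> \<subseteq> star C B (Desusp C ` B)" by (intro star_mono image_mono B)
  finally show ?case by (simp add: image_image)
next
  case (Suc j)
  let ?D = "\<lambda>X. (Desusp C ^^ Suc (Suc j)) ` X"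
  have 1: "Desusp C ` desusp_star C A (Suc j) = star C (Desusp C ` desusp_star C A j) (?D A)"
    unfolding desusp_star.simps(2) star_desusp[symmetric] desusp_pow_Suc_image ..
  have 2: "(Desusp C ^^ Suc (Suc (Suc j))) ` T = ?D (Desusp C ` T)"
    by (simp add: image_image funpow_swap1)
  have "star C (star C F (star C (Desusp C ` desusp_star C A j) (?D A))) (?D (Desusp C ` T))
      \<subseteq> star C (star C F (star C (Desusp C ` desusp_star C A j) (?D (star C T F)))) (?D (Desusp C ` T))"
    by (intro star_mono image_mono A subset_refl)
  also have "\<dots> = star C (star C (star C F (Desusp C ` desusp_star C A j)) (?D T)) (?D (star C F (Desusp C ` T)))"
    unfolding star_desusp_pow[symmetric] star_assoc ..
  also have "\<dots> \<subseteq> star C (desusp_star C B (Suc j)) (?D B)"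
    by (intro star_mono image_mono B Suc)
  finally show ?case unfolding 1 2 desusp_star.simps(2)[of _ _ "Suc j"] .
qed

end

text \<open>
  In the definition of a left tilt the map \<open>l\<close> is quantified existentially; fixing it allows the
  tilted objects to be compared with the simple ones one by one.
\<close>

locale left_tilting = triangulated_category K C
  for K :: "'k ring" and C :: "('k, 'o, 'm, 'z) tri_cat_scheme" (structure) +
  fixes w :: nat and S S' :: "'o set" and l :: "'o \<Rightarrow> 'o"
  assumes fin: "hom_finite K C" and w: "2 \<le> w" and sms: "simple_minded_system C w S"
    and serre: "serre_vanishing C w" and S': "S' \<subseteq> S"
    and tilt_inside: "s \<in> S' \<Longrightarrow> l s = Desusp C s"
    and tilt_outside: "s \<in> S - S' \<Longrightarrow> \<exists>t \<tau> g h.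
       is_cover C (Desusp C ` ext_closure C S') (Desusp C t) s \<tau> \<and> Tri C (Desusp C t) s (l s) \<tau> g h"
begin

abbreviation "A \<equiv> ext_closure C S"
abbreviation "T \<equiv> ext_closure C S'"
abbreviation "F \<equiv> right_perp C T \<inter> A"
abbreviation "L \<equiv> l ` S"

lemma orth: "orthogonal_collection C w S"
  using sms by (simp add: simple_minded_system_def)

lemma S_distinct: "s \<in> S \<Longrightarrow> t \<in> S \<Longrightarrow> s \<noteq> t \<Longrightarrow> hom_zero C s t"
  using orth by (simp add: orthogonal_collection_iff)

lemma proper_S: "proper_semibrick C S"
  by (rule orthogonal_proper_semibrick[OF orth w])

lemma semibrick_S: "semibrick C S"
  by (rule orthogonal_semibrick[OF orth])

lemma proper_S': "proper_semibrick C S'"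
  by (rule proper_semibrick_subset[OF proper_S S'])

lemma T_subset: "T \<subseteq> A"
  by (rule ext_closure_mono[OF S'])

lemma A_orth: "a \<in> A \<Longrightarrow> b \<in> A \<Longrightarrow> hom_zero C a (Desusp C b)"
  using proper_semibrick_orth[OF proper_S] by (simp add: hom_orth_def)

lemma A_orth': "a \<in> A \<Longrightarrow> b \<in> A \<Longrightarrow> hom_zero C (Susp C a) b"
  using A_orth hom_zero_desusp[of "Susp C a" b] by simp

lemma T_F: "t \<in> T \<Longrightarrow> f \<in> F \<Longrightarrow> hom_zero C t f"
  by (auto simp: right_perp_eq hom_orth_def)

lemma FI: "a \<in> A \<Longrightarrow> (\<And>t. t \<in> T \<Longrightarrow> hom_zero C t a) \<Longrightarrow> a \<in> F"
  by (auto simp: right_perp_eq hom_orth_def)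

lemma FI': "a \<in> A \<Longrightarrow> (\<And>s. s \<in> S' \<Longrightarrow> hom_zero C s a) \<Longrightarrow> a \<in> F"
  by (simp add: in_right_perp_ext_closure hom_orth_def)

lemma A_torsion: "A \<subseteq> star C T F"
  using ext_closure_torsion[OF semibrick_S S'] by blast

lemma zero_in_F: "zero_object C z \<Longrightarrow> z \<in> F"
  by (rule FI[OF zero_in_ext_closure zero_object_hom_zero(2)])

lemma F_iso_closed: "iso_closed C F"
  unfolding iso_closed_def
proof (intro ballI allI impI)
  fix x y assume x: "x \<in> F" and i: "isomorphic C x y"
  obtain f where f: "is_iso C x y f" using i by (auto simp: isomorphic_def)
  have "y \<in> A" using x i ext_closure_iso_closed unfolding iso_closed_def by blast
  then show "y \<in> F" by (rule FI) (rule iso_hom_zero[OF is_iso_id f T_F[OF _ x]])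
qed

lemma F_star: "star C F F \<subseteq> F"
proof
  fix e assume e: "e \<in> star C F F"
  have "star C F F \<subseteq> star C A A" by (rule star_mono) simp_all
  then have "e \<in> A" using e ext_closure_star[of S] by blast
  moreover have "hom_orth C T (star C F F)"
    by (intro hom_orth_star_right) (simp_all add: hom_orth_def T_F)
  ultimately show "e \<in> F" by (rule FI[OF _ hom_orthD[OF _ _ e]])
qed

lemma subobject_in_F:
  assumes t: "Tri C k f m \<kappa> p r" and k: "k \<in> A" and f: "f \<in> F" and m: "m \<in> A"
  shows "k \<in> F"
proof (rule FI[OF k], rule hom_zeroI)
  fix t' v assume t': "t' \<in> T" and v: "v \<in> Mor C t' k"
  have "\<kappa> \<cdot> v = Zero C t' f"
    by (rule hom_zeroD[OF T_F[OF t' f] comp_closed[OF v tri_mor(1)[OF t]]])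
  moreover have "hom_zero C t' (Desusp C m)" using A_orth t' T_subset m by blast
  ultimately show "v = Zero C t' k" using tri_mono[OF t _ v] by simp
qed

text \<open>
  A torsion-free quotient of \<open>q\<close> would be a torsion-free quotient of the torsion object \<open>t'\<close>.
\<close>

lemma quotient_in_T:
  assumes t: "Tri C m t' q i \<pi> d" and m: "m \<in> A" and t': "t' \<in> T" and q: "q \<in> A"
  shows "q \<in> T"
proof -
  obtain t1 f1 a b c where t1: "t1 \<in> T" and f1: "f1 \<in> F" and T1: "Tri C t1 q f1 a b c"
    using q A_torsion by (auto elim!: starE)
  note m1 = tri_mor[OF T1]
  have "b \<cdot> \<pi> = Zero C t' f1"
    by (rule hom_zeroD[OF T_F[OF t' f1] comp_closed[OF tri_mor(2)[OF t] m1(2)]])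
  moreover have "hom_zero C (Susp C m) f1" using A_orth' m f1 by blast
  ultimately have "b = Zero C q f1" using tri_epi[OF t _ m1(2)] by simp
  then have "Id C f1 \<cdot> b = Zero C q f1" using comp_zero_right[OF id_closed] by simp
  moreover have "hom_zero C (Susp C t1) f1" using A_orth' t1 T_subset f1 by blast
  ultimately have "Id C f1 = Zero C f1 f1" using tri_epi[OF T1 _ id_closed] by simp
  then have "is_iso C t1 q a" using tri_iso_of_zero[OF T1] zero_object_iff_id by blast
  then show ?thesis using t1 ext_closure_iso_closed isomorphicI unfolding iso_closed_def by blast
qed

subsection \<open>The tilted objects\<close>

lemma tilt_triangle:
  assumes "s \<in> S - S'"
  obtains x \<tau> g h where "is_cover C (Desusp C ` T) x s \<tau>" "Tri C x s (l s) \<tau> g h" "Susp C x \<in> T"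
proof -
  obtain t \<tau> g h where t: "is_cover C (Desusp C ` T) (Desusp C t) s \<tau>" "Tri C (Desusp C t) s (l s) \<tau> g h"
    using tilt_outside[OF assms] by blast
  moreover have "Susp C (Desusp C t) \<in> T"
    using t(1) inj_image_mem_iff[OF inj_desusp] by (simp add: is_cover_def)
  ultimately show ?thesis by (rule that)
qed

text \<open>
  The tilted object is an extension of a torsion object \<open>Susp C x\<close> by \<open>s\<close>.  Suppose that a map
  \<open>s' \<rightarrow> l s\<close> with \<open>s'\<close> in \<open>S'\<close> does not vanish in \<open>Susp C x\<close>.  Then it splits off a simple subobject of
  \<open>Susp C x\<close> that the cover kills, which contradicts minimality.  Hence the map comes from \<open>s\<close>, where it
  vanishes by orthogonality.
\<close>

lemma tilt_in_F:
  assumes s: "s \<in> S - S'" shows "l s \<in> F"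
proof -
  obtain x \<tau> g h where cov: "is_cover C (Desusp C ` T) x s \<tau>" and t: "Tri C x s (l s) \<tau> g h"
    and x: "Susp C x \<in> T" by (rule tilt_triangle[OF s])
  note m = tri_mor[OF t]
  have pre: "is_precover C (Desusp C ` T) x s \<tau>" using cov by (simp add: is_cover_precover)
  have "s \<in> A" using s ext_closure_superset by blast
  then have lA: "l s \<in> A" using ext_closure_extension[OF tri_rotate_fwd[OF t]] x T_subset by blast
  have D: "Desusp C ` T = ext_closure C (Desusp C ` S')" by (simp add: ext_closure_desusp)
  have sb: "semibrick C (Desusp C ` S')"
    using proper_semibrick_desusp[OF proper_S'] by (simp add: proper_semibrick_def)
  show ?thesis
  proof (rule FI'[OF lA], rule hom_zeroI)
    fix s' u assume s': "s' \<in> S'" and u: "u \<in> Mor C s' (l s)"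
    have hu: "h \<cdot> u \<in> Mor C s' (Susp C x)" by (rule comp_closed[OF u m(3)])
    define v where "v = DesuspM C (h \<cdot> u)"
    have v: "v \<in> Mor C (Desusp C s') x" unfolding v_def by (rule desusp_mor_from[OF hu])
    have "SuspM C \<tau> \<cdot> (h \<cdot> u) = Zero C s' (Susp C s)"
      using comp_assoc[OF u m(3) susp_mor[OF m(1)]] tri_comp_zero(3)[OF t] comp_zero_left[OF u] by simp
    then have \<tau>v: "\<tau> \<cdot> v = Zero C (Desusp C s') s"
      unfolding v_def using desusp_comp[OF hu susp_mor[OF m(1)]] desusp_susp[OF m(1)]
        desusp_zero[of s' "Susp C s"] by simp
    have "v = Zero C (Desusp C s') x"
    proof (rule ccontr)
      assume nz: "v \<noteq> Zero C (Desusp C s') x"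
      obtain x' e r where T': "Tri C (Desusp C s') x x' v e r" using tri_complete[OF v] by blast
      have x': "x' \<in> Desusp C ` T"
        unfolding D using precover_mor(2)[OF pre] cone_of_simple[OF sb imageI[OF s'] _ T' nz]
        by (simp only: D)
      obtain \<tau>' where \<tau>': "\<tau>' \<in> Mor C x' s" "\<tau> = \<tau>' \<cdot> e" by (rule tri_extend[OF T' m(1) \<tau>v])
      obtain \<gamma> where \<gamma>: "\<gamma> \<in> Mor C x' x" "\<tau>' = \<tau> \<cdot> \<gamma>" by (rule precover_factor[OF pre x' \<tau>'(1)])
      note e = tri_mor(2)[OF T']
      have "\<tau> \<cdot> (\<gamma> \<cdot> e) = \<tau>"
        by (simp add: comp_assoc[OF e \<gamma>(1) m(1), symmetric] flip: \<gamma>(2) \<tau>'(2))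
      then have "is_iso C x x (\<gamma> \<cdot> e)" using cov comp_closed[OF e \<gamma>(1)] by (simp add: is_cover_def)
      then obtain \<rho> where \<rho>: "\<rho> \<in> Mor C x x" "\<rho> \<cdot> (\<gamma> \<cdot> e) = Id C x" by (rule is_isoE)
      have "(\<gamma> \<cdot> e) \<cdot> v = Zero C (Desusp C s') x"
        using comp_assoc[OF v e \<gamma>(1)] tri_comp_zero(1)[OF T'] comp_zero_right[OF \<gamma>(1)] by simp
      then have "v = Zero C (Desusp C s') x"
        using comp_assoc[OF v comp_closed[OF e \<gamma>(1)] \<rho>(1)] \<rho>(2) id_left[OF v] comp_zero_right[OF \<rho>(1)]
        by simp
      then show False using nz by simp
    qed
    then have "h \<cdot> u = Zero C s' (Susp C x)"
      using susp_desusp[OF hu] susp_zero[of "Desusp C s'" x] by (simp add: v_def)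
    then obtain u' where u': "u' \<in> Mor C s' s" "u = g \<cdot> u'" by (rule tri_lift2[OF t u])
    have "u' = Zero C s' s" by (rule hom_zeroD[OF S_distinct u'(1)]) (use s s' S' in auto)
    then show "u = Zero C s' (l s)" using u'(2) comp_zero_right[OF m(2)] by simp
  qed
qed

lemma DT_star: "star C (Desusp C ` T) (Desusp C ` T) \<subseteq> Desusp C ` T"
  using ext_closure_star[of "Desusp C ` S'"] by (simp add: ext_closure_desusp)

lemma DT_tilt:
  assumes s: "s \<in> S - S'" and t: "t \<in> T" shows "hom_zero C (Desusp C t) (l s)"
proof -
  obtain x \<tau> g h where "is_cover C (Desusp C ` T) x s \<tau>" "Tri C x s (l s) \<tau> g h"
    by (rule tilt_triangle[OF s])
  from cover_cone_orth[OF this DT_star] show ?thesis using t by (simp add: hom_orth_def)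
qed

lemma outside_T:
  assumes s: "s \<in> S - S'" and t: "t \<in> T" shows "hom_zero C s t"
proof -
  have "hom_orth C {s} S'" unfolding hom_orth_def using S_distinct[of s] s S' by auto
  from hom_orth_ext_closure_right[OF this] show ?thesis using t by (simp add: hom_orth_def)
qed

text \<open>
  Restriction along \<open>s \<rightarrow> l s\<close> and composition with \<open>u \<rightarrow> l u\<close> identify \<open>Mor C (l s) (l u)\<close> with
  \<open>Mor C s u\<close>.  The next two lemmas give the injectivity of the first map and the lifting along the
  second; together they transport the orthogonality of \<open>S\<close> to the tilted objects.
\<close>

lemma tilt_hom_restrict:
  assumes t: "Tri C x s (l s) \<tau> g h" and x: "Susp C x \<in> T" and u: "u \<in> S - S'"
    and \<phi>: "\<phi> \<in> Mor C (l s) (l u)" "\<phi> \<cdot> g = Zero C s (l u)"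
  shows "\<phi> = Zero C (l s) (l u)"
  by (rule tri_epi[OF t T_F[OF x tilt_in_F[OF u]] \<phi>])

lemma tilt_hom_lift:
  assumes s: "s \<in> S - S'" and t: "Tri C x s (l s) \<tau> g h"
    and t': "Tri C x' u (l u) \<tau>' g' h'" and x': "Susp C x' \<in> T" and \<phi>: "\<phi> \<in> Mor C (l s) (l u)"
  obtains \<psi> where "\<psi> \<in> Mor C s u" "\<phi> \<cdot> g = g' \<cdot> \<psi>"
proof -
  have g: "\<phi> \<cdot> g \<in> Mor C s (l u)" by (rule comp_closed[OF tri_mor(2)[OF t] \<phi>])
  have "h' \<cdot> (\<phi> \<cdot> g) = Zero C s (Susp C x')"
    by (rule hom_zeroD[OF outside_T[OF s x'] comp_closed[OF g tri_mor(3)[OF t']]])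
  from tri_lift2[OF t' g this] show ?thesis using that by blast
qed

lemma tilt_distinct:
  assumes s: "s \<in> S - S'" and u: "u \<in> S - S'" and su: "s \<noteq> u"
  shows "hom_zero C (l s) (l u)"
proof (rule hom_zeroI)
  fix \<phi> assume \<phi>: "\<phi> \<in> Mor C (l s) (l u)"
  obtain x \<tau> g h where t: "Tri C x s (l s) \<tau> g h" and x: "Susp C x \<in> T" by (rule tilt_triangle[OF s])
  obtain x' \<tau>' g' h' where t': "Tri C x' u (l u) \<tau>' g' h'" and x': "Susp C x' \<in> T"
    by (rule tilt_triangle[OF u])
  obtain \<psi> where \<psi>: "\<psi> \<in> Mor C s u" "\<phi> \<cdot> g = g' \<cdot> \<psi>" by (rule tilt_hom_lift[OF s t t' x' \<phi>])
  have "hom_zero C s u" using S_distinct s u su by simp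
  then have "\<phi> \<cdot> g = Zero C s (l u)"
    using \<psi> hom_zeroD comp_zero_right[OF tri_mor(2)[OF t']] by metis
  then show "\<phi> = Zero C (l s) (l u)" by (rule tilt_hom_restrict[OF t x u \<phi>])
qed

lemma tilt_endo:
  assumes s: "s \<in> S - S'"
  shows "\<not> zero_object C (l s)"
    and "\<phi> \<in> Mor C (l s) (l s) \<Longrightarrow> \<phi> \<noteq> Zero C (l s) (l s) \<Longrightarrow> is_iso C (l s) (l s) \<phi>"
proof -
  obtain x \<tau> g h where t: "Tri C x s (l s) \<tau> g h" and x: "Susp C x \<in> T" by (rule tilt_triangle[OF s])
  note m = tri_mor[OF t]
  have xT: "Desusp C (Susp C x) = x" by simp
  have sA: "s \<in> A" using s ext_closure_superset by blast
  show "\<not> zero_object C (l s)"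
  proof
    assume "zero_object C (l s)"
    then have "g \<cdot> Id C s = Zero C s (l s)" using m zero_object_hom_zero(2) hom_zeroD id_right by metis
    then obtain v where v: "v \<in> Mor C s x" "Id C s = \<tau> \<cdot> v" by (rule tri_lift[OF t id_closed])
    have "hom_zero C s x" using A_orth[OF sA, of "Susp C x"] x T_subset by auto
    then have "Id C s = Zero C s s" using v hom_zeroD comp_zero_right[OF m(1)] by metis
    then show False using orth s by (simp add: orthogonal_collection_iff zero_object_iff_id)
  qed
  assume \<phi>: "\<phi> \<in> Mor C (l s) (l s)" and nz: "\<phi> \<noteq> Zero C (l s) (l s)"
  obtain \<psi> where \<psi>: "\<psi> \<in> Mor C s s" "\<phi> \<cdot> g = g \<cdot> \<psi>" by (rule tilt_hom_lift[OF s t t x \<phi>])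
  have "\<psi> \<noteq> Zero C s s" using \<psi> tilt_hom_restrict[OF t x s \<phi>] nz comp_zero_right[OF m(2)] by auto
  then have "is_iso C s s \<psi>" using orth s \<psi>(1) by (simp add: orthogonal_collection_iff)
  then obtain \<psi>' where \<psi>': "\<psi>' \<in> Mor C s s" "\<psi>' \<cdot> \<psi> = Id C s" "\<psi> \<cdot> \<psi>' = Id C s" by (rule is_isoE)
  have g\<psi>': "g \<cdot> \<psi>' \<in> Mor C s (l s)" by (rule comp_closed[OF \<psi>'(1) m(2)])
  have "(g \<cdot> \<psi>') \<cdot> \<tau> = Zero C x (l s)"
    using hom_zeroD[OF DT_tilt[OF s x, unfolded xT] comp_closed[OF m(1) g\<psi>']] .
  then obtain \<phi>' where \<phi>': "\<phi>' \<in> Mor C (l s) (l s)" "g \<cdot> \<psi>' = \<phi>' \<cdot> g" by (rule tri_extend[OF t g\<psi>'])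
  have unique: "\<alpha> = Id C (l s)" if \<alpha>: "\<alpha> \<in> Mor C (l s) (l s)" "\<alpha> \<cdot> g = g" for \<alpha>
    by (rule right_cancel[OF m(2) \<alpha>(1) id_closed])
      (use \<alpha>(2) id_left[OF m(2)] tilt_hom_restrict[OF t x s] in auto)
  have "(\<phi>' \<cdot> \<phi>) \<cdot> g = g"
  proof -
    have "(\<phi>' \<cdot> \<phi>) \<cdot> g = \<phi>' \<cdot> (g \<cdot> \<psi>)" using comp_assoc[OF m(2) \<phi> \<phi>'(1)] \<psi>(2) by simp
    also have "\<dots> = g \<cdot> (\<psi>' \<cdot> \<psi>)"
      using comp_assoc[OF \<psi>(1) m(2) \<phi>'(1)] comp_assoc[OF \<psi>(1) \<psi>'(1) m(2)] \<phi>'(2) by simp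
    finally show ?thesis using \<psi>'(2) id_right[OF m(2)] by simp
  qed
  moreover have "(\<phi> \<cdot> \<phi>') \<cdot> g = g"
  proof -
    have "(\<phi> \<cdot> \<phi>') \<cdot> g = \<phi> \<cdot> (g \<cdot> \<psi>')" using comp_assoc[OF m(2) \<phi>'(1) \<phi>] \<phi>'(2) by simp
    also have "\<dots> = g \<cdot> (\<psi> \<cdot> \<psi>')"
      using comp_assoc[OF \<psi>'(1) m(2) \<phi>] comp_assoc[OF \<psi>'(1) \<psi>(1) m(2)] \<psi>(2) by simp
    finally show ?thesis using \<psi>'(3) id_right[OF m(2)] by simp
  qed
  ultimately show "is_iso C (l s) (l s) \<phi>"
    using is_isoI[OF \<phi> \<phi>'(1) unique[OF comp_closed[OF \<phi> \<phi>'(1)]] unique[OF comp_closed[OF \<phi>'(1) \<phi>]]]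
    by simp
qed

text \<open>
  All cases but one reduce to the orthogonality of the heart or of the torsion pair.  From a tilted
  object to a shifted member of \<open>S'\<close> the shift is by one more than allowed, and in the last degree the
  Hom space is $\mathrm{Hom}(l s, \Sigma^{-w} u)$, dual to $\mathrm{Hom}(u, l s) = 0$.
\<close>

lemma tilt_hom_zero_desusp_pow:
  assumes s: "s \<in> S" and u: "u \<in> S" and i: "1 \<le> i" "i < w"
  shows "hom_zero C (l s) ((Desusp C ^^ i) (l u))"
proof -
  have A: "hom_zero C a ((Desusp C ^^ j) b)" if "a \<in> A" "b \<in> A" "1 \<le> j" "j < w" for a b j
    using orthogonal_ext_closure[OF orth that(3,4)] that(1,2) by (simp add: hom_orth_def)
  have sA: "s \<in> A" and uA: "u \<in> A" using s u ext_closure_superset by blast+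
  obtain j where j: "i = Suc j" using i by (cases i) auto
  have pow: "(Desusp C ^^ i) x = Desusp C ((Desusp C ^^ j) x)" for x using j by simp
  consider "s \<in> S'" "u \<in> S'" | "s \<in> S'" "u \<notin> S'" | "s \<notin> S'" "u \<in> S'" | "s \<notin> S'" "u \<notin> S'" by blast
  then show ?thesis
  proof cases
    case 1
    have "(Desusp C ^^ i) (Desusp C u) = Desusp C ((Desusp C ^^ i) u)" by (simp add: funpow_swap1)
    then show ?thesis using A[OF sA uA i] 1 by (simp add: tilt_inside hom_zero_desusp)
  next
    case 2
    then have lu: "l u \<in> F" using u tilt_in_F by blast
    have "hom_zero C s ((Desusp C ^^ j) (l u))"
    proof (cases "j = 0")
      case True
      then show ?thesis using T_F[OF _ lu] 2 ext_closure_superset by auto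
    next
      case False
      then show ?thesis using A[OF sA, of "l u" j] lu i j by simp
    qed
    then show ?thesis using 2 by (simp add: tilt_inside pow hom_zero_desusp)
  next
    case 3
    then have ls: "l s \<in> F" using s tilt_in_F by blast
    have e: "(Desusp C ^^ i) (l u) = (Desusp C ^^ Suc i) u" using 3 by (simp add: tilt_inside funpow_swap1)
    show ?thesis
    proof (cases "Suc i = w")
      case True
      \<comment> \<open>Here the shift leaves the range of orthogonality, and Serre duality takes over.\<close>
      have "hom_zero C u (l s)" using T_F[OF _ ls] 3 ext_closure_superset by blast
      then show ?thesis using serre e True unfolding serre_vanishing_def by simp
    next
      case False
      then show ?thesis using A[of "l s" u "Suc i"] ls uA i e by simp
    qed
  next
    case 4
    then show ?thesis using A[OF _ _ i] tilt_in_F s u by blast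
  qed
qed

lemma tilt_orthogonal: "orthogonal_collection C w L"
  unfolding orthogonal_collection_iff
proof (intro conjI)
  show "finite L" using orth by (simp add: orthogonal_collection_iff)
  have D: "semibrick C (Desusp C ` S')"
    using proper_semibrick_desusp[OF proper_S'] by (simp add: proper_semibrick_def)
  have nz: "\<not> zero_object C (l s)" if "s \<in> S" for s
    using tilt_endo(1)[of s] D that by (cases "s \<in> S'") (auto simp: tilt_inside semibrick_def)
  then show "\<forall>s\<in>L. \<not> zero_object C s" by blast
  have "is_iso C (l s) (l s) f" if "s \<in> S" "f \<in> Mor C (l s) (l s)" "f \<noteq> Zero C (l s) (l s)" for s f
    using tilt_endo(2)[of s f] D that by (cases "s \<in> S'") (auto simp: tilt_inside semibrick_def)
  then show "\<forall>s\<in>L. \<forall>f\<in>Mor C s s. f \<noteq> Zero C s s \<longrightarrow> is_iso C s s f" by blast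
  have "hom_zero C (l s) (l u)" if s: "s \<in> S" and u: "u \<in> S" and su: "s \<noteq> u" for s u
  proof -
    consider "s \<in> S'" "u \<in> S'" | "s \<in> S'" "u \<notin> S'" | "s \<notin> S'" "u \<in> S'" | "s \<notin> S'" "u \<notin> S'" by blast
    then show ?thesis
    proof cases
      case 1
      then show ?thesis using S_distinct[OF s u su] by (simp add: tilt_inside hom_zero_desusp)
    next
      case 2
      then show ?thesis using DT_tilt[of u s] u ext_closure_superset by (auto simp: tilt_inside)
    next
      case 3
      then show ?thesis
        using A_orth[of "l s" u] tilt_in_F[of s] s u ext_closure_superset by (auto simp: tilt_inside)
    next
      case 4
      then show ?thesis using tilt_distinct s u su by blast
    qed
  qed
  then show "\<forall>s\<in>L. \<forall>t\<in>L. s \<noteq> t \<longrightarrow> hom_zero C s t" by blast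
  show "\<forall>i\<in>{1..<w}. hom_orth C L ((Desusp C ^^ i) ` L)"
    using tilt_hom_zero_desusp_pow by (auto simp: hom_orth_def)
qed

subsection \<open>The tilted heart\<close>

text \<open>
  An object on the left is the fibre of a map $f \to t$ inside the original heart.  That fibre is an
  extension of the desuspended cokernel, a quotient of \<open>t\<close> and hence torsion, by the kernel, a subobject
  of \<open>f\<close> and hence torsion-free.
\<close>

lemma DT_F: "star C (Desusp C ` T) F \<subseteq> star C F (Desusp C ` T)"
proof
  fix e assume "e \<in> star C (Desusp C ` T) F"
  then obtain t f p q r where t: "t \<in> T" and f: "f \<in> F" and te: "Tri C (Desusp C t) e f p q r"
    by (auto elim!: starE)
  define r' where "r' = \<ominus>\<^bsub>Hom C t (Susp C e)\<^esub> SuspM C p"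
  have te': "Tri C e f t q r r'" using tri_rotate_fwd[OF te] by (simp add: r'_def)
  obtain k m b \<kappa> p' r1 i \<pi> d where K: "k \<in> A" "m \<in> A" "b \<in> A" "Tri C k f m \<kappa> p' r1" "Tri C m t b i \<pi> d"
    "r = i \<cdot> p'"
    by (rule ext_closure_factorization[OF semibrick_S _ _ tri_mor(2)[OF te']]) (use f t T_subset in auto)
  have kF: "k \<in> F" by (rule subobject_in_F[OF K(4,1) f K(2)])
  have bT: "b \<in> T" by (rule quotient_in_T[OF K(5,2) t K(3)])
  obtain x y z where "Tri C k e (Desusp C b) x y z"
    by (rule fibre_of_comp[OF K(4) tri_rotate_bwd[OF K(5)]]) (use te' K(6) in auto)
  from starI[OF this kF] show "e \<in> star C F (Desusp C ` T)" using bT by blast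
qed

lemma DT_tilted: "Desusp C ` T \<subseteq> ext_closure C L"
proof -
  have "Desusp C ` S' \<subseteq> L" using S' by (auto simp: tilt_inside[symmetric])
  from ext_closure_mono[OF this] show ?thesis by (simp add: ext_closure_desusp)
qed

text \<open>
  The product $F * \Sigma^{-1}T$ contains the tilted objects, and it is closed under extensions because
  its two factors may be interchanged in the required direction.
\<close>

lemma tilted_subset: "ext_closure C L \<subseteq> star C F (Desusp C ` T)"
proof (rule ext_closure_least)
  obtain z where z: "zero_object C z" using ex_zero_object by blast
  have zT: "z \<in> Desusp C ` T" using zero_in_ext_closure[OF z, of "Desusp C ` S'"] by (simp add: ext_closure_desusp)
  have F: "F \<subseteq> star C F (Desusp C ` T)" by (rule subsetI) (rule starI[OF tri_id[OF z] _ zT])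
  have DT: "Desusp C ` T \<subseteq> star C F (Desusp C ` T)"
    using starI[OF tri_id'[OF z] zero_in_F[OF z]] by blast
  show "L \<subseteq> star C F (Desusp C ` T)"
  proof (rule image_subsetI)
    fix s assume s: "s \<in> S"
    have "l s \<in> F \<union> Desusp C ` T"
      using tilt_in_F[of s] tilt_inside[of s] s ext_closure_superset[of S'] by (cases "s \<in> S'") auto
    then show "l s \<in> star C F (Desusp C ` T)" using F DT by blast
  qed
  show "{x. zero_object C x} \<subseteq> star C F (Desusp C ` T)" using zero_in_F F by blast
  have "star C (star C F (Desusp C ` T)) (star C F (Desusp C ` T))
      = star C F (star C (star C (Desusp C ` T) F) (Desusp C ` T))"
    by (simp add: star_assoc)
  also have "\<dots> \<subseteq> star C F (star C (star C F (Desusp C ` T)) (Desusp C ` T))"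
    by (intro star_mono DT_F subset_refl)
  also have "\<dots> = star C (star C F F) (star C (Desusp C ` T) (Desusp C ` T))"
    by (simp add: star_assoc)
  also have "\<dots> \<subseteq> star C F (Desusp C ` T)" by (intro star_mono F_star DT_star)
  finally show "star C (star C F (Desusp C ` T)) (star C F (Desusp C ` T)) \<subseteq> star C F (Desusp C ` T)" .
qed

text \<open>
  The extension \<open>f\<close> is classified by a map \<open>Desusp C t \<rightarrow> s\<close>, which factors through the cover.  The
  factor is a monomorphism since \<open>f\<close> receives no maps from torsion objects, so its cone lies in
  $\Sigma^{-1}T$; the octahedron then presents \<open>f\<close> as an extension of \<open>l s\<close> by that cone.
\<close>

lemma simple_by_torsion_in_tilted:
  assumes s: "s \<in> S - S'" and t: "t \<in> T" and f: "f \<in> F" and T: "Tri C s f t p q r"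
  shows "f \<in> ext_closure C L"
proof -
  note m = tri_mor[OF T]
  obtain x \<tau> g h where cov: "is_cover C (Desusp C ` T) x s \<tau>" and tr: "Tri C x s (l s) \<tau> g h"
    by (rule tilt_triangle[OF s])
  have pre: "is_precover C (Desusp C ` T) x s \<tau>" using cov by (simp add: is_cover_precover)
  have Dr: "DesuspM C r \<in> Mor C (Desusp C t) s" by (rule desusp_mor_from[OF m(3)])
  have T': "Tri C (Desusp C t) s f (DesuspM C r) (\<ominus>\<^bsub>Hom C s f\<^esub> p) q"
    using tri_neg_first[OF tri_rotate_bwd[OF T]] by (simp add: neg_neg[OF Dr])
  have tD: "Desusp C t \<in> Desusp C ` T" using t by blast
  obtain \<gamma> where \<gamma>: "\<gamma> \<in> Mor C (Desusp C t) x" "DesuspM C r = \<tau> \<cdot> \<gamma>"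
    by (rule precover_factor[OF pre tD Dr])
  have D: "ext_closure C (Desusp C ` S') = Desusp C ` T" by (simp add: ext_closure_desusp)
  obtain b u v where b: "b \<in> Desusp C ` T" and Tb: "Tri C (Desusp C t) x b \<gamma> u v"
  proof (rule cone_of_monomorphism[OF proper_semibrick_desusp[OF proper_S'], unfolded D])
    show "Desusp C t \<in> Desusp C ` T" "x \<in> Desusp C ` T" "\<gamma> \<in> Mor C (Desusp C t) x"
      using tD precover_mor(2)[OF pre] \<gamma>(1) by simp_all
    fix y k assume y: "y \<in> Desusp C ` T" and k: "k \<in> Mor C y (Desusp C t)" and z: "\<gamma> \<cdot> k = Zero C y x"
    have "DesuspM C r \<cdot> k = Zero C y s"
      using comp_assoc[OF k \<gamma>(1) tri_mor(1)[OF tr]] \<gamma>(2) z comp_zero_right[OF tri_mor(1)[OF tr]] by simp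
    moreover have "hom_zero C y (Desusp C f)" using y T_F[OF _ f] by (auto simp: hom_zero_desusp)
    ultimately show "k = Zero C y (Desusp C t)" using tri_mono[OF T' _ k] by simp
  qed
  obtain a c d where "Tri C b f (l s) a c d"
    using tri_octahedral[OF Tb tr] T' \<gamma>(2) by metis
  moreover have "l s \<in> ext_closure C L" using s ext_closure_superset[of L] by blast
  ultimately show ?thesis using ext_closure_extension b DT_tilted by blast
qed

text \<open>
  Let \<open>s\<close> be a simple subobject of \<open>f\<close>; it is not in \<open>S'\<close>.  Decompose the quotient \<open>f/s\<close> into a torsion
  part and a torsion-free part.  The torsion-free part is shorter than \<open>f\<close>, and the preimage of the
  torsion part is an extension as in the previous lemma.
\<close>

lemma F_tilted: "f \<in> F \<Longrightarrow> f \<in> ext_power C S n \<Longrightarrow> f \<in> ext_closure C L"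
proof (induction n arbitrary: f rule: less_induct)
  case (less n)
  note f = less.prems(1)
  show ?case
  proof (cases "hom_orth C S {f}")
    case True
    from hom_orth_ext_closure_left[OF True] have "hom_zero C f f" using f by (simp add: hom_orth_def)
    then show ?thesis using hom_zero_self zero_in_ext_closure by blast
  next
    case False
    then obtain s j where s: "s \<in> S" and j: "j \<in> Mor C s f" "j \<noteq> Zero C s f"
      unfolding hom_orth_def by (metis hom_zeroI singletonD)
    have sS': "s \<in> S - S'" using s j T_F[OF _ f] ext_closure_superset[of S'] hom_zeroD by blast
    obtain c e r where tc: "Tri C s f c j e r" using tri_complete[OF j(1)] by blast
    obtain m where m: "n = Suc m" "c \<in> ext_power C S m"
      using cone_of_simple_in_ext_power[OF semibrick_S s less.prems(2) tc j(2)] by blast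
    obtain t f2 a b d where t: "t \<in> T" and f2: "f2 \<in> right_perp C T \<inter> ext_power C S m"
      and tt: "Tri C t c f2 a b d"
      using torsion_decomposition[OF semibrick_S S' m(2)] by (rule starE)
    obtain f1 u v p q r' where f1: "Tri C f1 f f2 u (b \<cdot> e) v" and sf: "Tri C s f1 t p q r'"
      by (rule fibre_of_comp_exists[OF tc tt])
    have f2F: "f2 \<in> F" using f2 by (auto simp: ext_closure_def)
    have "f1 \<in> A" using ext_closure_extension[OF sf] s t T_subset ext_closure_superset by blast
    then have "f1 \<in> F" by (rule subobject_in_F[OF f1]) (use f f2F in auto)
    then have "f1 \<in> ext_closure C L" by (rule simple_by_torsion_in_tilted[OF sS' t _ sf])
    moreover have "f2 \<in> ext_closure C L" using less.IH[of m f2] f2F f2 m(1) by simp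
    ultimately show ?thesis by (rule ext_closure_extension[OF f1])
  qed
qed

lemma F_subset_tilted: "F \<subseteq> ext_closure C L"
  using F_tilted unfolding ext_closure_def[of C S] by blast

lemma tilted_eq: "ext_closure C L = star C F (Desusp C ` T)"
proof
  have "star C F (Desusp C ` T) \<subseteq> star C (ext_closure C L) (ext_closure C L)"
    by (intro star_mono F_subset_tilted DT_tilted)
  then show "star C F (Desusp C ` T) \<subseteq> ext_closure C L" using ext_closure_star[of L] by simp
qed (rule tilted_subset)

subsection \<open>Generation\<close>

text \<open>
  The precover by the heart that generation provides may carry superfluous torsion.  For an object
  without maps from \<open>T\<close> the cover sheds it, and the retract argument keeps the cone in the remaining
  product.
\<close>

lemma right_perp_subset:
  "right_perp C T \<subseteq> star C F (Desusp C ` desusp_star C A (w - 2))"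
proof
  fix y assume y: "y \<in> right_perp C T"
  let ?N = "Desusp C ` desusp_star C A (w - 2)"
  have N: "retract_closed C ?N"
    by (rule retract_closed_desusp[OF retract_closed_desusp_star[OF fin orth _ w]]) (use w in simp)
  have AN: "hom_orth C A ?N" by (rule hom_orth_desusp_star[OF orth]) (use w in simp)
  have "y \<in> star C A ?N" using simple_minded_star[OF sms w] by simp
  then obtain a \<tau> n g h where cov: "is_cover C A a y \<tau>" and t: "Tri C a y n \<tau> g h" and n: "n \<in> ?N"
    by (rule cover_cone_in[OF fin proper_S N AN _ id_closed id_closed id_left[OF id_closed]])
  have pre: "is_precover C A a y \<tau>" using cov by (simp add: is_cover_precover)
  note \<tau> = precover_mor(1)[OF pre] and a = precover_mor(2)[OF pre]
  \<comment> \<open>The torsion part of \<open>a\<close> dies in \<open>y\<close>, so minimality makes \<open>a\<close> a retract of its torsion-free part.\<close>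
  obtain t' f i p r where t': "t' \<in> T" and f: "f \<in> F" and tf: "Tri C t' a f i p r"
    using a A_torsion by (auto elim!: starE)
  note m = tri_mor[OF tf]
  have "hom_zero C t' y" using y t' by (auto simp: right_perp_eq hom_orth_def)
  then have "\<tau> \<cdot> i = Zero C t' y" using comp_closed[OF m(1) \<tau>] hom_zeroD by blast
  then obtain \<tau>' where \<tau>': "\<tau>' \<in> Mor C f y" "\<tau> = \<tau>' \<cdot> p" by (rule tri_extend[OF tf \<tau>])
  obtain \<gamma> where \<gamma>: "\<gamma> \<in> Mor C f a" "\<tau>' = \<tau> \<cdot> \<gamma>" by (rule precover_factor[OF pre _ \<tau>'(1)]) (use f in simp)
  have \<gamma>p: "\<gamma> \<cdot> p \<in> Mor C a a" by (rule comp_closed[OF m(2) \<gamma>(1)])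
  have "\<tau> \<cdot> (\<gamma> \<cdot> p) = \<tau>"
    by (simp add: comp_assoc[OF m(2) \<gamma>(1) \<tau>, symmetric] flip: \<gamma>(2) \<tau>'(2))
  then have "is_iso C a a (\<gamma> \<cdot> p)" using cov \<gamma>p by (simp add: is_cover_def)
  then obtain \<rho> where \<rho>: "\<rho> \<in> Mor C a a" "\<rho> \<cdot> (\<gamma> \<cdot> p) = Id C a" by (rule is_isoE)
  have "a \<in> F"
  proof (rule FI[OF a], rule hom_zeroI)
    fix u v assume u: "u \<in> T" and v: "v \<in> Mor C u a"
    have "p \<cdot> v = Zero C u f" by (rule hom_zeroD[OF T_F[OF u f] comp_closed[OF v m(2)]])
    then have "(\<gamma> \<cdot> p) \<cdot> v = Zero C u a" using comp_assoc[OF v m(2) \<gamma>(1)] comp_zero_right[OF \<gamma>(1)] by simp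
    then show "v = Zero C u a"
      using comp_assoc[OF v \<gamma>p \<rho>(1)] \<rho>(2) id_left[OF v] comp_zero_right[OF \<rho>(1)] by simp
  qed
  then show "y \<in> star C F ?N" using n by (rule starI[OF t])
qed

text \<open>
  Splitting every copy of the heart into $T * F$ and regrouping would leave a factor \<open>T\<close> in front, where
  a factor $\Sigma^{-w}T$ at the end is wanted.  The exchange is made by Serre duality: the torsion pair
  with torsion-free class \<open>T\<close>, shifted by $\Sigma^{-w}$, has a torsion class without maps from \<open>T\<close>.
\<close>

lemma tilt_generates: "desusp_star C (ext_closure C L) (w - 1) = UNIV"
proof -
  have w2: "Suc (Suc (w - 2)) = w" "Suc (w - 2) = w - 1" using w by simp_all
  have inv: "(Desusp C ^^ m) ((Susp C ^^ m) x) = x" for m x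
    by (induction m arbitrary: x) (simp_all add: funpow_swap1)
  have perp: "(Desusp C ^^ w) ` left_perp C T \<subseteq> right_perp C T"
    using serre by (auto simp: left_perp_eq right_perp_eq hom_orth_def serre_vanishing_def)
  have "UNIV = (Desusp C ^^ w) ` star C (left_perp C T) T"
    using star_left_perp_UNIV[OF fin sms w S'] surjI[of "Desusp C ^^ w", OF inv] by simp
  also have "\<dots> \<subseteq> star C (right_perp C T) ((Desusp C ^^ w) ` T)"
    unfolding star_desusp_pow[symmetric] by (intro star_mono perp subset_refl)
  also have "\<dots> \<subseteq> star C (star C F (Desusp C ` desusp_star C A (w - 2))) ((Desusp C ^^ w) ` T)"
    by (intro star_mono right_perp_subset subset_refl)
  also have "\<dots> \<subseteq> desusp_star C (ext_closure C L) (w - 1)"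
    using desusp_star_regroup[OF A_torsion equalityD2[OF tilted_eq], of "w - 2",
        unfolded w2(1), unfolded w2(2)] .
  finally show ?thesis by blast
qed

lemma tilt_simple_minded: "simple_minded_system C w L"
  unfolding simple_minded_system_def using tilt_orthogonal tilt_generates by blast

subsection \<open>Torsion pairs\<close>

lemma torsion_pair_of_star:
  assumes P: "proper_semibrick C P" and X: "iso_closed C X" "X \<subseteq> ext_closure C P"
    and Y: "iso_closed C Y" "Y \<subseteq> ext_closure C P" and XY: "hom_orth C X Y"
    and ex: "ext_closure C P \<subseteq> star C X Y"
  shows "torsion_pair C (ext_closure C P) X Y"
proof -
  have "\<exists>t\<in>X. \<exists>f\<in>Y. \<exists>i p. short_exact_in C (ext_closure C P) t a f i p" if a: "a \<in> ext_closure C P" for a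
  proof -
    obtain t f i p r where t: "t \<in> X" "f \<in> Y" "Tri C t a f i p r" using a ex by (auto elim!: starE)
    have "short_exact_in C (ext_closure C P) t a f i p"
      by (rule triangle_short_exact[OF proper_semibrick_orth[OF P] t(3)]) (use t X Y a in auto)
    then show ?thesis using t by blast
  qed
  then show ?thesis
    using X Y XY proper_semibrick_abelian[OF P]
    unfolding torsion_pair_def iso_closed_def hom_orth_def hom_zero_def by blast
qed

lemma torsion_pair_original: "torsion_pair C A T F"
  by (rule torsion_pair_of_star[OF proper_S ext_closure_iso_closed T_subset F_iso_closed _ _ A_torsion])
    (simp_all add: hom_orth_def T_F)

lemma torsion_pair_tilted: "torsion_pair C (ext_closure C L) F (Desusp C ` T)"
proof (rule torsion_pair_of_star[OF orthogonal_proper_semibrick[OF tilt_orthogonal w] F_iso_closed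
      F_subset_tilted _ DT_tilted])
  show "iso_closed C (Desusp C ` T)" using ext_closure_iso_closed[of "Desusp C ` S'"] by (simp add: ext_closure_desusp)
  show "hom_orth C F (Desusp C ` T)" using A_orth T_subset by (auto simp: hom_orth_def)
qed (simp add: tilted_eq)

end

section \<open>Tilting on both sides\<close>

lemma is_cover_op: "is_cover (op_cat C) X x c \<tau> \<longleftrightarrow> is_envelope C X c x \<tau>"
  by (simp add: is_cover_def is_envelope_def)

lemma epi_in_op: "epi_in (op_cat C) A x y f \<longleftrightarrow> mono_in C A y x f"
  by (auto simp: mono_in_def epi_in_def)

lemma abelian_subcategory_op:
  assumes "abelian_subcategory (op_cat C) A" shows "abelian_subcategory C A"
  using assms
  unfolding abelian_subcategory_def kernel_in_op cokernel_in_op mono_in_op epi_in_op biproduct_op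
    zero_object_op op_cat_simps
  by (elim conjE) (intro conjI; blast)

lemma short_exact_in_op: "short_exact_in (op_cat C) A x y z f g \<longleftrightarrow> short_exact_in C A z y x g f"
  by (auto simp: short_exact_in_def kernel_in_op cokernel_in_op)

context triangulated_category
begin

lemma torsion_pair_op:
  assumes "torsion_pair (op_cat C) A X Y" shows "torsion_pair C A Y X"
proof -
  have "isomorphic (op_cat C) x y \<longleftrightarrow> isomorphic C x y" for x y
    using isomorphic_op isomorphic_sym by metis
  then show ?thesis
    using assms abelian_subcategory_op[of C A]
    unfolding torsion_pair_def short_exact_in_op op_cat_simps
    by (elim conjE) (intro conjI; blast)
qed

text \<open>
  The dual of the zero space is zero, which is one implication.  The converse applies it to
  $\mathrm{Hom}(y, \Sigma^{-w}x)$, the dual of $\mathrm{Hom}(\Sigma^{-w}x, \Sigma^{-w}y)$, which is isomorphic to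
  $\mathrm{Hom}(x, y)$.
\<close>

lemma neg_calabi_yau_serre_vanishing:
  assumes cy: "neg_calabi_yau K C w"
  shows "serre_vanishing C w"
proof -
  interpret K: field K by (rule field_K)
  let ?D = "\<lambda>x y. dual_space K (Hom C y ((Desusp C ^^ w) x))"
  obtain \<phi> where \<phi>: "\<And>x y. \<phi> x y \<in> module_hom K (Hom C x y) (?D x y)"
      "\<And>x y. bij_betw (\<phi> x y) (Mor C x y) (carrier (?D x y))"
    using cy unfolding neg_calabi_yau_def Let_def by blast
  have 1: "hom_zero C x y" if z: "hom_zero C y ((Desusp C ^^ w) x)" for x y
  proof (rule hom_zeroI)
    fix f assume f: "f \<in> Mor C x y"
    let ?V = "Hom C y ((Desusp C ^^ w) x)"
    interpret V: abelian_group ?V by (rule hom_abelian)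
    have V: "carrier ?V = {\<zero>\<^bsub>?V\<^esub>}" using z by (simp add: hom_zero_def)
    have dual: "\<xi> \<zero>\<^bsub>?V\<^esub> = \<zero>\<^bsub>K\<^esub> \<and> \<xi> \<in> extensional (carrier ?V)" if \<xi>: "\<xi> \<in> carrier (?D x y)" for \<xi>
    proof -
      have c: "\<xi> \<zero>\<^bsub>?V\<^esub> \<in> carrier K" "\<xi> \<in> extensional (carrier ?V)"
        using \<xi> V.zero_closed by (auto simp: dual_space_def PiE_def)
      have "\<forall>u\<in>carrier ?V. \<forall>v\<in>carrier ?V. \<xi> (u \<oplus>\<^bsub>?V\<^esub> v) = \<xi> u \<oplus>\<^bsub>K\<^esub> \<xi> v"
        using \<xi> by (simp add: dual_space_def)
      then have "\<xi> (\<zero>\<^bsub>?V\<^esub> \<oplus>\<^bsub>?V\<^esub> \<zero>\<^bsub>?V\<^esub>) = \<xi> \<zero>\<^bsub>?V\<^esub> \<oplus>\<^bsub>K\<^esub> \<xi> \<zero>\<^bsub>?V\<^esub>"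
        using V.zero_closed by blast
      then show ?thesis using c K.add.r_cancel_one' by (metis V.l_zero V.zero_closed)
    qed
    have D: "\<phi> x y f \<in> carrier (?D x y)" "\<phi> x y (Zero C x y) \<in> carrier (?D x y)"
      using module_hom_closed[OF \<phi>(1)] f zero_mor by blast+
    have "\<phi> x y f = \<phi> x y (Zero C x y)"
    proof (rule extensionalityI[of _ "carrier ?V"])
      fix v assume "v \<in> carrier ?V"
      then have "v = \<zero>\<^bsub>?V\<^esub>" using V by simp
      then show "\<phi> x y f v = \<phi> x y (Zero C x y) v" using dual[OF D(1)] dual[OF D(2)] by simp
    qed (use dual D in blast)+
    then show "f = Zero C x y" using \<phi>(2) f zero_mor unfolding bij_betw_def inj_on_def by blast
  qed
  have 2: "hom_zero C ((Desusp C ^^ n) x) ((Desusp C ^^ n) y) \<longleftrightarrow> hom_zero C x y" for n x y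
    by (induction n) (simp_all add: hom_zero_desusp)
  show ?thesis unfolding serre_vanishing_def using 1 2 by metis
qed

lemma left_tilting_theorem:
  assumes fin: "hom_finite K C" and w: "2 \<le> w" and sms: "simple_minded_system C w S"
    and serre: "serre_vanishing C w" and S': "S' \<subseteq> S"
  shows "\<exists>L. left_tilt C S' S L"
    and "left_tilt C S' S L \<Longrightarrow> simple_minded_system C w L"
    and "left_tilt C S' S L \<Longrightarrow> torsion_pair C (ext_closure C S) (ext_closure C S')
      (right_perp C (ext_closure C S') \<inter> ext_closure C S)"
    and "left_tilt C S' S L \<Longrightarrow> torsion_pair C (ext_closure C L)
      (right_perp C (ext_closure C S') \<inter> ext_closure C S) (Desusp C ` ext_closure C S')"
proof -
  show "\<exists>L. left_tilt C S' S L" by (rule left_tilt_exists[OF fin sms w S'])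
  have t: "\<exists>l. L = l ` S \<and> left_tilting K C w S S' l" if tilt: "left_tilt C S' S L"
  proof -
    obtain l where l: "L = l ` S" "\<forall>s \<in> S'. l s = Desusp C s"
      "\<forall>s \<in> S - S'. \<exists>t \<tau> g h. is_cover C (Desusp C ` ext_closure C S') (Desusp C t) s \<tau> \<and>
         Tri C (Desusp C t) s (l s) \<tau> g h"
      using tilt unfolding left_tilt_def by blast
    have "left_tilting K C w S S' l"
      by unfold_locales (use assms l in auto)
    then show ?thesis using l by blast
  qed
  show "simple_minded_system C w L" if "left_tilt C S' S L"
    using t[OF that] left_tilting.tilt_simple_minded by blast
  show "torsion_pair C (ext_closure C S) (ext_closure C S')
      (right_perp C (ext_closure C S') \<inter> ext_closure C S)" if "left_tilt C S' S L"
    using t[OF that] left_tilting.torsion_pair_original by blast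
  show "torsion_pair C (ext_closure C L)
      (right_perp C (ext_closure C S') \<inter> ext_closure C S) (Desusp C ` ext_closure C S')"
    if "left_tilt C S' S L"
    using t[OF that] left_tilting.torsion_pair_tilted by blast
qed

lemma left_tilt_op: "left_tilt (op_cat C) S'' S R \<longleftrightarrow> right_tilt C S'' S R"
  unfolding left_tilt_def right_tilt_def
  by (simp add: is_cover_op ext_closure_op) (intro arg_cong[of _ _ Ex] ext; blast)

lemma right_tilting_theorem:
  assumes fin: "hom_finite K C" and w: "2 \<le> w" and sms: "simple_minded_system C w S"
    and serre: "serre_vanishing C w" and S'': "S'' \<subseteq> S"
  shows "\<exists>R. right_tilt C S'' S R"
    and "right_tilt C S'' S R \<Longrightarrow> simple_minded_system C w R"
    and "right_tilt C S'' S R \<Longrightarrow> torsion_pair C (ext_closure C S)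
      (left_perp C (ext_closure C S'') \<inter> ext_closure C S) (ext_closure C S'')"
    and "right_tilt C S'' S R \<Longrightarrow> torsion_pair C (ext_closure C R)
      (Susp C ` ext_closure C S'') (left_perp C (ext_closure C S'') \<inter> ext_closure C S)"
proof -
  interpret op: triangulated_category K "op_cat C" by (rule op_triangulated)
  have s: "simple_minded_system (op_cat C) w S" "serre_vanishing (op_cat C) w"
    using sms serre by (simp_all add: simple_minded_system_op serre_vanishing_op)
  note L = op.left_tilting_theorem[OF hom_finite_op[OF fin] w s S'']
  show "\<exists>R. right_tilt C S'' S R" using L(1) by (simp add: left_tilt_op)
  show "simple_minded_system C w R" if "right_tilt C S'' S R"
    using L(2)[of R] that by (simp add: left_tilt_op simple_minded_system_op)
  show "torsion_pair C (ext_closure C S)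
      (left_perp C (ext_closure C S'') \<inter> ext_closure C S) (ext_closure C S'')" if "right_tilt C S'' S R"
    using torsion_pair_op[OF L(3)[of R]] that
    by (simp add: left_tilt_op ext_closure_op right_perp_op)
  show "torsion_pair C (ext_closure C R)
      (Susp C ` ext_closure C S'') (left_perp C (ext_closure C S'') \<inter> ext_closure C S)"
    if "right_tilt C S'' S R"
    using torsion_pair_op[OF L(4)[of R]] that
    by (simp add: left_tilt_op ext_closure_op right_perp_op)
qed

end

theorem theoremC:
  fixes K :: "'k ring" and C :: "('k, 'o, 'm) tri_cat" and w :: nat
    and S S' S'' :: "'o set"
  assumes "triangulated_category K C" and "hom_finite K C" and "split_idempotents C"
    and "w \<ge> 2" and "simple_minded_system C w S" and "neg_calabi_yau K C w"
    and "S' \<subseteq> S" and "S'' \<subseteq> S"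
  shows "(let T = ext_closure C S'; F = right_perp C (ext_closure C S') \<inter> ext_closure C S in
           (\<exists>L. left_tilt C S' S L) \<and>
           (\<forall>L. left_tilt C S' S L \<longrightarrow>
              simple_minded_system C w L \<and>
              torsion_pair C (ext_closure C S) T F \<and>
              torsion_pair C (ext_closure C L) F (Desusp C ` T))) \<and>
         (let U = left_perp C (ext_closure C S'') \<inter> ext_closure C S; G = ext_closure C S'' in
           (\<exists>R. right_tilt C S'' S R) \<and>
           (\<forall>R. right_tilt C S'' S R \<longrightarrow>
              simple_minded_system C w R \<and>
              torsion_pair C (ext_closure C S) U G \<and>
              torsion_pair C (ext_closure C R) (Susp C ` G) U))"
proof -
  interpret triangulated_category K C by (rule assms(1))
  have serre: "serre_vanishing C w" by (rule neg_calabi_yau_serre_vanishing[OF assms(6)])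
  show ?thesis
    unfolding Let_def
    using left_tilting_theorem[OF assms(2,4,5) serre assms(7)]
      right_tilting_theorem[OF assms(2,4,5) serre assms(8)] by blast
qed

end
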